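(* Let $\mathcal{H}$ be a separable complex Hilbert space, $K$ a bounded operator on $\mathcal{H}$ with $0\le K\le 1$, and $(\rho_K,\mathcal{H}_K,\Omega_K)$ the GNS triple of the quasi-free state $\varphi_K$ on the GICAR algebra $\mathfrak{I}(\mathcal{H})$. Let $A$ be a self-adjoint operator on $\mathcal{H}$ and $U_t:=e^{\mathrm{i}tA}$ ($t\in\mathbb{R}$). If $A$ commutes with $K$, then the following hold. (1) There exists a unique strongly continuous one-parameter group $(\Gamma_K(U_t))_{t\in\mathbb{R}}$ of unitary operators on $\mathcal{H}_K$ such that $\Gamma_K(U_t)\rho_K(x)\Omega_K=\rho_K(\gamma_{U_t}(x))\Omega_K$ for every $x\in\mathfrak{I}(\mathcal{H})$ and $t\in\mathbb{R}$. (2) Let $d\Gamma_K(A)$ denote the infinitesimal generator of $(\Gamma_K(U_t))_{t\in\mathbb{R}}$. If $\mathcal{V}$ is a dense subspace of $\mathcal{H}$ such that $\mathcal{V}\subset\mathrm{dom}(A)$ and $U_t\mathcal{V}\subset\mathcal{V}$ for every $t\in\mathbb{R}$, then $$\widetilde{\mathcal{V}}:=\mathrm{span}\{\rho_K(a^*(h_1)\cdots a^*(h_n)a(k_1)\cdots a(k_n))\Omega_K\mid n\ge 0,\ h_1,\dots,h_n,k_1,\dots,k_n\in\mathcal{V}\}$$ is a core of $d\Gamma_K(A)$.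
   Context: Inner products are linear in the first argument. For a separable complex Hilbert space $\mathcal{H}$, the CAR algebra $\mathfrak{A}(\mathcal{H})$ is the universal unital $C^*$-algebra generated by $a(h)$ ($h\in\mathcal{H}$) such that $h\mapsto a^*(h):=a(h)^*$ is linear and $a(h)a(k)+a(k)a(h)=0$, $a^*(h)a(k)+a(k)a^*(h)=\langle h,k\rangle 1$. For a unitary $U$ on $\mathcal{H}$, $\gamma_U$ is the $*$-automorphism of $\mathfrak{A}(\mathcal{H})$ with $\gamma_U(a(h))=a(Uh)$. The GICAR algebra $\mathfrak{I}(\mathcal{H})$ is the $C^*$-subalgebra of elements fixed by $\gamma_{\lambda 1}$ for all $\lambda\in\mathbb{T}$; it is generated by the elements $a^*(h)a(k)$ and is invariant under every $\gamma_U$. For $0\le K\le1$, the quasi-free state $\varphi_K$ is the unique state on $\mathfrak{A}(\mathcal{H})$ with $\varphi_K(a^*(h_n)\cdots a^*(h_1)a(k_1)\cdots a(k_m))=\delta_{n,m}\det[\langle Kh_i,k_j\rangle]_{i,j=1}^n$; its restriction to $\mathfrak{I}(\mathcal{H})$ is denoted by the same symbol, and $(\rho_K,\mathcal{H}_K,\Omega_K)$ is the GNS triple of this restriction: $\rho_K$ is a $*$-representation of $\mathfrak{I}(\mathcal{H})$ on $\mathcal{H}_K$ with unit cyclic vector $\Omega_K$ and $\langle\rho_K(x)\Omega_K,\Omega_K\rangle=\varphi_K(x)$. "$A$ commutes with $K$" means $U_tK=KU_t$ for all $t$. The generator $d\Gamma_K(A)$ is the self-adjoint operator with $\Gamma_K(U_t)=e^{\mathrm{i}t\,d\Gamma_K(A)}$.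 The term $n=0$ in $\widetilde{\mathcal V}$ is the vector $\Omega_K$. *)

theory Defs
  imports
    "HOL-Analysis.Analysis"
    "HOL-Library.Poly_Mapping"
    "Jordan_Normal_Form.Determinant"
begin

section \<open>Complex Hilbert spaces and unital C*-algebras\<close>

class complex_vector = real_vector +
  fixes scaleC :: "complex \<Rightarrow> 'a \<Rightarrow> 'a"  (infixr "*\<^sub>C" 75)
  assumes scaleC_add_right: "c *\<^sub>C (x + y) = c *\<^sub>C x + c *\<^sub>C y"
    and scaleC_add_left: "(c + d) *\<^sub>C x = c *\<^sub>C x + d *\<^sub>C x"
    and scaleC_scaleC: "c *\<^sub>C d *\<^sub>C x = (c * d) *\<^sub>C x"
    and scaleC_one: "1 *\<^sub>C x = x"
    and scaleR_scaleC: "r *\<^sub>R x = complex_of_real r *\<^sub>C x"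

global_interpretation complex_vector:
  vector_space "scaleC :: complex \<Rightarrow> 'a \<Rightarrow> 'a :: complex_vector"
  by unfold_locales (simp_all add: scaleC_add_right scaleC_add_left scaleC_scaleC scaleC_one)

abbreviation clinear :: "('a::complex_vector \<Rightarrow> 'b::complex_vector) \<Rightarrow> bool"
  where "clinear \<equiv> Vector_Spaces.linear scaleC scaleC"

abbreviation csubspace :: "'a::complex_vector set \<Rightarrow> bool"
  where "csubspace \<equiv> complex_vector.subspace"

abbreviation cspan :: "'a::complex_vector set \<Rightarrow> 'a set"
  where "cspan \<equiv> complex_vector.span"

instantiation prod :: (complex_vector, complex_vector) complex_vector
begin
definition scaleC_prod :: "complex \<Rightarrow> 'a \<times> 'b \<Rightarrow> 'a \<times> 'b"
  where "scaleC_prod c p = (c *\<^sub>C fst p, c *\<^sub>C snd p)"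
instance
  by standard (auto simp: scaleC_prod_def scaleC_add_right scaleC_add_left scaleC_scaleC
      scaleC_one scaleR_scaleC prod_eq_iff)
end

(* Norm, metric and topology are those of the underlying real inner product Re <x,y>,
   so that norm x ^ 2 = <x,x>. The inner product is linear in its first argument. *)
class complex_hilbert_space = complex_vector + real_inner + complete_space +
  fixes cinner :: "'a \<Rightarrow> 'a \<Rightarrow> complex"
  assumes cinner_add_left: "cinner (x + y) z = cinner x z + cinner y z"
    and cinner_scaleC_left: "cinner (c *\<^sub>C x) y = c * cinner x y"
    and cinner_commute: "cinner x y = cnj (cinner y x)"
    and inner_eq_Re_cinner: "inner x y = Re (cinner x y)"

class unital_cstar_algebra = complex_vector + real_normed_algebra_1 + complete_space +
  fixes star :: "'a \<Rightarrow> 'a"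
  assumes mult_scaleC_left: "(c *\<^sub>C x) * y = c *\<^sub>C (x * y)"
    and mult_scaleC_right: "x * (c *\<^sub>C y) = c *\<^sub>C (x * y)"
    and norm_scaleC: "norm (c *\<^sub>C x) = cmod c * norm x"
    and star_add: "star (x + y) = star x + star y"
    and star_scaleC: "star (c *\<^sub>C x) = cnj c *\<^sub>C star x"
    and star_mult: "star (x * y) = star y * star x"
    and star_star: "star (star x) = x"
    and cstar_identity: "norm (star x * x) = (norm x)\<^sup>2"

definition unital_star_hom ::
    "('a::unital_cstar_algebra \<Rightarrow> 'b::unital_cstar_algebra) \<Rightarrow> bool" where
  "unital_star_hom f \<longleftrightarrow> clinear f \<and> (\<forall>x y. f (x * y) = f x * f y) \<and>
     (\<forall>x. f (star x) = star (f x)) \<and> f 1 = 1"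

definition star_automorphism :: "('a::unital_cstar_algebra \<Rightarrow> 'a) \<Rightarrow> bool" where
  "star_automorphism f \<longleftrightarrow> unital_star_hom f \<and> bij f"

definition state :: "('a::unital_cstar_algebra \<Rightarrow> complex) \<Rightarrow> bool" where
  "state \<phi> \<longleftrightarrow> Vector_Spaces.linear scaleC (*) \<phi> \<and> (\<forall>x. \<phi> (star x * x) \<in> \<real>\<^sub>\<ge>\<^sub>0) \<and>
     bounded_linear \<phi> \<and> onorm \<phi> = 1"


section \<open>Universal C*-algebras\<close>

(* The free unital *-algebra on a set of generators is the monoid algebra, over the complex
   numbers, of words in the letters g and g*. *)
datatype 'g letter = Gen 'g | Gen_star 'g

fun letter_star :: "'g letter \<Rightarrow> 'g letter" where
  "letter_star (Gen g) = Gen_star g"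
| "letter_star (Gen_star g) = Gen g"

datatype 'g word = Word (letters: "'g letter list")

instantiation word :: (type) monoid_add
begin
definition zero_word :: "'a word" where "0 = Word []"
definition plus_word :: "'a word \<Rightarrow> 'a word \<Rightarrow> 'a word"
  where "u + v = Word (letters u @ letters v)"
instance by standard (auto simp: zero_word_def plus_word_def)
end

type_synonym 'g free_star_algebra = "'g word \<Rightarrow>\<^sub>0 complex"

definition free_const :: "complex \<Rightarrow> 'g free_star_algebra" where
  "free_const c = Poly_Mapping.single 0 c"

definition free_gen :: "'g \<Rightarrow> 'g free_star_algebra" where
  "free_gen g = Poly_Mapping.single (Word [Gen g]) 1"

definition word_star :: "'g word \<Rightarrow> 'g word" where
  "word_star w = Word (map letter_star (rev (letters w)))"

definition free_star :: "'g free_star_algebra \<Rightarrow> 'g free_star_algebra" where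
  "free_star x = (\<Sum>w\<in>Poly_Mapping.keys x.
     Poly_Mapping.single (word_star w) (cnj (Poly_Mapping.lookup x w)))"

fun eval_letter :: "('g \<Rightarrow> 'a::unital_cstar_algebra) \<Rightarrow> 'g letter \<Rightarrow> 'a" where
  "eval_letter a (Gen g) = a g"
| "eval_letter a (Gen_star g) = star (a g)"

definition eval_word :: "('g \<Rightarrow> 'a::unital_cstar_algebra) \<Rightarrow> 'g word \<Rightarrow> 'a" where
  "eval_word a w = prod_list (map (eval_letter a) (letters w))"

definition eval_free :: "('g \<Rightarrow> 'a::unital_cstar_algebra) \<Rightarrow> 'g free_star_algebra \<Rightarrow> 'a" where
  "eval_free a x = (\<Sum>w\<in>Poly_Mapping.keys x. Poly_Mapping.lookup x w *\<^sub>C eval_word a w)"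

lemma eval_free_superset:
  assumes "finite S" "Poly_Mapping.keys x \<subseteq> S"
  shows "eval_free a x = (\<Sum>w\<in>S. Poly_Mapping.lookup x w *\<^sub>C eval_word a w)"
  unfolding eval_free_def
  by (rule sum.mono_neutral_left) (use assms in \<open>auto simp: in_keys_iff\<close>)

lemma eval_free_add: "eval_free a (x + y) = eval_free a x + eval_free a y"
proof -
  let ?S = "Poly_Mapping.keys x \<union> Poly_Mapping.keys y"
  have "eval_free a z = (\<Sum>w\<in>?S. Poly_Mapping.lookup z w *\<^sub>C eval_word a w)"
    if "z \<in> {x, y, x + y}" for z
    by (rule eval_free_superset) (use that Poly_Mapping.keys_add[of x y] in auto)
  then show ?thesis
    by (simp add: lookup_add scaleC_add_left sum.distrib)
qed

lemma eval_free_single: "eval_free a (Poly_Mapping.single w c) = c *\<^sub>C eval_word a w"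
  by (subst eval_free_superset[of "{w}"]) auto

lemma eval_free_diff: "eval_free a (x - y) = eval_free a x - eval_free a y"
  by (metis eval_free_add diff_add_cancel eq_diff_eq)

lemma eval_free_mult: "eval_free a (x * y) = eval_free a x * eval_free a y"
proof -
  have ew: "eval_word a (u + v) = eval_word a u * eval_word a v" for u v
    by (simp add: eval_word_def plus_word_def)
  have s: "eval_free a (Poly_Mapping.single u c * y) = eval_free a (Poly_Mapping.single u c) * eval_free a y" for u c y
  proof (induction y rule: update_induct)
    case const
    have "eval_free a 0 = 0" by (simp add: eval_free_def)
    then show ?case by simp
  next
    case (update f v d)
    have "Poly_Mapping.update v d f = f + Poly_Mapping.single v d"
      using update by (intro poly_mapping_eqI) (auto simp: lookup_update lookup_add lookup_single when_def in_keys_iff)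
    then show ?case using update by (simp add: distrib_left mult_single eval_free_add eval_free_single ew
      mult_scaleC_left mult_scaleC_right scaleC_scaleC mult.commute)
  qed
  show ?thesis
  proof (induction x rule: update_induct)
    case const
    have "eval_free a 0 = 0" by (simp add: eval_free_def)
    then show ?case by simp
  next
    case (update f v d)
    have "Poly_Mapping.update v d f = f + Poly_Mapping.single v d"
      using update by (intro poly_mapping_eqI) (auto simp: lookup_update lookup_add lookup_single when_def in_keys_iff)
    then show ?case using update s by (simp add: distrib_right eval_free_add)
  qed
qed

lemma eval_free_const: "eval_free a (free_const c) = c *\<^sub>C 1"
  by (simp add: free_const_def eval_free_single eval_word_def zero_word_def)

lemma eval_free_star: "eval_free a (free_star x) = star (eval_free a x)"
  for a :: "'b \<Rightarrow> 'a::unital_cstar_algebra"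
proof -
  have star_0: "star 0 = (0 :: 'a :: unital_cstar_algebra)"
    using star_add[of 0 "0 :: 'a"] by simp
  have star_1: "star 1 = (1 :: 'a :: unital_cstar_algebra)"
    by (metis mult_1_left star_mult star_star)
  have letter: "eval_letter a (letter_star l) = star (eval_letter a l)" for a :: "'b \<Rightarrow> 'a" and l
    by (cases l) (simp_all add: star_star)
  have list: "prod_list (map (eval_letter a) (map letter_star (rev ls))) =
      star (prod_list (map (eval_letter a) ls))" for a :: "'b \<Rightarrow> 'a" and ls
    by (induction ls) (simp_all add: star_1 star_mult letter)
  have word: "eval_word a (word_star w) = star (eval_word a w)" for w
    using list[of a "letters w"] by (simp add: eval_word_def word_star_def)
  have ev_sum: "eval_free a (\<Sum>w\<in>S. f w) = (\<Sum>w\<in>S. eval_free a (f w))" for S and f :: "_ \<Rightarrow> 'b free_star_algebra"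
    by (induction S rule: infinite_finite_induct)
      (simp_all add: eval_free_add, simp_all add: eval_free_def)
  have star_sum: "star (\<Sum>w\<in>S. f w) = (\<Sum>w\<in>S. star (f w))" for S and f :: "'b word \<Rightarrow> 'a"
    by (induction S rule: infinite_finite_induct) (simp_all add: star_0 star_add)
  show ?thesis
    unfolding free_star_def ev_sum eval_free_single word
    by (simp add: eval_free_def star_sum star_scaleC)
qed

definition free_cstar_seminorm :: "('g free_star_algebra \<Rightarrow> real) \<Rightarrow> bool" where
  "free_cstar_seminorm p \<longleftrightarrow>
     (\<forall>x. 0 \<le> p x) \<and> (\<forall>x y. p (x + y) \<le> p x + p y) \<and>
     (\<forall>c x. p (free_const c * x) = cmod c * p x) \<and>
     (\<forall>x y. p (x * y) \<le> p x * p y) \<and> (\<forall>x. p (free_star x * x) = (p x)\<^sup>2)"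

(* A unital C*-algebra B generated by a family b satisfying the relations R is, up to
   isomorphism, the same as a C*-seminorm p x = norm (eval_free b x) on the free *-algebra
   vanishing on R: conversely, B is the completion of the quotient by the null space of p.
   A *-homomorphism sending each a g to b g exists iff p x <= norm (eval_free a x) for all x, and it
   is unique because a generates. Hence the last two conditions are the universal property of
   ('a, a) with respect to all unital C*-algebras, which HOL types cannot quantify over. *)
definition universal_cstar_algebra ::
    "'g free_star_algebra set \<Rightarrow> ('g \<Rightarrow> 'a::unital_cstar_algebra) \<Rightarrow> bool" where
  "universal_cstar_algebra R a \<longleftrightarrow>
     (\<forall>r\<in>R. eval_free a r = 0) \<and>
     closure (range (eval_free a)) = UNIV \<and>
     (\<forall>p. free_cstar_seminorm p \<and> (\<forall>r\<in>R. p r = 0) \<longrightarrow> (\<forall>x. p x \<le> norm (eval_free a x)))"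

lemma free_cstar_seminorm_norm_eval: "free_cstar_seminorm (\<lambda>x. norm (eval_free b x))"
  by (simp add: free_cstar_seminorm_def eval_free_add eval_free_mult eval_free_star eval_free_const
      norm_triangle_ineq norm_mult_ineq cstar_identity mult_scaleC_left norm_scaleC)

lemma universal_cstar_algebra_norm_le:
  assumes "universal_cstar_algebra R a" "\<forall>r\<in>R. eval_free b r = 0"
  shows "norm (eval_free b x) \<le> norm (eval_free a x)"
proof -
  have max: "\<forall>p. free_cstar_seminorm p \<and> (\<forall>r\<in>R. p r = 0) \<longrightarrow>
      (\<forall>x. p x \<le> norm (eval_free a x))"
    using assms(1) unfolding universal_cstar_algebra_def by (elim conjE)
  have "\<forall>r\<in>R. norm (eval_free b r) = 0"
    using assms(2) by simp
  then show ?thesis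
    using max[THEN spec, of "\<lambda>x. norm (eval_free b x)"] free_cstar_seminorm_norm_eval[of b]
    by blast
qed


section \<open>CAR and GICAR algebras\<close>

definition CAR_relations :: "'h::complex_hilbert_space free_star_algebra set" where
  "CAR_relations =
     {free_star (free_gen (c *\<^sub>C h + d *\<^sub>C k)) -
        (free_const c * free_star (free_gen h) + free_const d * free_star (free_gen k)) | c d h k. True} \<union>
     {free_gen h * free_gen k + free_gen k * free_gen h | h k. True} \<union>
     {free_star (free_gen h) * free_gen k + free_gen k * free_star (free_gen h) -
        free_const (cinner h k) | h k. True}"

lemma eval_CAR_relations:
  fixes a :: "'a::complex_hilbert_space \<Rightarrow> 'b::unital_cstar_algebra"
  shows "(\<forall>r\<in>CAR_relations. eval_free a r = 0) \<longleftrightarrow>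
     (\<forall>c d h k. star (a (c *\<^sub>C h + d *\<^sub>C k)) = c *\<^sub>C star (a h) + d *\<^sub>C star (a k)) \<and>
     (\<forall>h k. a h * a k + a k * a h = 0) \<and>
     (\<forall>h k. star (a h) * a k + a k * star (a h) = cinner h k *\<^sub>C 1)"
proof -
  have gen: "eval_free a (free_gen h) = a h" and star: "eval_free a (free_star (free_gen h)) = star (a h)" for h
    by (simp_all add: free_gen_def eval_free_star eval_free_single eval_word_def scaleC_one)
  have ball: "(\<forall>r\<in>{f c d h k | c d h k. True}. P r) \<longleftrightarrow> (\<forall>c d h k. P (f c d h k))"
    "(\<forall>r\<in>{g h k | h k. True}. P r) \<longleftrightarrow> (\<forall>h k. P (g h k))"
    for f :: "complex \<Rightarrow> complex \<Rightarrow> 'a \<Rightarrow> 'a \<Rightarrow> 'a free_star_algebra" and g :: "'a \<Rightarrow> 'a \<Rightarrow> 'a free_star_algebra" and P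
    by blast+
  show ?thesis
    unfolding CAR_relations_def ball_Un ball eval_free_diff eval_free_add eval_free_mult star gen
      eval_free_const mult_scaleC_left mult_1_left right_minus_eq conj_assoc ..
qed

definition CAR_algebra :: "('h::complex_hilbert_space \<Rightarrow> 'a::unital_cstar_algebra) \<Rightarrow> bool" where
  "CAR_algebra a \<longleftrightarrow> universal_cstar_algebra CAR_relations a"

definition bogoliubov ::
    "('h \<Rightarrow> 'a::unital_cstar_algebra) \<Rightarrow> ('h \<Rightarrow> 'h) \<Rightarrow> 'a \<Rightarrow> 'a" where
  "bogoliubov a U = (THE \<gamma>. star_automorphism \<gamma> \<and> (\<forall>h. \<gamma> (a h) = a (U h)))"

definition GICAR :: "('h::complex_hilbert_space \<Rightarrow> 'a::unital_cstar_algebra) \<Rightarrow> 'a set" where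
  "GICAR a = {x. \<forall>z. cmod z = 1 \<longrightarrow> bogoliubov a (\<lambda>h. z *\<^sub>C h) x = x}"

definition creations :: "('h \<Rightarrow> 'a::unital_cstar_algebra) \<Rightarrow> 'h list \<Rightarrow> 'a" where
  "creations a hs = prod_list (map (\<lambda>h. star (a h)) hs)"

definition annihilations :: "('h \<Rightarrow> 'a::unital_cstar_algebra) \<Rightarrow> 'h list \<Rightarrow> 'a" where
  "annihilations a ks = prod_list (map a ks)"

definition quasi_free_state ::
    "('h::complex_hilbert_space \<Rightarrow> 'a::unital_cstar_algebra) \<Rightarrow> ('h \<Rightarrow> 'h) \<Rightarrow> ('a \<Rightarrow> complex) \<Rightarrow> bool" where
  "quasi_free_state a K \<phi> \<longleftrightarrow> state \<phi> \<and>
     (\<forall>hs ks. \<phi> (creations a (rev hs) * annihilations a ks) =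
        (if length hs = length ks
         then Determinant.det (mat (length hs) (length hs) (\<lambda>(i, j). cinner (K (hs ! i)) (ks ! j)))
         else 0))"


section \<open>Bounded and unbounded operators\<close>

definition bounded_operator ::
    "('h::complex_hilbert_space \<Rightarrow> 'k::complex_hilbert_space) \<Rightarrow> bool" where
  "bounded_operator T \<longleftrightarrow> clinear T \<and> bounded_linear T"

definition positive_operator :: "('h::complex_hilbert_space \<Rightarrow> 'h) \<Rightarrow> bool" where
  "positive_operator T \<longleftrightarrow> bounded_operator T \<and> (\<forall>x. cinner (T x) x \<in> \<real>\<^sub>\<ge>\<^sub>0)"

definition unitary_operator :: "('h::complex_hilbert_space \<Rightarrow> 'h) \<Rightarrow> bool" where
  "unitary_operator U \<longleftrightarrow> clinear U \<and> surj U \<and> (\<forall>x y. cinner (U x) (U y) = cinner x y)"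

(* Unbounded operators are identified with their graphs; the domain is then Domain. *)
type_synonym 'h unbounded_operator = "('h \<times> 'h) set"

definition linear_operator :: "'h::complex_hilbert_space unbounded_operator \<Rightarrow> bool" where
  "linear_operator A \<longleftrightarrow> csubspace A \<and> single_valued A"

definition adjoint_operator ::
    "'h::complex_hilbert_space unbounded_operator \<Rightarrow> 'h unbounded_operator" where
  "adjoint_operator A = {(y, z). \<forall>(x, w)\<in>A. cinner w y = cinner x z}"

definition self_adjoint :: "'h::complex_hilbert_space unbounded_operator \<Rightarrow> bool" where
  "self_adjoint A \<longleftrightarrow>
     linear_operator A \<and> closure (Domain A) = UNIV \<and> adjoint_operator A = A"

definition is_core :: "'h::complex_hilbert_space set \<Rightarrow> 'h unbounded_operator \<Rightarrow> bool" where
  "is_core D A \<longleftrightarrow> csubspace D \<and> D \<subseteq> Domain A \<and> closure (A \<inter> (D \<times> UNIV)) = A"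

definition unitary_group :: "(real \<Rightarrow> 'h::complex_hilbert_space \<Rightarrow> 'h) \<Rightarrow> bool" where
  "unitary_group U \<longleftrightarrow> (\<forall>t. unitary_operator (U t)) \<and>
     (\<forall>s t. U (s + t) = U s \<circ> U t) \<and> (\<forall>x. continuous_on UNIV (\<lambda>t. U t x))"

(* The factor 1/i is the convention under which U t = exp (i t A) has generator A. *)
definition generator ::
    "(real \<Rightarrow> 'h::complex_hilbert_space \<Rightarrow> 'h) \<Rightarrow> 'h unbounded_operator" where
  "generator U = {(x, y). ((\<lambda>t. (1 / (\<i> * of_real t)) *\<^sub>C (U t x - x)) \<longlongrightarrow> y) (at 0)}"

(* exp (i t A) for self-adjoint A, characterized by Stone's theorem as the unique strongly
   continuous unitary group with generator A. *)
definition exp_i :: "'h::complex_hilbert_space unbounded_operator \<Rightarrow> real \<Rightarrow> 'h \<Rightarrow> 'h" where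
  "exp_i A = (THE U. unitary_group U \<and> generator U = A)"


section \<open>GNS representation and second quantization\<close>

(* Representation of a *-subalgebra S by bounded operators; values of \<rho> outside S are
   irrelevant. *)
definition star_representation ::
    "'a::unital_cstar_algebra set \<Rightarrow> ('a \<Rightarrow> 'k::complex_hilbert_space \<Rightarrow> 'k) \<Rightarrow> bool" where
  "star_representation S \<rho> \<longleftrightarrow>
     (\<forall>x\<in>S. bounded_operator (\<rho> x)) \<and>
     (\<forall>x\<in>S. \<forall>y\<in>S. \<forall>\<xi>. \<rho> (x + y) \<xi> = \<rho> x \<xi> + \<rho> y \<xi>) \<and>
     (\<forall>x\<in>S. \<forall>c \<xi>. \<rho> (c *\<^sub>C x) \<xi> = c *\<^sub>C \<rho> x \<xi>) \<and>
     (\<forall>x\<in>S. \<forall>y\<in>S. \<rho> (x * y) = \<rho> x \<circ> \<rho> y) \<and>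
     (\<forall>x\<in>S. \<forall>\<xi> \<eta>. cinner (\<rho> (star x) \<xi>) \<eta> = cinner \<xi> (\<rho> x \<eta>))"

definition GNS_triple ::
    "'a::unital_cstar_algebra set \<Rightarrow> ('a \<Rightarrow> complex) \<Rightarrow>
     ('a \<Rightarrow> 'k::complex_hilbert_space \<Rightarrow> 'k) \<Rightarrow> 'k \<Rightarrow> bool" where
  "GNS_triple S \<phi> \<rho> \<Omega> \<longleftrightarrow> star_representation S \<rho> \<and> norm \<Omega> = 1 \<and>
     closure ((\<lambda>x. \<rho> x \<Omega>) ` S) = UNIV \<and> (\<forall>x\<in>S. cinner (\<rho> x \<Omega>) \<Omega> = \<phi> x)"

definition is_second_quantization ::
    "('h::complex_hilbert_space \<Rightarrow> 'a::unital_cstar_algebra) \<Rightarrow>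
     ('a \<Rightarrow> 'k::complex_hilbert_space \<Rightarrow> 'k) \<Rightarrow> 'k \<Rightarrow>
     (real \<Rightarrow> 'h \<Rightarrow> 'h) \<Rightarrow> (real \<Rightarrow> 'k \<Rightarrow> 'k) \<Rightarrow> bool" where
  "is_second_quantization a \<rho> \<Omega> U \<Gamma> \<longleftrightarrow> unitary_group \<Gamma> \<and>
     (\<forall>t. \<forall>x\<in>GICAR a. \<Gamma> t (\<rho> x \<Omega>) = \<rho> (bogoliubov a (U t) x) \<Omega>)"

definition second_quantization ::
    "('h::complex_hilbert_space \<Rightarrow> 'a::unital_cstar_algebra) \<Rightarrow>
     ('a \<Rightarrow> 'k::complex_hilbert_space \<Rightarrow> 'k) \<Rightarrow> 'k \<Rightarrow>
     (real \<Rightarrow> 'h \<Rightarrow> 'h) \<Rightarrow> real \<Rightarrow> 'k \<Rightarrow> 'k" where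
  "second_quantization a \<rho> \<Omega> U = (THE \<Gamma>. is_second_quantization a \<rho> \<Omega> U \<Gamma>)"

(* For n = 0 the spanning vector is \<rho> 1 \<Omega>, which equals \<Omega> because \<Omega> is cyclic. *)
definition V_tilde ::
    "('h::complex_hilbert_space \<Rightarrow> 'a::unital_cstar_algebra) \<Rightarrow>
     ('a \<Rightarrow> 'k::complex_hilbert_space \<Rightarrow> 'k) \<Rightarrow> 'k \<Rightarrow> 'h set \<Rightarrow> 'k set" where
  "V_tilde a \<rho> \<Omega> V = cspan {\<rho> (creations a hs * annihilations a ks) \<Omega> | hs ks.
     length hs = length ks \<and> set hs \<subseteq> V \<and> set ks \<subseteq> V}"

end

theory Submission
  imports Defs
begin

text \<open>
  The uniqueness of the second quantization is immediate, since the vectors \<open>\<rho> x \<Omega>\<close> are dense and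
  unitaries are continuous. Its existence comes from the invariance of the quasi-free state: the
  determinants that define \<open>\<phi>\<close> only see the numbers \<open>\<langle>K h, k\<rangle>\<close>, and these do not change under
  a unitary that commutes with \<open>K\<close>. Normally ordered monomials span a dense subspace of the CAR
  algebra (Wick ordering), so \<open>\<phi> \<circ> \<gamma>\<^sub>U = \<phi>\<close>, hence \<open>\<rho> x \<Omega> \<mapsto> \<rho> (\<gamma>\<^sub>U x) \<Omega>\<close> preserves norms and
  extends to a unitary (\<open>state_invariant\<close>, \<open>second_quantization_isometry\<close>). Strong continuity only has
  to be checked on the vectors given by balanced monomials, where it follows from
  \<open>\<parallel>a h\<parallel> \<le> \<parallel>h\<parallel>\<close>.

  The statement about cores is an instance of Nelson's criterion (\<open>core_of_invariant_dense\<close>): a dense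
  subspace of the domain of the generator that the unitary group leaves invariant is a core. For
  \<open>V_tilde\<close>, invariance is \<open>V_tilde_invariant\<close>; the orbits of the monomials are differentiable by the
  product rule (\<open>V_tilde_in_Domain\<close>); and density (\<open>V_tilde_dense\<close>) says that the balanced monomials
  span a dense subspace of the GICAR algebra (\<open>GICAR_eq_closure\<close>), which is shown by averaging over
  the gauge group.

  Two points behind the definitions need work of their own. The group \<open>exp_i A\<close> is a definite
  description, so Stone's theorem (\<open>stone\<close>) is needed to know that it is a unitary group
  with generator \<open>A\<close>; the group is built as a limit of resolvent powers \<open>(1 - \<i> t A / N)\<^sup>-\<^sup>N\<close>. Likewise
  \<open>bogoliubov a U\<close> is the unique algebraic *-automorphism with the prescribed values on the generators, and
  these only generate a dense subalgebra. Uniqueness therefore rests on the automatic contractivity of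
  *-homomorphisms (\<open>unital_star_hom_norm_le\<close>), which is reduced to the fact that a self-adjoint element of
  norm less than one is the mean of a unitary and its adjoint.
\<close>

section \<open>Closed subspaces of a complex Hilbert space\<close>

instance complex_hilbert_space \<subseteq> banach ..

instance unital_cstar_algebra \<subseteq> banach ..

text \<open>An identity between continuous maps is a closed condition, so by this principle it suffices to check it on a
  dense set.\<close>

lemma closed_superset_of_dense:
  assumes "closed C" "closure D = UNIV" "\<And>x. x \<in> D \<Longrightarrow> x \<in> C"
  shows "x \<in> C"
  using closure_minimal[of D C] assms by auto

text \<open>Hilbert spaces and C*-algebras both satisfy the hypothesis, but their common superclass does
  not contain it.\<close>

lemma bounded_bilinear_scaleC:
  assumes "\<And>c (x :: 'b::{complex_vector,real_normed_vector}). norm (c *\<^sub>C x) = cmod c * norm x"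
  shows "bounded_bilinear (scaleC :: complex \<Rightarrow> 'b \<Rightarrow> 'b)"
proof
  show "\<exists>K. \<forall>c (x :: 'b). norm (c *\<^sub>C x) \<le> norm c * norm x * K"
    by (rule exI[of _ 1]) (simp add: assms)
qed (simp_all add: scaleC_add_left scaleC_add_right scaleR_scaleC scaleC_scaleC scaleR_conv_of_real
    mult.commute)

lemma cinner_add_right: "cinner x (y + z) = cinner x y + cinner x z"
  by (metis cinner_add_left cinner_commute complex_cnj_add)

lemma cinner_scaleC_right: "cinner x (c *\<^sub>C y) = cnj c * cinner x y"
  by (metis cinner_commute cinner_scaleC_left complex_cnj_mult)

lemma cinner_self: "cinner x x = of_real ((norm x)\<^sup>2)"
  by (rule complex_eqI)
    (use arg_cong[OF cinner_commute[of x x], of Im] in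
      \<open>simp_all add: power2_norm_eq_inner inner_eq_Re_cinner\<close>)

lemma norm_scaleC_hilbert: "norm (c *\<^sub>C x) = cmod c * norm x" for x :: "'a::complex_hilbert_space"
proof -
  have "of_real ((norm (c *\<^sub>C x))\<^sup>2) = (of_real ((cmod c * norm x)\<^sup>2) :: complex)"
    unfolding cinner_self[symmetric] cinner_scaleC_left cinner_scaleC_right
    by (simp only: cinner_self power_mult_distrib of_real_mult complex_norm_square)
      (simp only: mult_ac)
  then show ?thesis
    by (simp only: of_real_eq_iff) simp
qed

lemma bounded_bilinear_scaleC_hilbert:
  "bounded_bilinear (scaleC :: complex \<Rightarrow> 'a \<Rightarrow> 'a::complex_hilbert_space)"
  by (rule bounded_bilinear_scaleC) (rule norm_scaleC_hilbert)

lemma bounded_bilinear_scaleC_cstar: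
  "bounded_bilinear (scaleC :: complex \<Rightarrow> 'a \<Rightarrow> 'a::unital_cstar_algebra)"
  by (rule bounded_bilinear_scaleC) (rule norm_scaleC)

text \<open>Reduces questions about the complex inner product to the real inner product, to which the
  Cauchy-Schwarz inequality for real inner product spaces applies.\<close>

lemma cinner_eq_inner: "cinner x y = Complex (inner x y) (inner (- \<i> *\<^sub>C x) y)"
proof -
  have "Im (cinner x y) = Re (cinner ((- \<i>) *\<^sub>C x) y)"
    unfolding cinner_scaleC_left by simp
  then show ?thesis
    by (simp add: inner_eq_Re_cinner complex_eq_iff)
qed

lemma bounded_bilinear_cinner:
  "bounded_bilinear (cinner :: 'a::complex_hilbert_space \<Rightarrow> 'a \<Rightarrow> complex)"
proof
  fix x y z :: 'a and r :: real
  show "cinner (x + y) z = cinner x z + cinner y z" "cinner x (y + z) = cinner x y + cinner x z"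
    by (rule cinner_add_left cinner_add_right)+
  show "cinner (r *\<^sub>R x) y = r *\<^sub>R cinner x y" "cinner x (r *\<^sub>R y) = r *\<^sub>R cinner x y"
    by (simp_all add: scaleR_scaleC cinner_scaleC_left cinner_scaleC_right scaleR_conv_of_real)
  have "cmod (cinner x y) \<le> norm x * norm y * 2" for x y :: 'a
    using Cauchy_Schwarz_ineq2[of x y] Cauchy_Schwarz_ineq2[of "- \<i> *\<^sub>C x" y]
      cmod_le[of "cinner x y"]
    by (simp add: cinner_eq_inner norm_scaleC_hilbert)
  then show "\<exists>K. \<forall>x y :: 'a. cmod (cinner x y) \<le> norm x * norm y * K"
    by blast
qed

text \<open>The projection theorem, in the form in which it is used. A minimising sequence for the distance from \<open>z\<close>
  to \<open>M\<close> is Cauchy by the parallelogram law; for its limit \<open>l\<close> the vector \<open>z - l\<close> is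
  orthogonal to \<open>M\<close>, hence zero.\<close>

lemma closed_csubspace_eq_UNIV:
  fixes M :: "'a::complex_hilbert_space set"
  assumes sub: "csubspace M" and cl: "closed M"
    and orth: "\<And>y. (\<And>x. x \<in> M \<Longrightarrow> cinner x y = 0) \<Longrightarrow> y = 0"
  shows "M = UNIV"
proof -
  have scaleR_M: "r *\<^sub>R x \<in> M" if "x \<in> M" for r x
    using sub that by (simp add: scaleR_scaleC complex_vector.subspace_scale)
  have "z \<in> M" for z
  proof -
    define D where "D = (INF m\<in>M. (norm (z - m))\<^sup>2)"
    have ne: "M \<noteq> {}"
      using complex_vector.subspace_0[OF sub] by auto
    have bdd: "bdd_below ((\<lambda>m. (norm (z - m))\<^sup>2) ` M)"
      by (rule bdd_belowI[of _ 0]) auto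
    have D_le: "D \<le> (norm (z - m))\<^sup>2" if "m \<in> M" for m
      unfolding D_def using that bdd by (rule cINF_lower[rotated])
    have "\<exists>m\<in>M. (norm (z - m))\<^sup>2 < D + inverse (real (Suc n))" for n
    proof (rule ccontr)
      assume "\<not> ?thesis"
      then have "D + inverse (real (Suc n)) \<le> D"
        unfolding D_def by (intro cINF_greatest[OF ne]) (auto simp: not_less D_def)
      then show False by simp
    qed
    then obtain m where m: "\<And>n. m n \<in> M"
      and m_less: "\<And>n. (norm (z - m n))\<^sup>2 < D + inverse (real (Suc n))"
      by metis
    have m_diff: "(norm (m n - m k))\<^sup>2 \<le> 2 * (inverse (real (Suc n)) + inverse (real (Suc k)))" for n k
    proof -
      have mid: "(1/2) *\<^sub>R (m n + m k) \<in> M"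
        by (intro scaleR_M complex_vector.subspace_add[OF sub] m)
      have "(norm (m n - m k))\<^sup>2 = 2 * (norm (z - m n))\<^sup>2 + 2 * (norm (z - m k))\<^sup>2
          - 4 * (norm (z - (1/2) *\<^sub>R (m n + m k)))\<^sup>2"
        unfolding power2_norm_eq_inner
        by (simp add: inner_simps inner_commute algebra_simps)
      then show ?thesis
        using D_le[OF mid] m_less[of n] m_less[of k] by argo
    qed
    have "Cauchy m"
    proof (rule metric_CauchyI)
      fix e :: real assume "e > 0"
      then obtain N where N: "inverse (real (Suc N)) < e\<^sup>2 / 4"
        using reals_Archimedean[of "e\<^sup>2 / 4"] by auto
      have "dist (m n) (m k) < e" if "n \<ge> N" "k \<ge> N" for n k
      proof -
        have "inverse (real (Suc i)) \<le> inverse (real (Suc N))" if "i \<ge> N" for i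
          using that by (simp add: le_imp_inverse_le)
        from this[OF that(1)] this[OF that(2)] have "(norm (m n - m k))\<^sup>2 < e\<^sup>2"
          using m_diff[of n k] N by argo
        then show ?thesis
          using \<open>e > 0\<close> by (simp add: dist_norm power_less_imp_less_base)
      qed
      then show "\<exists>N. \<forall>n\<ge>N. \<forall>k\<ge>N. dist (m n) (m k) < e"
        by blast
    qed
    then obtain l where l: "m \<longlonglongrightarrow> l"
      using Cauchy_convergent_iff convergent_def by blast
    have lM: "l \<in> M"
      using closed_sequentially[OF cl] m l by blast
    have "(norm (z - l))\<^sup>2 \<le> D"
    proof (rule LIMSEQ_le)
      show "(\<lambda>n. (norm (z - m n))\<^sup>2) \<longlonglongrightarrow> (norm (z - l))\<^sup>2"
        by (intro tendsto_intros l)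
      show "(\<lambda>n. D + inverse (real (Suc n))) \<longlonglongrightarrow> D"
        using tendsto_add[OF tendsto_const[of D] LIMSEQ_inverse_real_of_nat] by simp
    qed (use m_less less_imp_le in blast)
    \<comment> \<open>\<open>l\<close> is nearest to \<open>z\<close>; the competitor \<open>l + t x\<close> with the optimal \<open>t\<close> gives orthogonality.\<close>
    have inner0: "inner x (z - l) = 0" if "x \<in> M" for x
    proof (cases "x = 0")
      case False
      define t where "t = inner x (z - l) / inner x x"
      have "l + t *\<^sub>R x \<in> M"
        using that lM by (intro complex_vector.subspace_add[OF sub] scaleR_M)
      then have "(norm (z - l))\<^sup>2 \<le> (norm (z - (l + t *\<^sub>R x)))\<^sup>2"
        using D_le \<open>(norm (z - l))\<^sup>2 \<le> D\<close> order_trans by blast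
      also have "\<dots> = (norm (z - l))\<^sup>2 - (inner x (z - l))\<^sup>2 / inner x x"
      proof -
        have "z - (l + t *\<^sub>R x) = (z - l) - t *\<^sub>R x" by simp
        then have "(norm (z - (l + t *\<^sub>R x)))\<^sup>2
            = (norm (z - l))\<^sup>2 - 2 * t * inner x (z - l) + t * t * inner x x"
          unfolding power2_norm_eq_inner
          by (simp only: inner_diff_left inner_diff_right inner_scaleR_left inner_scaleR_right)
            (simp add: inner_commute algebra_simps)
        then show ?thesis
          using False by (simp add: t_def power2_eq_square)
      qed
      finally have "(inner x (z - l))\<^sup>2 / inner x x \<le> 0" by simp
      then show ?thesis
        using False inner_gt_zero_iff[of x] unfolding divide_le_0_iff
        by (metis not_less power2_less_eq_zero_iff)
    qed simp
    have "cinner x (z - l) = 0" if "x \<in> M" for x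
      using inner0[OF that] inner0[OF complex_vector.subspace_scale[OF sub that, of "- \<i>"]]
      by (simp add: cinner_eq_inner complex_eq_iff)
    then have "z - l = 0" by (rule orth)
    then show ?thesis using lM by simp
  qed
  then show ?thesis by blast
qed

text \<open>The continuity of scalar multiplication is a hypothesis so that the lemma covers both a Hilbert
  space and its square, where graphs of operators live.\<close>

lemma csubspace_closure:
  fixes M :: "'a::{complex_vector,real_normed_vector} set"
  assumes "csubspace M"
    and cont: "\<And>c u x. u \<longlonglongrightarrow> x \<Longrightarrow> (\<lambda>n. c *\<^sub>C u n :: 'a) \<longlonglongrightarrow> c *\<^sub>C x"
  shows "csubspace (closure M)"
proof -
  have add: "x + y \<in> closure M" if x: "x \<in> closure M" and y: "y \<in> closure M" for x y
  proof -
    obtain u v where "\<And>n. u n \<in> M" "u \<longlonglongrightarrow> x" "\<And>n. v n \<in> M" "v \<longlonglongrightarrow> y"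
      using x y unfolding closure_sequential by blast
    then show ?thesis
      unfolding closure_sequential
      by (intro exI[of _ "\<lambda>n. u n + v n"])
        (auto intro: tendsto_add complex_vector.subspace_add[OF assms(1)])
  qed
  have scale: "c *\<^sub>C x \<in> closure M" if x: "x \<in> closure M" for c x
  proof -
    obtain u where "\<And>n. u n \<in> M" "u \<longlonglongrightarrow> x"
      using x unfolding closure_sequential by blast
    then show ?thesis
      unfolding closure_sequential
      by (intro exI[of _ "\<lambda>n. c *\<^sub>C u n"])
        (auto intro: cont complex_vector.subspace_scale[OF assms(1)])
  qed
  have "0 \<in> closure M"
    using complex_vector.subspace_0[OF assms(1)] closure_subset by blast
  then show ?thesis
    using add scale by (simp add: complex_vector.subspace_def)
qed

lemma csubspace_closure_hilbert: "csubspace M \<Longrightarrow> csubspace (closure M)"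
  for M :: "'a::complex_hilbert_space set"
  by (erule csubspace_closure)
    (rule bounded_bilinear.tendsto[OF bounded_bilinear_scaleC_hilbert tendsto_const])

lemma csubspace_closure_prod: "csubspace M \<Longrightarrow> csubspace (closure M)"
  for M :: "('a::complex_hilbert_space \<times> 'a) set"
  by (erule csubspace_closure)
    (auto simp: scaleC_prod_def intro!: tendsto_Pair tendsto_fst tendsto_snd
      bounded_bilinear.tendsto[OF bounded_bilinear_scaleC_hilbert tendsto_const])

lemma orthogonal_dense_eq_0:
  fixes M :: "'a::complex_hilbert_space set"
  assumes "closure M = UNIV" and "\<And>x. x \<in> M \<Longrightarrow> cinner x y = 0"
  shows "y = 0"
proof -
  have "y \<in> {x. cinner x y = 0}"
    by (rule closed_superset_of_dense[OF _ assms(1)])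
      (auto intro!: closed_Collect_eq bounded_bilinear.continuous_on[OF bounded_bilinear_cinner]
        continuous_intros simp: assms(2))
  then show ?thesis
    by (simp add: cinner_self)
qed

section \<open>Generators of unitary groups\<close>

lemmas tendsto_scaleC_hilbert = bounded_bilinear.tendsto[OF bounded_bilinear_scaleC_hilbert]

lemma clinear_add: "clinear T \<Longrightarrow> T (x + y) = T x + T y"
  unfolding Vector_Spaces.linear_iff by blast

lemma clinear_scaleC: "clinear T \<Longrightarrow> T (c *\<^sub>C x) = c *\<^sub>C T x"
  unfolding Vector_Spaces.linear_iff by blast

lemma clinear_diff: "clinear T \<Longrightarrow> T (x - y) = T x - T y"
  by (metis clinear_add diff_add_cancel add_diff_cancel_right')

lemma clinearI:
  fixes T :: "'a::complex_vector \<Rightarrow> 'b::complex_vector"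
  assumes "\<And>x y. T (x + y) = T x + T y" "\<And>c x. T (c *\<^sub>C x) = c *\<^sub>C T x"
  shows "clinear T"
  by unfold_locales (use assms in auto)

lemma unitary_operatorD:
  assumes "unitary_operator U"
  shows "clinear U" "surj U" "cinner (U x) (U y) = cinner x y"
  using assms by (auto simp: unitary_operator_def)

lemma unitary_norm: "unitary_operator U \<Longrightarrow> norm (U x) = norm x"
  for x :: "'a::complex_hilbert_space"
  using unitary_operatorD(3)[of U x x] by (simp add: norm_eq_sqrt_inner inner_eq_Re_cinner)

lemma unitary_bounded_linear:
  fixes U :: "'a::complex_hilbert_space \<Rightarrow> 'a"
  assumes "unitary_operator U"
  shows "bounded_linear U"
  by (rule bounded_linear_intro[of _ 1])
    (simp_all add: clinear_add[OF unitary_operatorD(1)[OF assms]] scaleR_scaleC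
      clinear_scaleC[OF unitary_operatorD(1)[OF assms]] unitary_norm[OF assms])

lemma unitary_group_unitary: "unitary_group U \<Longrightarrow> unitary_operator (U t)"
  by (simp add: unitary_group_def)

lemma unitary_group_plus: "unitary_group U \<Longrightarrow> U (s + t) x = U s (U t x)"
  by (simp add: unitary_group_def)

text \<open>The group law makes \<open>U 0\<close> idempotent, and an injective idempotent is the identity.\<close>

lemma unitary_group_0:
  fixes U :: "real \<Rightarrow> 'a::complex_hilbert_space \<Rightarrow> 'a"
  assumes "unitary_group U"
  shows "U 0 x = x"
proof -
  note u = unitary_group_unitary[OF assms]
  have "norm (U 0 (U 0 x - x)) = 0"
    using unitary_group_plus[OF assms, of 0 0 x] by (simp add: clinear_diff[OF unitary_operatorD(1)[OF u]])
  then show ?thesis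
    unfolding unitary_norm[OF u] by simp
qed

lemma has_vector_derivative_at_0_iff:
  fixes f :: "real \<Rightarrow> 'a::real_normed_vector"
  shows "(f has_vector_derivative d) (at 0) \<longleftrightarrow> ((\<lambda>t. (f t - f 0) /\<^sub>R t) \<longlongrightarrow> d) (at 0)"
proof -
  have "norm (f h - f 0 - h *\<^sub>R d) / norm h = norm ((f h - f 0) /\<^sub>R h - d)" if "h \<noteq> 0" for h
  proof -
    have "(f h - f 0) /\<^sub>R h - d = inverse h *\<^sub>R (f h - f 0 - h *\<^sub>R d)"
      using that by (simp add: scaleR_diff_right)
    then show ?thesis
      by (simp add: divide_inverse mult.commute)
  qed
  then have "((\<lambda>h. norm (f h - f 0 - h *\<^sub>R d) / norm h) \<longlongrightarrow> 0) (at 0) \<longleftrightarrow>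
      ((\<lambda>h. norm ((f h - f 0) /\<^sub>R h - d)) \<longlongrightarrow> 0) (at 0)"
    by (intro tendsto_cong) (auto simp: eventually_at_filter)
  then show ?thesis
    by (simp add: has_vector_derivative_def has_derivative_at bounded_linear_scaleR_left
        tendsto_norm_zero_iff LIM_zero_iff)
qed

text \<open>The complex difference quotient that defines the generator is \<open>- \<i>\<close> times the real one, so the
  calculus of vector derivatives applies to orbits.\<close>

lemma in_generator_iff:
  fixes U :: "real \<Rightarrow> 'a::complex_hilbert_space \<Rightarrow> 'a"
  assumes "unitary_group U"
  shows "(x, y) \<in> generator U \<longleftrightarrow> ((\<lambda>t. U t x) has_vector_derivative \<i> *\<^sub>C y) (at 0)"
proof -
  have eq: "(1 / (\<i> * of_real t)) *\<^sub>C (U t x - x) = (- \<i>) *\<^sub>C ((U t x - x) /\<^sub>R t)" for t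
    by (simp add: scaleR_scaleC scaleC_scaleC divide_inverse)
  have "((\<lambda>t. (U t x - x) /\<^sub>R t) \<longlongrightarrow> \<i> *\<^sub>C y) (at 0) \<longleftrightarrow>
      ((\<lambda>t. (- \<i>) *\<^sub>C ((U t x - x) /\<^sub>R t)) \<longlongrightarrow> y) (at 0)"
  proof
    assume "((\<lambda>t. (U t x - x) /\<^sub>R t) \<longlongrightarrow> \<i> *\<^sub>C y) (at 0)"
    from tendsto_scaleC_hilbert[OF tendsto_const[of "- \<i>"] this]
    show "((\<lambda>t. (- \<i>) *\<^sub>C ((U t x - x) /\<^sub>R t)) \<longlongrightarrow> y) (at 0)"
      by (simp add: scaleC_scaleC scaleC_one)
  next
    assume "((\<lambda>t. (- \<i>) *\<^sub>C ((U t x - x) /\<^sub>R t)) \<longlongrightarrow> y) (at 0)"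
    from tendsto_scaleC_hilbert[OF tendsto_const[of \<i>] this]
    show "((\<lambda>t. (U t x - x) /\<^sub>R t) \<longlongrightarrow> \<i> *\<^sub>C y) (at 0)"
      by (simp add: scaleC_scaleC scaleC_one)
  qed
  then show ?thesis
    by (simp add: generator_def eq has_vector_derivative_at_0_iff unitary_group_0[OF assms])
qed

lemma has_vector_derivative_orbit:
  fixes U :: "real \<Rightarrow> 'a::complex_hilbert_space \<Rightarrow> 'a"
  assumes U: "unitary_group U" and xy: "(x, y) \<in> generator U"
  shows "((\<lambda>s. U s x) has_vector_derivative \<i> *\<^sub>C U t y) (at t within S)"
proof -
  note u = unitary_group_unitary[OF U]
  have "((\<lambda>s. U t (U (s - t) x)) has_vector_derivative U t (1 *\<^sub>R (\<i> *\<^sub>C y))) (at t)"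
  proof (rule bounded_linear.has_vector_derivative[OF unitary_bounded_linear[OF u]])
    have "((\<lambda>s. U s x) \<circ> (\<lambda>s. s - t) has_vector_derivative 1 *\<^sub>R (\<i> *\<^sub>C y)) (at t)"
      by (rule vector_diff_chain_at)
        (use xy in \<open>auto simp: in_generator_iff[OF U] intro!: derivative_eq_intros\<close>)
    then show "((\<lambda>s. U (s - t) x) has_vector_derivative 1 *\<^sub>R (\<i> *\<^sub>C y)) (at t)"
      by (simp add: o_def)
  qed
  moreover have "U t (U (s - t) x) = U s x" for s
    using unitary_group_plus[OF U, of t "s - t" x] by simp
  ultimately show ?thesis
    by (simp add: clinear_scaleC[OF unitary_operatorD(1)[OF u]] has_vector_derivative_at_within)
qed

lemma generator_invariant:
  fixes U :: "real \<Rightarrow> 'a::complex_hilbert_space \<Rightarrow> 'a"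
  assumes U: "unitary_group U" and xy: "(x, y) \<in> generator U"
  shows "(U t x, U t y) \<in> generator U"
proof -
  note u = unitary_group_unitary[OF U]
  have "((\<lambda>s. U t (U s x)) has_vector_derivative U t (\<i> *\<^sub>C y)) (at 0)"
    using xy unfolding in_generator_iff[OF U]
    by (rule bounded_linear.has_vector_derivative[OF unitary_bounded_linear[OF u]])
  moreover have "U t (U s x) = U s (U t x)" for s
    by (metis unitary_group_plus[OF U] add.commute)
  ultimately show ?thesis
    by (simp add: in_generator_iff[OF U] clinear_scaleC[OF unitary_operatorD(1)[OF u]])
qed

lemma csubspace_generator:
  fixes U :: "real \<Rightarrow> 'a::complex_hilbert_space \<Rightarrow> 'a"
  assumes U: "unitary_group U"
  shows "csubspace (generator U)"
proof -
  note lin = unitary_operatorD(1)[OF unitary_group_unitary[OF U]]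
  have "(c *\<^sub>C x, c *\<^sub>C y) \<in> generator U" if "(x, y) \<in> generator U" for c x y
  proof -
    have "((\<lambda>t. c *\<^sub>C U t x) has_vector_derivative c *\<^sub>C (\<i> *\<^sub>C y)) (at 0)"
      by (rule bounded_linear.has_vector_derivative
          [OF bounded_bilinear.bounded_linear_right[OF bounded_bilinear_scaleC_hilbert]])
        (use that in \<open>simp add: in_generator_iff[OF U]\<close>)
    then show ?thesis
      by (simp add: in_generator_iff[OF U] clinear_scaleC[OF lin] scaleC_scaleC mult.commute)
  qed
  moreover have "(x + x', y + y') \<in> generator U"
    if "(x, y) \<in> generator U" "(x', y') \<in> generator U" for x y x' y'
    using has_vector_derivative_add[OF that[unfolded in_generator_iff[OF U]]]
    by (simp add: in_generator_iff[OF U] clinear_add[OF lin] scaleC_add_right)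
  moreover have "(0, 0) \<in> generator U"
    using clinear_scaleC[OF lin, of _ 0 0]
    by (simp add: in_generator_iff[OF U])
  ultimately show ?thesis
    by (auto simp: complex_vector.subspace_def zero_prod_def scaleC_prod_def)
qed

text \<open>Differentiate the constant function \<open>t \<mapsto> \<langle>U t x, U t x'\<rangle>\<close> at zero.\<close>

lemma generator_symmetric:
  fixes U :: "real \<Rightarrow> 'a::complex_hilbert_space \<Rightarrow> 'a"
  assumes U: "unitary_group U" and "(x, y) \<in> generator U" "(x', y') \<in> generator U"
  shows "cinner y x' = cinner x y'"
proof -
  have "((\<lambda>t. cinner (U t x) (U t x')) has_vector_derivative
      cinner (U 0 x) (\<i> *\<^sub>C U 0 y') + cinner (\<i> *\<^sub>C U 0 y) (U 0 x')) (at 0)"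
    by (rule bounded_bilinear.has_vector_derivative[OF bounded_bilinear_cinner])
      (rule has_vector_derivative_orbit[OF U] assms)+
  moreover have "((\<lambda>t. cinner (U t x) (U t x')) has_vector_derivative 0) (at 0)"
    using unitary_operatorD(3)[OF unitary_group_unitary[OF U]] by simp
  ultimately have "cinner x (\<i> *\<^sub>C y') + cinner (\<i> *\<^sub>C y) x' = 0"
    unfolding unitary_group_0[OF U] by (rule vector_derivative_unique_at)
  then have "\<i> * (cinner y x' - cinner x y') = 0"
    by (simp add: cinner_scaleC_left cinner_scaleC_right algebra_simps)
  then show ?thesis by simp
qed

text \<open>For \<open>(u, v)\<close> in the generator the mean value inequality bounds \<open>\<parallel>U t u - u - \<i> t v\<parallel>\<close> by \<open>\<bar>t\<bar>\<close> times
  the supremum of \<open>\<parallel>U s v - v\<parallel>\<close> over \<open>\<bar>s\<bar> \<le> \<bar>t\<bar>\<close>. This bound is stable under limits of \<open>(u, v)\<close>,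
  because unitaries are uniformly Lipschitz.\<close>

lemma generator_closed:
  fixes U :: "real \<Rightarrow> 'a::complex_hilbert_space \<Rightarrow> 'a"
  assumes U: "unitary_group U"
  shows "closed (generator U)"
  unfolding closed_sequential_limits
proof (intro allI impI, elim conjE)
  fix f :: "nat \<Rightarrow> 'a \<times> 'a" and l
  assume f: "\<forall>n. f n \<in> generator U" and lim: "f \<longlonglongrightarrow> l"
  obtain x y where l: "l = (x, y)" by fastforce
  define u v where "u = (\<lambda>n. fst (f n))" and "v = (\<lambda>n. snd (f n))"
  have uv: "(u n, v n) \<in> generator U" for n
    using f by (simp add: u_def v_def)
  have u: "u \<longlonglongrightarrow> x" and v: "v \<longlonglongrightarrow> y"
    unfolding u_def v_def using tendsto_fst[OF lim] tendsto_snd[OF lim] l by simp_all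
  note unit = unitary_group_unitary[OF U]
  note lin = unitary_operatorD(1)[OF unit]
  note bl = unitary_bounded_linear[OF unit]
  have "\<exists>d>0. \<forall>t. norm (t - 0) < d \<longrightarrow>
      norm (U t x - U 0 x - t *\<^sub>R (\<i> *\<^sub>C y)) \<le> e * norm (t - 0)" if "e > 0" for e
  proof -
    have "isCont (\<lambda>t. U t y) 0"
      using U by (simp add: unitary_group_def continuous_on_eq_continuous_at)
    then obtain d where d: "d > 0" "\<And>s. \<bar>s\<bar> < d \<Longrightarrow> norm (U s y - y) < e"
      using \<open>e > 0\<close> unfolding continuous_at_eps_delta
      by (auto simp: dist_norm unitary_group_0[OF U])
    have "norm (U t x - U 0 x - t *\<^sub>R (\<i> *\<^sub>C y)) \<le> e * norm (t - 0)" if t: "norm (t - 0) < d" for t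
    proof -
      have "norm (U t (u n) - u n - t *\<^sub>R (\<i> *\<^sub>C v n)) \<le> (e + 2 * norm (v n - y)) * \<bar>t\<bar>" for n
      proof -
        \<comment> \<open>Subtracting the linear term leaves a function with small derivative.\<close>
        define g where "g = (\<lambda>s. U s (u n) - s *\<^sub>R (\<i> *\<^sub>C v n))"
        have der: "(g has_derivative (\<lambda>h. h *\<^sub>R (\<i> *\<^sub>C U s (v n) - \<i> *\<^sub>C v n))) (at s within S)" for s S
          unfolding g_def has_vector_derivative_def[symmetric]
          by (intro derivative_eq_intros has_vector_derivative_diff
              has_vector_derivative_orbit[OF U uv] refl) (auto intro!: derivative_eq_intros)
        have bound: "onorm (\<lambda>h. h *\<^sub>R (\<i> *\<^sub>C U s (v n) - \<i> *\<^sub>C v n)) \<le> e + 2 * norm (v n - y)"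
          if s: "s \<in> cball 0 \<bar>t\<bar>" for s
        proof -
          have "U s (v n) - v n = U s (v n - y) + (U s y - y) + (y - v n)"
            by (simp add: clinear_diff[OF lin])
          also have "norm \<dots> \<le> norm (U s (v n - y)) + norm (U s y - y) + norm (y - v n)"
            by (meson norm_triangle_ineq norm_triangle_le order_refl add_mono)
          also have "\<dots> \<le> e + 2 * norm (v n - y)"
            using d(2)[of s] s t by (simp add: unitary_norm[OF unit] norm_minus_commute)
          finally have "norm (U s (v n) - v n) \<le> e + 2 * norm (v n - y)" .
          moreover have "\<i> *\<^sub>C U s (v n) - \<i> *\<^sub>C v n = \<i> *\<^sub>C (U s (v n) - v n)"
            by (simp add: complex_vector.scale_right_diff_distrib)
          ultimately show ?thesis
            by (simp add: onorm_scaleR_left norm_scaleC_hilbert onorm_id)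
        qed
        have "norm (g t - g 0) \<le> (e + 2 * norm (v n - y)) * norm (t - 0)"
          by (rule differentiable_bound[OF convex_cball[of 0 "\<bar>t\<bar>"] der bound]) auto
        then show ?thesis
          by (simp add: g_def unitary_group_0[OF U] algebra_simps)
      qed
      moreover have "(\<lambda>n. norm (U t (u n) - u n - t *\<^sub>R (\<i> *\<^sub>C v n))) \<longlonglongrightarrow> norm (U t x - x - t *\<^sub>R (\<i> *\<^sub>C y))"
        by (intro tendsto_intros bounded_linear.tendsto[OF bl] tendsto_scaleC_hilbert u v)
      moreover have "(\<lambda>n. (e + 2 * norm (v n - y)) * \<bar>t\<bar>) \<longlonglongrightarrow> (e + 2 * norm (y - y)) * \<bar>t\<bar>"
        by (intro tendsto_intros v)
      ultimately have "norm (U t x - x - t *\<^sub>R (\<i> *\<^sub>C y)) \<le> (e + 2 * norm (y - y)) * \<bar>t\<bar>"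
        by (intro LIMSEQ_le) auto
      then show ?thesis
        by (simp add: unitary_group_0[OF U])
    qed
    then show ?thesis using d(1) by blast
  qed
  then have "((\<lambda>t. U t x) has_vector_derivative \<i> *\<^sub>C y) (at 0)"
    unfolding has_vector_derivative_def has_derivative_at_alt
    by (auto simp: bounded_linear_scaleR_left)
  then show "l \<in> generator U"
    by (simp add: l in_generator_iff[OF U])
qed

section \<open>Cores of generators\<close>

definition symmetric_operator :: "'h::complex_hilbert_space unbounded_operator \<Rightarrow> bool" where
  "symmetric_operator T \<longleftrightarrow> (\<forall>(x, w)\<in>T. \<forall>(x', w')\<in>T. cinner w x' = cinner x w')"

lemma symmetric_operatorD:
  "symmetric_operator T \<Longrightarrow> (x, w) \<in> T \<Longrightarrow> (x', w') \<in> T \<Longrightarrow> cinner w x' = cinner x w'"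
  unfolding symmetric_operator_def by blast

lemma csubspace_graphD:
  fixes T :: "('h::complex_vector \<times> 'h) set"
  assumes "csubspace T"
  shows "(x, w) \<in> T \<Longrightarrow> (x', w') \<in> T \<Longrightarrow> (x + x', w + w') \<in> T"
    and "(x, w) \<in> T \<Longrightarrow> (x', w') \<in> T \<Longrightarrow> (x - x', w - w') \<in> T"
    and "(x, w) \<in> T \<Longrightarrow> (c *\<^sub>C x, c *\<^sub>C w) \<in> T"
  using complex_vector.subspace_add[OF assms, of "(x, w)" "(x', w')"]
    complex_vector.subspace_diff[OF assms, of "(x, w)" "(x', w')"]
    complex_vector.subspace_scale[OF assms, of "(x, w)" c]
  by (simp_all add: scaleC_prod_def)

text \<open>The cross term vanishes because \<open>\<langle>w, x\<rangle>\<close> is real. This identity is the source of injectivity,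
  of the closedness of ranges and of the contractivity of resolvents.\<close>

lemma symmetric_norm_shift:
  fixes x :: "'h::complex_hilbert_space"
  assumes "symmetric_operator T" "(x, w) \<in> T"
  shows "(norm (x - (\<i> * of_real h) *\<^sub>C w))\<^sup>2 = (norm x)\<^sup>2 + h\<^sup>2 * (norm w)\<^sup>2"
proof -
  have "cinner w x = cinner x w"
    using symmetric_operatorD[OF assms(1,2,2)] .
  then have "Im (cinner x w) = 0"
    using cinner_commute[of w x] by (metis complex_cnj_cancel_iff complex_is_Real_iff Reals_cnj_iff)
  then have "inner x ((\<i> * of_real h) *\<^sub>C w) = 0"
    by (simp add: inner_eq_Re_cinner cinner_scaleC_right)
  then have "(norm (x - (\<i> * of_real h) *\<^sub>C w))\<^sup>2 = (norm x)\<^sup>2 + (norm ((\<i> * of_real h) *\<^sub>C w))\<^sup>2"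
    unfolding power2_norm_eq_inner by (simp add: inner_diff_left inner_diff_right inner_commute)
  then show ?thesis
    by (simp add: norm_scaleC_hilbert norm_mult power_mult_distrib)
qed

lemma symmetric_norm_shift_ge:
  fixes x :: "'h::complex_hilbert_space"
  assumes "symmetric_operator T" "(x, w) \<in> T"
  shows "norm x \<le> norm (x - (\<i> * of_real h) *\<^sub>C w)"
    and "\<bar>h\<bar> * norm w \<le> norm (x - (\<i> * of_real h) *\<^sub>C w)"
proof -
  note eq = symmetric_norm_shift[OF assms, of h]
  show "norm x \<le> norm (x - (\<i> * of_real h) *\<^sub>C w)"
    by (rule power2_le_imp_le) (simp_all add: eq)
  show "\<bar>h\<bar> * norm w \<le> norm (x - (\<i> * of_real h) *\<^sub>C w)"
    by (rule power2_le_imp_le) (simp_all add: eq power_mult_distrib)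
qed

text \<open>By the norm identity, convergence of \<open>x - \<i> h w\<close> forces \<open>x\<close> and \<open>w\<close> to converge. So the range is
  closed, and the projection theorem turns a trivial orthogonal complement into surjectivity.\<close>

lemma symmetric_range_shift:
  fixes T :: "'h::complex_hilbert_space unbounded_operator"
  assumes sub: "csubspace T" and sym: "symmetric_operator T" and cl: "closed T" and h: "h \<noteq> 0"
    and orth: "\<And>y. (\<And>x w. (x, w) \<in> T \<Longrightarrow> cinner (x - (\<i> * of_real h) *\<^sub>C w) y = 0) \<Longrightarrow> y = 0"
  shows "\<exists>x w. (x, w) \<in> T \<and> x - (\<i> * of_real h) *\<^sub>C w = y"
proof -
  define M where "M = {x - (\<i> * of_real h) *\<^sub>C w |x w. (x, w) \<in> T}"
  have "csubspace M"
    unfolding complex_vector.subspace_def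
  proof (intro conjI allI ballI)
    show "0 \<in> M"
      using complex_vector.subspace_0[OF sub] unfolding M_def zero_prod_def
      by (intro CollectI exI[of _ 0]) simp
    show "y + y' \<in> M" if yM: "y \<in> M" "y' \<in> M" for y y'
    proof -
      obtain x w x' w' where *: "(x, w) \<in> T" "y = x - (\<i> * of_real h) *\<^sub>C w"
        "(x', w') \<in> T" "y' = x' - (\<i> * of_real h) *\<^sub>C w'"
        using yM unfolding M_def by blast
      then have "y + y' = (x + x') - (\<i> * of_real h) *\<^sub>C (w + w')"
        by (simp add: scaleC_add_right)
      then show ?thesis
        using csubspace_graphD(1)[OF sub *(1,3)] unfolding M_def by blast
    qed
    show "c *\<^sub>C y \<in> M" if yM: "y \<in> M" for c y
    proof -
      obtain x w where *: "(x, w) \<in> T" "y = x - (\<i> * of_real h) *\<^sub>C w"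
        using yM unfolding M_def by blast
      then have "c *\<^sub>C y = c *\<^sub>C x - (\<i> * of_real h) *\<^sub>C (c *\<^sub>C w)"
        by (simp add: complex_vector.scale_right_diff_distrib scaleC_scaleC mult.commute)
      then show ?thesis
        using csubspace_graphD(3)[OF sub *(1)] unfolding M_def by blast
    qed
  qed
  moreover have "closed M"
    unfolding closed_sequential_limits
  proof (intro allI impI, elim conjE)
    fix f l assume f: "\<forall>n. f n \<in> M" and lim: "f \<longlonglongrightarrow> l"
    from f have "\<forall>n. \<exists>x w. (x, w) \<in> T \<and> f n = x - (\<i> * of_real h) *\<^sub>C w"
      unfolding M_def by blast
    then obtain x w where xw: "\<And>n. (x n, w n) \<in> T"
      and f_eq: "\<And>n. f n = x n - (\<i> * of_real h) *\<^sub>C w n"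
      by metis
    have diff: "(x n - x m, w n - w m) \<in> T" for n m
      using csubspace_graphD(2)[OF sub xw xw] .
    have f_diff: "f n - f m = (x n - x m) - (\<i> * of_real h) *\<^sub>C (w n - w m)" for n m
      by (simp add: f_eq complex_vector.scale_right_diff_distrib)
    have Cf: "Cauchy f"
      using lim by (rule LIMSEQ_imp_Cauchy)
    have "Cauchy x"
      using Cf symmetric_norm_shift_ge(1)[OF sym diff, where h = h]
      unfolding Cauchy_iff f_diff by (meson le_less_trans)
    then obtain x0 where x0: "x \<longlonglongrightarrow> x0"
      using Cauchy_convergent_iff convergent_def by blast
    have w_eq: "w n = (1 / (\<i> * of_real h)) *\<^sub>C (x n - f n)" for n
      using h by (simp add: f_eq scaleC_scaleC scaleC_one)
    have "w \<longlonglongrightarrow> (1 / (\<i> * of_real h)) *\<^sub>C (x0 - l)"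
      unfolding w_eq[abs_def] by (intro tendsto_scaleC_hilbert tendsto_intros x0 lim)
    then have "(\<lambda>n. (x n, w n)) \<longlonglongrightarrow> (x0, (1 / (\<i> * of_real h)) *\<^sub>C (x0 - l))"
      by (intro tendsto_Pair x0)
    then have "(x0, (1 / (\<i> * of_real h)) *\<^sub>C (x0 - l)) \<in> T"
      by (rule closed_sequentially[OF cl xw])
    moreover have "l = x0 - (\<i> * of_real h) *\<^sub>C ((1 / (\<i> * of_real h)) *\<^sub>C (x0 - l))"
      using h by (simp add: scaleC_scaleC scaleC_one)
    ultimately show "l \<in> M"
      unfolding M_def by blast
  qed
  ultimately have "M = UNIV"
    by (rule closed_csubspace_eq_UNIV) (rule orth, unfold M_def, blast)
  then have "y \<in> M" by simp
  then show ?thesis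
    unfolding M_def by force
qed

text \<open>Nelson's criterion. Let \<open>T\<close> be the closure of the restriction of the generator to \<open>D\<close>. If \<open>y\<close> is
  orthogonal to the range of \<open>1 - \<i> T\<close>, then for \<open>x \<in> D\<close> invariance makes the
  bounded function \<open>t \<mapsto> \<langle>G t x, y\<rangle>\<close> equal to its own derivative; it must vanish, and density gives \<open>y = 0\<close>.
  Hence \<open>1 - \<i> T\<close> is surjective while its extension \<open>1 - \<i> (generator G)\<close> is injective, so both operators
  agree.\<close>

lemma core_of_invariant_dense:
  fixes G :: "real \<Rightarrow> 'k::complex_hilbert_space \<Rightarrow> 'k"
  assumes G: "unitary_group G" and D: "csubspace D" and dense: "closure D = UNIV"
    and dom: "D \<subseteq> Domain (generator G)" and inv: "\<And>t x. x \<in> D \<Longrightarrow> G t x \<in> D"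
  shows "is_core D (generator G)"
proof -
  define T where "T = closure (generator G \<inter> (D \<times> UNIV))"
  have sub_T: "T \<subseteq> generator G"
    unfolding T_def by (rule closure_minimal) (auto simp: generator_closed[OF G])
  have sym_G: "symmetric_operator (generator G)"
    using generator_symmetric[OF G] by (auto simp: symmetric_operator_def)
  then have sym: "symmetric_operator T"
    using sub_T unfolding symmetric_operator_def by blast
  have "csubspace (generator G \<inter> (D \<times> UNIV))"
    using csubspace_generator[OF G] D
    by (auto simp: complex_vector.subspace_def zero_prod_def scaleC_prod_def)
  then have sub: "csubspace T"
    unfolding T_def by (rule csubspace_closure_prod)
  have orth: "y = 0" if y: "\<And>x w. (x, w) \<in> T \<Longrightarrow> cinner (x - (\<i> * of_real 1) *\<^sub>C w) y = 0" for y
  proof (rule orthogonal_dense_eq_0[OF dense])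
    fix x assume x: "x \<in> D"
    then obtain w where w: "(x, w) \<in> generator G"
      using dom by blast
    have eq: "cinner (\<i> *\<^sub>C G t w) y = cinner (G t x) y" for t
    proof -
      have "(G t x, G t w) \<in> T"
        unfolding T_def using generator_invariant[OF G w] inv[OF x] closure_subset by fastforce
      from y[OF this] show ?thesis
        by (simp add: bounded_bilinear.diff_left[OF bounded_bilinear_cinner])
    qed
    define f where "f = (\<lambda>t. exp (- t) *\<^sub>R cinner (G t x) y)"
    have "(f has_derivative (\<lambda>h. 0)) (at t within UNIV)" for t
    proof -
      have "((\<lambda>t. cinner (G t x) y) has_vector_derivative cinner (\<i> *\<^sub>C G t w) y) (at t)"
        by (rule bounded_linear.has_vector_derivative
            [OF bounded_bilinear.bounded_linear_left[OF bounded_bilinear_cinner]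
              has_vector_derivative_orbit[OF G w]])
      then have "((\<lambda>t. cinner (G t x) y) has_vector_derivative cinner (G t x) y) (at t)"
        unfolding eq .
      moreover have "((\<lambda>t. exp (- t)) has_field_derivative - exp (- t)) (at t)"
        by (auto intro!: derivative_eq_intros)
      ultimately have "(f has_vector_derivative
          exp (- t) *\<^sub>R cinner (G t x) y + (- exp (- t)) *\<^sub>R cinner (G t x) y) (at t)"
        unfolding f_def by (rule has_vector_derivative_scaleR[rotated])
      then show ?thesis
        by (simp add: has_vector_derivative_def)
    qed
    then obtain c where c: "\<And>t. f t = c"
      using has_derivative_zero_constant[of UNIV f] by auto
    have cf: "c = cinner x y"
      using c[of 0] by (simp add: f_def unitary_group_0[OF G])
    obtain B where B: "\<And>u. cmod (cinner u y) \<le> norm u * B"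
      using bounded_linear.bounded[OF bounded_bilinear.bounded_linear_left[OF bounded_bilinear_cinner, of y]]
      by blast
    \<comment> \<open>The matrix element is bounded in \<open>t\<close>, so \<open>f\<close> decays at infinity although it is constant.\<close>
    have "cmod c \<le> exp (- t) * (norm x * B)" for t
      using c[of t] B[of "G t x"]
      by (auto simp: f_def unitary_norm[OF unitary_group_unitary[OF G]])
    moreover have "((\<lambda>t::real. exp (- t) * (norm x * B)) \<longlongrightarrow> 0 * (norm x * B)) at_top"
      by (intro tendsto_mult tendsto_const filterlim_compose[OF exp_at_bot]
          filterlim_uminus_at_bot_at_top)
    ultimately have "cmod c \<le> 0 * (norm x * B)"
      by (intro tendsto_lowerbound[where F = at_top]) auto
    then show "cinner x y = 0"
      by (simp add: cf)
  qed
  have "generator G \<subseteq> T"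
  proof clarify
    fix x y assume xy: "(x, y) \<in> generator G"
    obtain x' y' where x': "(x', y') \<in> T"
      and eq: "x' - (\<i> * of_real 1) *\<^sub>C y' = x - (\<i> * of_real 1) *\<^sub>C y"
      using symmetric_range_shift[OF sub sym closed_closure[of "generator G \<inter> (D \<times> UNIV)", folded T_def]
          zero_neq_one[symmetric] orth] by blast
    have diff: "(x - x', y - y') \<in> generator G"
      using csubspace_graphD(2)[OF csubspace_generator[OF G] xy] x' sub_T by blast
    have "(x - x') - (\<i> * of_real 1) *\<^sub>C (y - y') = 0"
      using eq by (simp add: complex_vector.scale_right_diff_distrib algebra_simps)
    then have "norm (x - x') \<le> 0" "\<bar>1\<bar> * norm (y - y') \<le> 0"
      using symmetric_norm_shift_ge[OF sym_G diff, of 1] by simp_all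
    then show "(x, y) \<in> T"
      using x' by simp
  qed
  then show ?thesis
    using sub_T D dom by (auto simp: is_core_def T_def)
qed

section \<open>Stone's theorem\<close>

definition linear_contraction :: "('h::complex_hilbert_space \<Rightarrow> 'h) \<Rightarrow> bool" where
  "linear_contraction T \<longleftrightarrow> clinear T \<and> (\<forall>x. norm (T x) \<le> norm x)"

lemma linear_contractionD:
  assumes "linear_contraction T"
  shows "clinear T" "norm (T x) \<le> norm x"
    "T (x + y) = T x + T y" "T (x - y) = T x - T y" "T (c *\<^sub>C x) = c *\<^sub>C T x"
  using assms unfolding linear_contraction_def
  by (auto simp: clinear_add clinear_diff clinear_scaleC)

lemma linear_contraction_bounded_linear:
  "linear_contraction T \<Longrightarrow> bounded_linear T"
  by (rule bounded_linear_intro[of _ 1])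
    (simp_all add: linear_contractionD scaleR_scaleC)

lemma linear_contraction_comp:
  "linear_contraction S \<Longrightarrow> linear_contraction T \<Longrightarrow> linear_contraction (S \<circ> T)"
  unfolding linear_contraction_def
  by (auto intro!: clinearI simp: clinear_add clinear_scaleC intro: order_trans)

lemma linear_contraction_id: "linear_contraction id"
  by (auto simp: linear_contraction_def intro!: clinearI)

lemma linear_contraction_funpow: "linear_contraction T \<Longrightarrow> linear_contraction (T ^^ n)"
  by (induction n) (simp_all add: linear_contraction_id linear_contraction_comp)


text \<open>The telescoping sum \<open>P\<^sup>n - Q\<^sup>n = \<Sum> P\<^sup>i (P - Q) Q\<^sup>n\<^sup>-\<^sup>1\<^sup>-\<^sup>i\<close>, where commutativity lets \<open>P - Q\<close> act
  first on \<open>x\<close>.\<close>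

lemma norm_funpow_diff_le:
  assumes P: "linear_contraction P" and Q: "linear_contraction Q" and PQ: "P \<circ> Q = Q \<circ> P"
  shows "norm ((P ^^ n) x - (Q ^^ n) x) \<le> real n * norm (P x - Q x)"
proof (induction n)
  case (Suc n)
  have comm: "(P ^^ k) (Q y) = Q ((P ^^ k) y)" for k y
    by (induction k) (simp_all add: fun_eq_iff[THEN iffD1, OF PQ, simplified])
  have "(P ^^ Suc n) x - (Q ^^ Suc n) x = (P ^^ n) (P x - Q x) + Q ((P ^^ n) x - (Q ^^ n) x)"
    unfolding linear_contractionD(4)[OF linear_contraction_funpow[OF P]] linear_contractionD(4)[OF Q] comm
    by (simp add: funpow_swap1)
  also have "norm \<dots> \<le> norm (P x - Q x) + norm ((P ^^ n) x - (Q ^^ n) x)"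
    by (intro norm_triangle_le add_mono linear_contractionD(2) linear_contraction_funpow P Q)
  also have "\<dots> \<le> real (Suc n) * norm (P x - Q x)"
    using Suc.IH by (simp add: algebra_simps)
  finally show ?case .
qed simp

lemma linear_contraction_eqI:
  fixes S T :: "'h::complex_hilbert_space \<Rightarrow> 'h"
  assumes S: "linear_contraction S" and T: "linear_contraction T" and dense: "closure D = UNIV"
    and eq: "\<And>x. x \<in> D \<Longrightarrow> S x = T x"
  shows "S x = T x"
proof -
  have "x \<in> {x. S x = T x}"
    by (rule closed_superset_of_dense[OF _ dense])
      (auto intro!: closed_Collect_eq linear_continuous_on linear_contraction_bounded_linear S T simp: eq)
  then show ?thesis by simp
qed

lemma contractions_convergent:
  fixes T :: "nat \<Rightarrow> 'h::complex_hilbert_space \<Rightarrow> 'h"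
  assumes T: "\<And>n. linear_contraction (T n)" and dense: "closure D = UNIV"
    and conv: "\<And>x. x \<in> D \<Longrightarrow> convergent (\<lambda>n. T n x)"
  shows "convergent (\<lambda>n. T n x)"
proof -
  have "Cauchy (\<lambda>n. T n x)"
  proof (rule CauchyI)
    fix e :: real assume e: "e > 0"
    obtain y where y: "y \<in> D" "dist y x < e / 3"
      using dense e closure_approachable[of x D] by (metis UNIV_I divide_pos_pos zero_less_numeral)
    have "Cauchy (\<lambda>n. T n y)"
      using conv[OF y(1)] by (simp add: Cauchy_convergent_iff)
    then obtain N where N: "\<And>m n. m \<ge> N \<Longrightarrow> n \<ge> N \<Longrightarrow> norm (T m y - T n y) < e / 3"
      unfolding Cauchy_iff using e by (metis divide_pos_pos zero_less_numeral)
    have "norm (T m x - T n x) < e" if "m \<ge> N" "n \<ge> N" for m n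
    proof -
      have "T m x - T n x = T m (x - y) + (T m y - T n y) + T n (y - x)"
        by (simp add: linear_contractionD(4)[OF T])
      also have "norm \<dots> \<le> norm (x - y) + norm (T m y - T n y) + norm (y - x)"
        by (intro norm_triangle_le add_mono linear_contractionD(2)[OF T] order_refl)
      also have "\<dots> < e"
        using N[OF that] y(2) by (simp add: dist_norm norm_minus_commute)
      finally show ?thesis .
    qed
    then show "\<exists>N. \<forall>m\<ge>N. \<forall>n\<ge>N. norm (T m x - T n x) < e" by blast
  qed
  then show ?thesis
    by (simp add: Cauchy_convergent_iff)
qed

text \<open>Polarization recovers the real inner product from the norm, and with it the complex one.\<close>

lemma clinear_isometry_unitary:
  fixes T :: "'h::complex_hilbert_space \<Rightarrow> 'h"
  assumes lin: "clinear T" and iso: "\<And>x. norm (T x) = norm x" and "surj T"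
  shows "unitary_operator T"
proof -
  have inner: "inner (T x) (T y) = inner x y" for x y
  proof -
    have "(norm (T (x + y)))\<^sup>2 = (norm (x + y))\<^sup>2" "(norm (T x))\<^sup>2 = (norm x)\<^sup>2" "(norm (T y))\<^sup>2 = (norm y)\<^sup>2"
      by (simp_all add: iso)
    then show ?thesis
      unfolding clinear_add[OF lin] power2_norm_eq_inner
      by (simp add: inner_add_left inner_add_right inner_commute)
  qed
  have "cinner (T x) (T y) = cinner x y" for x y
    unfolding cinner_eq_inner[of "T x"] cinner_eq_inner[of x]
    using inner[of "- \<i> *\<^sub>C x" y] by (simp add: inner clinear_scaleC[OF lin] flip: clinear_scaleC[OF lin])
  then show ?thesis
    using assms by (simp add: unitary_operator_def)
qed

lemma self_adjoint_symmetric: "self_adjoint A \<Longrightarrow> symmetric_operator A"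
  unfolding self_adjoint_def symmetric_operator_def adjoint_operator_def by fast

lemma self_adjoint_closed:
  fixes A :: "'h::complex_hilbert_space unbounded_operator"
  assumes "self_adjoint A"
  shows "closed A"
proof -
  have "adjoint_operator A = (\<Inter>q\<in>A. {p. cinner (snd q) (fst p) = cinner (fst q) (snd p)})"
    by (simp add: adjoint_operator_def case_prod_unfold set_eq_iff)
  moreover have "closed (\<Inter>q\<in>A. {p. cinner (snd q) (fst p) = cinner (fst q) (snd p)})"
    by (intro closed_INT ballI closed_Collect_eq
        bounded_bilinear.continuous_on[OF bounded_bilinear_cinner] continuous_intros)
  ultimately show ?thesis
    using assms by (simp add: self_adjoint_def)
qed

text \<open>The inverse of \<open>1 - \<i> h A\<close>. At \<open>h = 0\<close> the equation \<open>x = y\<close> is solvable in the domain of \<open>A\<close> only for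
  some \<open>y\<close>, so the value there is fixed to be the continuous extension, the identity.\<close>

definition resolvent :: "'h::complex_hilbert_space unbounded_operator \<Rightarrow> real \<Rightarrow> 'h \<Rightarrow> 'h" where
  "resolvent A h y =
     (if h = 0 then y else (THE x. \<exists>w. (x, w) \<in> A \<and> x - (\<i> * of_real h) *\<^sub>C w = y))"

text \<open>The Euler approximant \<open>(1 - \<i> t A / N)\<^sup>-\<^sup>N\<close> of \<open>e\<^sup>\<i>\<^sup>t\<^sup>A\<close> with \<open>N = 2 ^ n\<close>. Along powers of two,
  consecutive approximants differ only by halving the step, so that the group law and convergence follow from one
  estimate.\<close>

definition euler :: "'h::complex_hilbert_space unbounded_operator \<Rightarrow> nat \<Rightarrow> real \<Rightarrow> 'h \<Rightarrow> 'h" where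
  "euler A n t = resolvent A (t / 2 ^ n) ^^ (2 ^ n)"

context
  fixes A :: "'h::complex_hilbert_space unbounded_operator"
  assumes A: "self_adjoint A"
begin

private lemma sub: "csubspace A" and dense: "closure (Domain A) = UNIV"
  using A by (auto simp: self_adjoint_def linear_operator_def)

private lemmas sym = self_adjoint_symmetric[OF A]

text \<open>A vector orthogonal to the range lies in the domain of the adjoint, which is \<open>A\<close> itself, as an
  eigenvector with eigenvalue \<open>\<i> / h\<close>; but then it is orthogonal to twice itself.\<close>

lemma self_adjoint_range_shift:
  assumes h: "h \<noteq> 0"
  shows "\<exists>x w. (x, w) \<in> A \<and> x - (\<i> * of_real h) *\<^sub>C w = y"
proof (rule symmetric_range_shift[OF sub sym self_adjoint_closed[OF A] h])
  fix y assume y: "\<And>x w. (x, w) \<in> A \<Longrightarrow> cinner (x - (\<i> * of_real h) *\<^sub>C w) y = 0"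
  have "cinner w y = cinner x ((\<i> / of_real h) *\<^sub>C y)" if "(x, w) \<in> A" for x w
    using y[OF that] h
    by (simp add: bounded_bilinear.diff_left[OF bounded_bilinear_cinner] cinner_scaleC_left
        cinner_scaleC_right field_simps)
  then have "(y, (\<i> / of_real h) *\<^sub>C y) \<in> A"
    using A by (auto simp: self_adjoint_def adjoint_operator_def)
  from y[OF this] have "cinner (y + y) y = 0"
    using h by (simp add: scaleC_scaleC scaleC_one)
  then show "y = 0"
    by (simp add: cinner_add_left cinner_self)
qed

lemma resolvent_shift:
  assumes xw: "(x, w) \<in> A"
  shows "resolvent A h (x - (\<i> * of_real h) *\<^sub>C w) = x"
proof (cases "h = 0")
  case False
  have "x' = x" if "(x', w') \<in> A" "x' - (\<i> * of_real h) *\<^sub>C w' = x - (\<i> * of_real h) *\<^sub>C w" for x' w'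
  proof -
    have "(x' - x) - (\<i> * of_real h) *\<^sub>C (w' - w) = 0"
      using that(2) by (simp add: complex_vector.scale_right_diff_distrib algebra_simps)
    then have "norm (x' - x) \<le> 0"
      using symmetric_norm_shift_ge(1)[OF sym csubspace_graphD(2)[OF sub that(1) xw], of h] by simp
    then show ?thesis by simp
  qed
  then show ?thesis
    using False xw unfolding resolvent_def by (auto intro!: the_equality)
qed (simp add: resolvent_def)

lemma resolvent_cases:
  assumes "h \<noteq> 0"
  obtains w where "(resolvent A h y, w) \<in> A" "resolvent A h y - (\<i> * of_real h) *\<^sub>C w = y"
  using self_adjoint_range_shift[OF assms, of y] resolvent_shift[where h = h] by metis

lemma linear_contraction_resolvent: "linear_contraction (resolvent A h)"
proof (cases "h = 0")
  case True
  then show ?thesis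
    by (auto simp: resolvent_def linear_contraction_def intro!: clinearI)
next
  case False
  have "norm (resolvent A h y) \<le> norm y" for y
  proof -
    obtain w where w: "(resolvent A h y, w) \<in> A" "resolvent A h y - (\<i> * of_real h) *\<^sub>C w = y"
      by (rule resolvent_cases[OF False])
    then show ?thesis
      using symmetric_norm_shift_ge(1)[OF sym w(1), of h] by simp
  qed
  moreover have "clinear (resolvent A h)"
  proof (rule clinearI)
    fix y y' c
    obtain w where w: "(resolvent A h y, w) \<in> A" "resolvent A h y - (\<i> * of_real h) *\<^sub>C w = y"
      by (rule resolvent_cases[OF False])
    obtain w' where w': "(resolvent A h y', w') \<in> A" "resolvent A h y' - (\<i> * of_real h) *\<^sub>C w' = y'"
      by (rule resolvent_cases[OF False])
    have "(resolvent A h y + resolvent A h y') - (\<i> * of_real h) *\<^sub>C (w + w') = y + y'"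
      using w(2) w'(2) by (simp add: scaleC_add_right algebra_simps)
    then show "resolvent A h (y + y') = resolvent A h y + resolvent A h y'"
      using resolvent_shift[OF csubspace_graphD(1)[OF sub w(1) w'(1)], of h] by simp
    have "c *\<^sub>C resolvent A h y - (\<i> * of_real h) *\<^sub>C (c *\<^sub>C w)
        = c *\<^sub>C (resolvent A h y - (\<i> * of_real h) *\<^sub>C w)"
      by (simp add: complex_vector.scale_right_diff_distrib scaleC_scaleC mult.commute)
    then show "resolvent A h (c *\<^sub>C y) = c *\<^sub>C resolvent A h y"
      using resolvent_shift[OF csubspace_graphD(3)[OF sub w(1)], of h c] w(2) by simp
  qed
  ultimately show ?thesis
    by (simp add: linear_contraction_def)
qed

private lemmas R = linear_contractionD[OF linear_contraction_resolvent]

text \<open>The second component of the resolvent, a multiple of \<open>resolvent A h x - x\<close>, lies in the domain of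
  \<open>A\<close> because \<open>x\<close> does.\<close>

lemma resolvent_commutes_operator:
  assumes xw: "(x, w) \<in> A"
  shows "(resolvent A h x, resolvent A h w) \<in> A"
proof (cases "h = 0")
  case False
  obtain v where v: "(resolvent A h x, v) \<in> A" "resolvent A h x - (\<i> * of_real h) *\<^sub>C v = x"
    by (rule resolvent_cases[OF False])
  have v_eq: "v = (1 / (\<i> * of_real h)) *\<^sub>C (resolvent A h x - x)"
  proof -
    have "resolvent A h x - x = (\<i> * of_real h) *\<^sub>C v"
      using v(2) by (simp add: algebra_simps)
    then show ?thesis
      using False by (simp add: scaleC_scaleC scaleC_one)
  qed
  have "(v, (1 / (\<i> * of_real h)) *\<^sub>C (v - w)) \<in> A"
    unfolding v_eq by (intro csubspace_graphD(2,3)[OF sub] v(1)[unfolded v_eq] xw)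
  from resolvent_shift[OF this, of h] have "resolvent A h w = v"
    using False by (simp add: scaleC_scaleC scaleC_one)
  then show ?thesis
    using v(1) by simp
qed (simp add: resolvent_def xw)

lemma resolvent_commute: "resolvent A h (resolvent A k y) = resolvent A k (resolvent A h y)"
proof (cases "h = 0")
  case False
  obtain v where v: "(resolvent A h y, v) \<in> A" "resolvent A h y - (\<i> * of_real h) *\<^sub>C v = y"
    by (rule resolvent_cases[OF False])
  have "resolvent A k y = resolvent A k (resolvent A h y - (\<i> * of_real h) *\<^sub>C v)"
    using v(2) by simp
  also have "\<dots> = resolvent A k (resolvent A h y) - (\<i> * of_real h) *\<^sub>C resolvent A k v"
    by (simp only: R)
  finally show ?thesis
    using resolvent_shift[OF resolvent_commutes_operator[OF v(1), of k], of h] by simp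
qed (simp add: resolvent_def)

lemma resolvent_minus:
  assumes "(x, w) \<in> A"
  shows "resolvent A h x - x = (\<i> * of_real h) *\<^sub>C resolvent A h w"
  using resolvent_shift[OF assms, of h] unfolding R by (simp add: algebra_simps)

lemma norm_resolvent_minus_le:
  assumes "(x, w) \<in> A"
  shows "norm (resolvent A h x - x) \<le> \<bar>h\<bar> * norm w"
  unfolding resolvent_minus[OF assms]
  by (simp add: norm_scaleC_hilbert norm_mult mult_left_mono R(2))

text \<open>Resolvents with small \<open>h\<close> move a vector of the domain of \<open>A\<close> by little and bring it into the domain
  of the square of \<open>A\<close>.\<close>

lemma dense_domain_square: "closure {x. \<exists>w v. (x, w) \<in> A \<and> (w, v) \<in> A} = UNIV" (is "closure ?D = _")
proof -
  have "Domain A \<subseteq> closure ?D"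
  proof clarify
    fix x w assume xw: "(x, w) \<in> A"
    show "x \<in> closure ?D"
      unfolding closure_approachable
    proof (intro allI impI)
      fix e :: real assume e: "e > 0"
      define c where "c = norm w + 1"
      have c: "c > 0" "norm w < c"
        by (simp_all add: c_def add_nonneg_pos)
      define h where "h = e / c"
      have h: "h > 0" "h * norm w < e"
        using e c by (simp_all add: h_def pos_divide_less_eq)
      have "resolvent A h x \<in> ?D"
        using resolvent_commutes_operator[OF xw, of h] resolvent_cases[of h w] h(1) by blast
      moreover have "dist (resolvent A h x) x < e"
        using norm_resolvent_minus_le[OF xw, of h] h by (simp add: dist_norm)
      ultimately show "\<exists>y\<in>?D. dist y x < e" by blast
    qed
  qed
  then have "closure (Domain A) \<subseteq> closure ?D"
    by (rule closure_minimal) simp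
  then show ?thesis
    using dense by blast
qed

text \<open>Formally \<open>(1 - \<i> h A) (1 - \<i> k A) = 1 - \<i> (h + k) A - h k A\<^sup>2\<close>, so the difference of
  the inverses is \<open>h k A\<^sup>2\<close> preceded by three contractions.\<close>

lemma norm_resolvent_product_diff:
  assumes xw: "(x, w) \<in> A" and wv: "(w, v) \<in> A"
  shows "norm (resolvent A h (resolvent A k x) - resolvent A (h + k) x) \<le> \<bar>h * k\<bar> * norm v"
proof -
  define z where "z = x - (\<i> * of_real (h + k)) *\<^sub>C w"
  define q where "q = (of_real (h * k) :: complex) *\<^sub>C v"
  have "(x - (\<i> * of_real k) *\<^sub>C w, w - (\<i> * of_real k) *\<^sub>C v) \<in> A"
    by (intro csubspace_graphD(2,3)[OF sub] xw wv)
  from resolvent_shift[OF this, of h]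
  have "resolvent A k (resolvent A h ((x - (\<i> * of_real k) *\<^sub>C w)
      - (\<i> * of_real h) *\<^sub>C (w - (\<i> * of_real k) *\<^sub>C v))) = x"
    using resolvent_shift[OF xw, of k] by simp
  also have "(x - (\<i> * of_real k) *\<^sub>C w) - (\<i> * of_real h) *\<^sub>C (w - (\<i> * of_real k) *\<^sub>C v) = z - q"
    by (simp add: z_def q_def complex_vector.scale_right_diff_distrib scaleC_scaleC scaleC_add_left
        complex_vector.scale_left_diff_distrib algebra_simps)
  finally have x: "x = resolvent A k (resolvent A h (z - q))" ..
  \<comment> \<open>\<open>z - q\<close> is \<open>(1 - \<i> h A) (1 - \<i> k A) x\<close> and \<open>z\<close> is \<open>(1 - \<i> (h + k) A) x\<close>.\<close>
  have rz: "resolvent A (h + k) z = x"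
    unfolding z_def by (rule resolvent_shift[OF xw])
  have "resolvent A h (resolvent A k x) - resolvent A (h + k) x
      = resolvent A h (resolvent A k (resolvent A (h + k) z))
        - resolvent A (h + k) (resolvent A k (resolvent A h (z - q)))"
    using rz x by simp
  also have "\<dots> = resolvent A (h + k) (resolvent A k (resolvent A h q))"
    by (simp add: R(4) resolvent_commute)
  finally show ?thesis
    using order_trans[OF R(2)[of "h + k"] order_trans[OF R(2)[of k] R(2)[of h q]]]
    by (simp add: q_def norm_scaleC_hilbert norm_mult abs_mult)
qed

lemma linear_contraction_euler: "linear_contraction (euler A n t)"
  unfolding euler_def by (intro linear_contraction_funpow linear_contraction_resolvent)

text \<open>This gives the group law in the limit, and for \<open>s = t\<close> it bounds consecutive approximants: by
  \<open>euler_Suc\<close> the product of two copies at half the time is the next approximant.\<close>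

lemma euler_add_bound:
  assumes xw: "(x, w) \<in> A" and wv: "(w, v) \<in> A"
  shows "norm (euler A n s (euler A n t x) - euler A n (s + t) x) \<le> \<bar>s * t\<bar> * norm v / 2 ^ n"
proof -
  let ?h = "s / 2 ^ n" and ?k = "t / 2 ^ n" and ?N = "2 ^ n :: nat"
  let ?P = "resolvent A ?h \<circ> resolvent A ?k"
  have "(?P ^^ m) y = (resolvent A ?h ^^ m) ((resolvent A ?k ^^ m) y)" for m y
  proof (induction m)
    case (Suc m)
    have "(resolvent A ?h ^^ m) (resolvent A ?k z) = resolvent A ?k ((resolvent A ?h ^^ m) z)" for z
      by (induction m) (simp_all add: resolvent_commute)
    with Suc show ?case by simp
  qed simp
  then have "norm (euler A n s (euler A n t x) - euler A n (s + t) x)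
      = norm ((?P ^^ ?N) x - (resolvent A (?h + ?k) ^^ ?N) x)"
    by (simp add: euler_def add_divide_distrib)
  also have "\<dots> \<le> real ?N * norm (?P x - resolvent A (?h + ?k) x)"
    by (intro norm_funpow_diff_le linear_contraction_comp linear_contraction_resolvent)
      (simp add: fun_eq_iff resolvent_commute)
  also have "\<dots> \<le> real ?N * (\<bar>?h * ?k\<bar> * norm v)"
    using norm_resolvent_product_diff[OF xw wv, of ?h ?k] by (intro mult_left_mono) simp_all
  also have "\<dots> = \<bar>s * t\<bar> * norm v / 2 ^ n"
    by (simp add: abs_mult)
  finally show ?thesis .
qed

lemma euler_Suc: "euler A (Suc n) t = euler A n (t / 2) \<circ> euler A n (t / 2)"
proof -
  have "t / 2 ^ Suc n = t / 2 / 2 ^ n" "(2::nat) ^ Suc n = 2 ^ n + 2 ^ n"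
    by simp_all
  then show ?thesis
    by (simp only: euler_def funpow_add)
qed

lemma euler_convergent: "convergent (\<lambda>n. euler A n t x)"
proof (rule contractions_convergent[OF linear_contraction_euler dense_domain_square])
  fix x assume "x \<in> {x. \<exists>w v. (x, w) \<in> A \<and> (w, v) \<in> A}"
  then obtain w v where xw: "(x, w) \<in> A" and wv: "(w, v) \<in> A" by blast
  define d where "d = (\<lambda>n. euler A (Suc n) t x - euler A n t x)"
  have "norm (d n) \<le> \<bar>t / 2 * (t / 2)\<bar> * norm v * (1 / 2) ^ n" for n
    using euler_add_bound[OF xw wv, of n "t / 2" "t / 2"]
    by (simp add: d_def euler_Suc power_divide)
  moreover have "summable (\<lambda>n. C * (1 / 2) ^ n)" for C :: real
    by (intro summable_mult summable_geometric) simp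
  ultimately have "summable d"
    by (blast intro: summable_comparison_test')
  then have "convergent (\<lambda>n. euler A 0 t x + (\<Sum>i<n. d i))"
    by (intro convergent_add convergent_const) (simp add: summable_iff_convergent)
  then show "convergent (\<lambda>n. euler A n t x)"
    unfolding d_def sum_lessThan_telescope[where f = "\<lambda>n. euler A n t x"] by simp
qed

definition stone_group :: "real \<Rightarrow> 'h \<Rightarrow> 'h" where
  "stone_group t x = lim (\<lambda>n. euler A n t x)"

lemma euler_tendsto: "(\<lambda>n. euler A n t x) \<longlonglongrightarrow> stone_group t x"
  using euler_convergent unfolding stone_group_def by (simp add: convergent_LIMSEQ_iff)

lemma linear_contraction_stone_group: "linear_contraction (stone_group t)"
  unfolding linear_contraction_def
proof (intro conjI clinearI allI)
  fix x y c
  note E = linear_contractionD[OF linear_contraction_euler]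
  show "stone_group t (x + y) = stone_group t x + stone_group t y"
    by (rule LIMSEQ_unique[OF euler_tendsto]) (unfold E, intro tendsto_add euler_tendsto)
  show "stone_group t (c *\<^sub>C x) = c *\<^sub>C stone_group t x"
    by (rule LIMSEQ_unique[OF euler_tendsto])
      (unfold E, intro tendsto_scaleC_hilbert tendsto_const euler_tendsto)
  show "norm (stone_group t x) \<le> norm x"
    by (rule LIMSEQ_le_const2[OF tendsto_norm[OF euler_tendsto]]) (simp add: E)
qed

lemma stone_group_add: "stone_group (s + t) x = stone_group s (stone_group t x)"
proof -
  have "stone_group (s + t) x = (stone_group s \<circ> stone_group t) x"
  proof (rule linear_contraction_eqI[where S = "stone_group (s + t)" and T = "stone_group s \<circ> stone_group t",
        OF _ _ dense_domain_square])
    fix x assume "x \<in> {x. \<exists>w v. (x, w) \<in> A \<and> (w, v) \<in> A}"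
    then obtain w v where xw: "(x, w) \<in> A" and wv: "(w, v) \<in> A" by blast
    have "(\<lambda>n. euler A n s (euler A n t x) - euler A n (s + t) x) \<longlonglongrightarrow> 0"
    proof (rule Lim_null_comparison)
      show "\<forall>\<^sub>F n in sequentially. norm (euler A n s (euler A n t x) - euler A n (s + t) x)
          \<le> \<bar>s * t\<bar> * norm v * (1 / 2) ^ n"
        using euler_add_bound[OF xw wv] by (simp add: power_divide)
      show "(\<lambda>n. \<bar>s * t\<bar> * norm v * (1 / 2) ^ n) \<longlonglongrightarrow> 0"
        by (intro tendsto_mult_right_zero LIMSEQ_power_zero) simp
    qed
    moreover have "(\<lambda>n. euler A n s (euler A n t x) - euler A n s (stone_group t x)) \<longlonglongrightarrow> 0"
    proof (rule Lim_null_comparison)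
      show "\<forall>\<^sub>F n in sequentially. norm (euler A n s (euler A n t x) - euler A n s (stone_group t x))
          \<le> norm (euler A n t x - stone_group t x)"
        by (simp add: linear_contractionD(2)[OF linear_contraction_euler]
            flip: linear_contractionD(4)[OF linear_contraction_euler])
      show "(\<lambda>n. norm (euler A n t x - stone_group t x)) \<longlonglongrightarrow> 0"
        by (intro tendsto_norm_zero) (simp add: LIM_zero_iff euler_tendsto)
    qed
    ultimately have "(\<lambda>n. (euler A n s (euler A n t x) - euler A n s (stone_group t x)
        - (euler A n s (euler A n t x) - euler A n (s + t) x)) + euler A n s (stone_group t x))
        \<longlonglongrightarrow> (0 - 0) + stone_group s (stone_group t x)"
      by (intro tendsto_add tendsto_diff euler_tendsto)
    then have "(\<lambda>n. euler A n (s + t) x) \<longlonglongrightarrow> stone_group s (stone_group t x)"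
      by simp
    with euler_tendsto have "stone_group (s + t) x = stone_group s (stone_group t x)"
      by (rule LIMSEQ_unique)
    then show "stone_group (s + t) x = (stone_group s \<circ> stone_group t) x" by simp
  qed (intro linear_contraction_comp linear_contraction_stone_group)+
  then show ?thesis by simp
qed

text \<open>The vector \<open>y\<close> from the domain stands in for \<open>w = A x\<close>, on which the resolvents cannot be
  estimated directly. Choosing \<open>y\<close> close to \<open>w\<close> first and then \<open>t\<close> small makes the right-hand side
  \<open>o(t)\<close>.\<close>

lemma norm_stone_group_minus_le:
  assumes xw: "(x, w) \<in> A" and yv: "(y, v) \<in> A"
  shows "norm (stone_group t x - x - (\<i> * of_real t) *\<^sub>C w) \<le> \<bar>t\<bar> * (2 * norm (w - y) + \<bar>t\<bar> * norm v)"
proof -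
  let ?C = "2 * norm (w - y) + \<bar>t\<bar> * norm v"
  have "norm (euler A n t x - x - (\<i> * of_real t) *\<^sub>C w) \<le> \<bar>t\<bar> * ?C" for n
  proof -
    define h where "h = t / 2 ^ n"
    define P where "P = resolvent A h"
    note Pk = linear_contractionD[OF linear_contraction_funpow[OF linear_contraction_resolvent, of _ h], folded P_def]
    have h_le: "real k * \<bar>h\<bar> \<le> \<bar>t\<bar>" if "k \<le> 2 ^ n" for k
    proof -
      have "real k * \<bar>h\<bar> \<le> 2 ^ n * \<bar>h\<bar>"
        using that by (intro mult_right_mono) (metis of_nat_le_iff of_nat_numeral of_nat_power, simp)
      then show ?thesis by (simp add: h_def abs_divide)
    qed
    have step: "norm ((P ^^ k) w - w) \<le> ?C" if "k \<le> 2 ^ n" for k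
    proof -
      have "norm ((P ^^ k) y - (id ^^ k) y) \<le> real k * norm (P y - id y)"
        unfolding P_def
        by (intro norm_funpow_diff_le linear_contraction_resolvent linear_contraction_id) simp
      also have "\<dots> \<le> real k * (\<bar>h\<bar> * norm v)"
        using norm_resolvent_minus_le[OF yv, of h] by (intro mult_left_mono) (simp_all add: P_def)
      also have "\<dots> \<le> \<bar>t\<bar> * norm v"
        using mult_right_mono[OF h_le[OF that], of "norm v"] by (simp add: mult.assoc)
      finally have y: "norm ((P ^^ k) y - y) \<le> \<bar>t\<bar> * norm v"
        by simp
      have "(P ^^ k) w - w = (P ^^ k) (w - y) + (y - w) + ((P ^^ k) y - y)"
        by (simp add: Pk(4))
      also have "norm \<dots> \<le> norm (w - y) + norm (y - w) + \<bar>t\<bar> * norm v"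
        by (intro norm_triangle_le add_mono Pk(2) y order_refl)
      finally show ?thesis by (simp add: norm_minus_commute)
    qed
    have "norm ((P ^^ k) x - x - (\<i> * of_real (real k * h)) *\<^sub>C w) \<le> real k * \<bar>h\<bar> * ?C" if "k \<le> 2 ^ n" for k
      using that
    proof (induction k)
      case (Suc k)
      have "(P ^^ Suc k) x - (P ^^ k) x = (P ^^ k) (P x - x)"
        by (simp only: Pk(4) funpow_Suc_right o_def)
      also have "\<dots> = (\<i> * of_real h) *\<^sub>C (P ^^ Suc k) w"
        by (simp only: P_def resolvent_minus[OF xw] funpow_Suc_right o_def Pk(5)[unfolded P_def])
      finally have eq: "(P ^^ Suc k) x = (P ^^ k) x + (\<i> * of_real h) *\<^sub>C (P ^^ Suc k) w"
        by (simp add: algebra_simps)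
      have "(P ^^ Suc k) x - x - (\<i> * of_real (real (Suc k) * h)) *\<^sub>C w
          = ((P ^^ k) x - x - (\<i> * of_real (real k * h)) *\<^sub>C w)
            + (\<i> * of_real h) *\<^sub>C ((P ^^ Suc k) w - w)"
        unfolding eq
        by (simp add: scaleC_add_left complex_vector.scale_right_diff_distrib algebra_simps)
      also have "norm \<dots> \<le> real k * \<bar>h\<bar> * ?C + \<bar>h\<bar> * ?C"
        using Suc step[of "Suc k"]
        by (intro norm_triangle_le add_mono) (auto simp: norm_scaleC_hilbert norm_mult intro!: mult_left_mono)
      finally show ?case by (simp add: algebra_simps)
    qed simp
    from this[of "2 ^ n"] show ?thesis
      by (simp add: euler_def P_def h_def)
  qed
  moreover have "(\<lambda>n. norm (euler A n t x - x - (\<i> * of_real t) *\<^sub>C w))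
      \<longlonglongrightarrow> norm (stone_group t x - x - (\<i> * of_real t) *\<^sub>C w)"
    by (intro tendsto_intros euler_tendsto)
  ultimately show ?thesis
    by (blast intro: LIMSEQ_le_const2)
qed

lemma unitary_group_stone_group: "unitary_group stone_group"
proof -
  have zero: "stone_group 0 x = x" for x
  proof -
    have "euler A n 0 x = x" for n
      unfolding euler_def resolvent_def by (simp add: id_def[symmetric])
    then show ?thesis
      using euler_tendsto[of 0 x] by (simp add: LIMSEQ_const_iff)
  qed
  note S = linear_contractionD[OF linear_contraction_stone_group]
  have inv: "stone_group t (stone_group (- t) x) = x" for t x
    using stone_group_add[of t "- t" x] by (simp add: zero)
  have norm: "norm (stone_group t x) = norm x" for t x
    using S(2)[of t x] S(2)[of "- t" "stone_group t x"] inv[of "- t" x] by simp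
  have unit: "unitary_operator (stone_group t)" for t
    by (rule clinear_isometry_unitary[OF S(1) norm]) (metis surjI inv)
  have dom: "isCont (\<lambda>t. stone_group t x) 0" if xw: "(x, w) \<in> A" for x w
  proof -
    obtain y v where yv: "(y, v) \<in> A"
      using xw by blast
    have "((\<lambda>t. stone_group t x - x - (\<i> * of_real t) *\<^sub>C w) \<longlongrightarrow> 0) (at 0)"
    proof (rule Lim_null_comparison)
      show "\<forall>\<^sub>F t in at 0. norm (stone_group t x - x - (\<i> * of_real t) *\<^sub>C w)
          \<le> \<bar>t\<bar> * (2 * norm (w - y) + \<bar>t\<bar> * norm v)"
        using norm_stone_group_minus_le[OF xw yv] by simp
      show "((\<lambda>t. \<bar>t\<bar> * (2 * norm (w - y) + \<bar>t\<bar> * norm v)) \<longlongrightarrow> 0) (at 0)"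
        by (auto intro!: tendsto_eq_intros)
    qed
    moreover have "((\<lambda>t. x + (\<i> * of_real t) *\<^sub>C w) \<longlongrightarrow> x + (\<i> * of_real 0) *\<^sub>C w) (at (0::real))"
      by (intro tendsto_intros tendsto_scaleC_hilbert)
    ultimately have "((\<lambda>t. (stone_group t x - x - (\<i> * of_real t) *\<^sub>C w) + (x + (\<i> * of_real t) *\<^sub>C w))
        \<longlongrightarrow> 0 + (x + (\<i> * of_real 0) *\<^sub>C w)) (at 0)"
      by (rule tendsto_add)
    then show ?thesis
      by (simp add: isCont_def zero)
  qed
  have cont0: "isCont (\<lambda>t. stone_group t x) 0" for x
    unfolding continuous_at_eps_delta
  proof (intro allI impI)
    fix e :: real assume e: "e > 0"
    obtain y w where yw: "(y, w) \<in> A" "dist y x < e / 3"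
      using dense e closure_approachable[of x "Domain A"] by (metis DomainE UNIV_I divide_pos_pos zero_less_numeral)
    obtain d where d: "d > 0" "\<And>t. dist t 0 < d \<Longrightarrow> dist (stone_group t y) y < e / 3"
      using dom[OF yw(1)] e unfolding continuous_at_eps_delta by (metis divide_pos_pos zero_less_numeral zero)
    have "dist (stone_group t x) (stone_group 0 x) < e" if "dist t 0 < d" for t
    proof -
      have "stone_group t x - x = stone_group t (x - y) + (stone_group t y - y) + (y - x)"
        by (simp add: S(4))
      also have "norm \<dots> \<le> norm (x - y) + norm (stone_group t y - y) + norm (y - x)"
        by (intro norm_triangle_le add_mono S(2) order_refl)
      also have "\<dots> < e"
        using d(2)[OF that] yw(2) by (simp add: dist_norm norm_minus_commute)
      finally show ?thesis by (simp add: dist_norm zero)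
    qed
    then show "\<exists>d>0. \<forall>t. dist t 0 < d \<longrightarrow> dist (stone_group t x) (stone_group 0 x) < e"
      using d(1) by blast
  qed
  have "isCont (\<lambda>t. stone_group t x) s" for x s
  proof -
    have "isCont (\<lambda>t. stone_group s (stone_group (t - s) x)) s"
      by (intro bounded_linear.isCont[OF linear_contraction_bounded_linear[OF linear_contraction_stone_group]]
          isCont_o2[where f = "\<lambda>t. t - s" and g = "\<lambda>t. stone_group t x"]) (simp_all add: cont0)
    then show ?thesis
      by (simp flip: stone_group_add)
  qed
  then show ?thesis
    unfolding unitary_group_def using unit
    by (auto simp: stone_group_add fun_eq_iff continuous_on_eq_continuous_at)
qed

text \<open>Once the generator extends \<open>A\<close>, its symmetry places it inside the adjoint of \<open>A\<close>, that is, inside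
  \<open>A\<close>.\<close>

lemma generator_stone_group: "generator stone_group = A"
proof
  show sup: "A \<subseteq> generator stone_group"
  proof clarify
    fix x w assume xw: "(x, w) \<in> A"
    have "\<exists>d>0. \<forall>t. norm (t - 0) < d \<longrightarrow>
        norm (stone_group t x - stone_group 0 x - (t - 0) *\<^sub>R (\<i> *\<^sub>C w)) \<le> e * norm (t - 0)" if e: "e > 0" for e
    proof -
      obtain y v where yv: "(y, v) \<in> A" "dist y w < e / 4"
        using dense e closure_approachable[of w "Domain A"]
        by (metis DomainE UNIV_I divide_pos_pos zero_less_numeral)
      define c where "c = norm v + 1"
      have c: "c > 0" "norm v \<le> c"
        by (simp_all add: c_def add_nonneg_pos)
      define d where "d = e / 2 / c"
      have d: "d > 0" "d * norm v \<le> e / 2"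
        using e c by (simp_all add: d_def pos_divide_le_eq)
      have "norm (stone_group t x - stone_group 0 x - (t - 0) *\<^sub>R (\<i> *\<^sub>C w)) \<le> e * norm (t - 0)"
        if t: "norm (t - 0) < d" for t
      proof -
        have "\<bar>t\<bar> * norm v \<le> d * norm v"
          using t by (intro mult_right_mono) auto
        then have "2 * norm (w - y) + \<bar>t\<bar> * norm v \<le> e"
          using d(2) yv(2) by (simp add: dist_norm norm_minus_commute)
        then have "\<bar>t\<bar> * (2 * norm (w - y) + \<bar>t\<bar> * norm v) \<le> \<bar>t\<bar> * e"
          by (rule mult_left_mono) simp
        then show ?thesis
          using norm_stone_group_minus_le[OF xw yv(1), of t]
          by (simp add: unitary_group_0[OF unitary_group_stone_group] scaleR_scaleC scaleC_scaleC mult.commute)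
      qed
      then show ?thesis using d(1) by blast
    qed
    then have "((\<lambda>t. stone_group t x) has_vector_derivative \<i> *\<^sub>C w) (at 0)"
      unfolding has_vector_derivative_def has_derivative_at_alt
      by (auto simp: bounded_linear_scaleR_left)
    then show "(x, w) \<in> generator stone_group"
      by (simp add: in_generator_iff[OF unitary_group_stone_group])
  qed
  show "generator stone_group \<subseteq> A"
  proof clarify
    fix x y assume "(x, y) \<in> generator stone_group"
    then have "(x, y) \<in> adjoint_operator A"
      using generator_symmetric[OF unitary_group_stone_group] sup
      unfolding adjoint_operator_def by blast
    then show "(x, y) \<in> A"
      using A by (simp add: self_adjoint_def)
  qed
qed

end

text \<open>For \<open>x\<close> in the common domain the difference of the two orbits satisfies \<open>w' = \<i> A w\<close>, so its
  norm is constant by symmetry, and it vanishes at \<open>t = 0\<close>.\<close>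

lemma unitary_group_unique:
  fixes U V :: "real \<Rightarrow> 'h::complex_hilbert_space \<Rightarrow> 'h"
  assumes U: "unitary_group U" and V: "unitary_group V" and gen: "generator U = generator V"
    and dense: "closure (Domain (generator U)) = UNIV"
  shows "U = V"
proof (intro ext)
  fix t x
  have dom: "U t x = V t x" if x: "x \<in> Domain (generator U)" for t x
  proof -
    obtain y where y: "(x, y) \<in> generator U" using x by blast
    then have y': "(x, y) \<in> generator V" using gen by simp
    define f where "f = (\<lambda>t. inner (U t x - V t x) (U t x - V t x))"
    have "(f has_derivative (\<lambda>h. 0)) (at t within UNIV)" for t
    proof -
      define w where "w = U t x - V t x"
      define z where "z = U t y - V t y"
      have wz: "(w, z) \<in> generator U"
        unfolding w_def z_def
        by (intro csubspace_graphD(2)[OF csubspace_generator[OF U]] generator_invariant[OF U y])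
          (simp add: gen generator_invariant[OF V y'])
      have "Im (cinner z w) = 0"
        using generator_symmetric[OF U wz wz] cinner_commute[of z w]
        by (metis complex_cnj_cancel_iff complex_is_Real_iff Reals_cnj_iff)
      then have re: "inner w (\<i> *\<^sub>C z) = 0" "inner (\<i> *\<^sub>C z) w = 0"
        unfolding inner_commute[of w] by (simp_all add: inner_eq_Re_cinner cinner_scaleC_left)
      have "((\<lambda>t. U t x - V t x) has_vector_derivative \<i> *\<^sub>C U t y - \<i> *\<^sub>C V t y) (at t)"
        by (intro has_vector_derivative_diff has_vector_derivative_orbit U V y y')
      from bounded_bilinear.has_vector_derivative[OF bounded_bilinear_inner this this]
      have "(f has_vector_derivative inner w (\<i> *\<^sub>C z) + inner (\<i> *\<^sub>C z) w) (at t)"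
        by (simp add: f_def w_def z_def complex_vector.scale_right_diff_distrib)
      then show ?thesis
        by (simp add: re has_vector_derivative_def)
    qed
    then obtain c where "\<And>t. f t = c"
      using has_derivative_zero_constant[of UNIV f] by auto
    then have "f t = f 0" by simp
    then show ?thesis
      by (simp add: f_def unitary_group_0[OF U] unitary_group_0[OF V])
  qed
  have "closed {x. U t x = V t x}"
    by (intro closed_Collect_eq linear_continuous_on unitary_bounded_linear unitary_group_unitary U V)
  then have "closure (Domain (generator U)) \<subseteq> {x. U t x = V t x}"
    using dom by (intro closure_minimal) auto
  then show "U t x = V t x"
    using dense by auto
qed

theorem stone:
  fixes A :: "'h::complex_hilbert_space unbounded_operator"
  assumes A: "self_adjoint A"
  shows "unitary_group (exp_i A)" and "generator (exp_i A) = A"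
proof -
  have "\<exists>!U. unitary_group U \<and> generator U = A"
  proof (rule ex1I)
    show "unitary_group (stone_group A) \<and> generator (stone_group A) = A"
      using unitary_group_stone_group[OF A] generator_stone_group[OF A] by blast
    fix V assume V: "unitary_group V \<and> generator V = A"
    then show "V = stone_group A"
      using unitary_group_unique[of V "stone_group A"] A unitary_group_stone_group[OF A]
        generator_stone_group[OF A]
      by (simp add: self_adjoint_def)
  qed
  from theI'[OF this] show "unitary_group (exp_i A)" "generator (exp_i A) = A"
    unfolding exp_i_def by blast+
qed

section \<open>Homomorphisms of C*-algebras\<close>

lemma star_1: "star 1 = (1 :: 'a::unital_cstar_algebra)"
  by (metis mult_1_left star_mult star_star)

lemma norm_star: "norm (star x) = norm (x :: 'a::unital_cstar_algebra)"
proof -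
  have le: "norm y \<le> norm (star y)" for y :: 'a
  proof (cases "y = 0")
    case False
    have "norm y * norm y \<le> norm (star y) * norm y"
      using norm_mult_ineq[of "star y" y] by (simp add: cstar_identity power2_eq_square)
    then show ?thesis
      using False by simp
  qed simp
  show ?thesis
    using le[of x] le[of "star x"] by (simp add: star_star)
qed

lemma bounded_linear_star: "bounded_linear (star :: 'a::unital_cstar_algebra \<Rightarrow> 'a)"
  by (rule bounded_linear_intro[of _ 1]) (simp_all add: star_add scaleR_scaleC star_scaleC norm_star)

lemma unital_star_homD:
  assumes "unital_star_hom f"
  shows "clinear f" "f (x * y) = f x * f y" "f (star x) = star (f x)" "f 1 = 1"
    "f (x + y) = f x + f y" "f (x - y) = f x - f y" "f (c *\<^sub>C x) = c *\<^sub>C f x"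
  using assms unfolding unital_star_hom_def
  by (auto simp: clinear_add clinear_diff clinear_scaleC)

lemma abs_gbinomial_half_le: "\<bar>(1/2 :: real) gchoose n\<bar> \<le> 1"
proof (induction n)
  case (Suc n)
  have "(1/2 :: real) gchoose Suc n = ((1/2) gchoose n) * ((1/2 - real n) / real (Suc n))"
    by (simp add: gbinomial_prod_rev field_simps)
  moreover have "\<bar>(1/2 - real n) / real (Suc n)\<bar> \<le> 1"
    by (simp add: abs_le_iff field_simps)
  ultimately show ?case
    using Suc by (simp only: abs_mult mult_le_one abs_ge_zero)
qed simp

text \<open>The square root is the binomial series \<open>\<Sum> ((1/2) gchoose n) (- y)\<^sup>n\<close>; its Cauchy square is
  \<open>1 - y\<close> by the Vandermonde identity.\<close>

lemma sqrt_one_minus: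
  fixes y :: "'a::unital_cstar_algebra"
  assumes y: "norm y < 1" and sa: "star y = y"
  obtains s where "s * s = 1 - y" "star s = s" "\<And>z. z * y = y * z \<Longrightarrow> z * s = s * z"
proof -
  define c where "c = (\<lambda>n. ((1/2 :: real) gchoose n) * (- 1) ^ n)"
  define f where "f = (\<lambda>n. c n *\<^sub>R y ^ n)"
  have "norm (f n) \<le> norm y ^ n" for n
  proof -
    have "\<bar>c n\<bar> \<le> 1"
      using abs_gbinomial_half_le[of n] by (simp add: c_def abs_mult power_abs)
    then have "norm (f n) \<le> 1 * norm y ^ n"
      unfolding f_def norm_scaleR by (intro mult_mono norm_power_ineq) simp_all
    then show ?thesis by simp
  qed
  then have sum_norm: "summable (\<lambda>n. norm (f n))"
    by (intro summable_comparison_test'[OF summable_geometric[of "norm y"]]) (use y in simp_all)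
  then have sum: "summable f"
    by (rule summable_norm_cancel)
  define s where "s = suminf f"
  have conv: "(\<Sum>i\<le>k. f i * f (k - i)) = (if k = 0 then 1 else if k = 1 then - y else 0)" for k
  proof -
    have "(\<Sum>i\<le>k. f i * f (k - i)) = (\<Sum>i\<le>k. (c i * c (k - i)) *\<^sub>R y ^ k)"
      by (intro sum.cong) (simp_all add: f_def flip: power_add)
    also have "\<dots> = (\<Sum>i\<le>k. c i * c (k - i)) *\<^sub>R y ^ k"
      by (simp add: scaleR_left.sum)
    also have "(\<Sum>i\<le>k. c i * c (k - i)) = (\<Sum>i\<le>k. ((1/2) gchoose i) * ((1/2) gchoose (k - i)) * (- 1) ^ k)"
      by (intro sum.cong) (simp_all add: c_def mult_ac flip: power_add)
    also have "\<dots> = (1 gchoose k) * (- 1) ^ k"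
      using gbinomial_Vandermonde[of "1/2 :: real" "1/2" k]
      by (simp add: atMost_atLeast0 flip: sum_distrib_right)
    also have "(1 :: real) gchoose k = real (1 choose k)"
      by (simp add: binomial_gbinomial)
    finally show ?thesis
      by (cases k rule: nat.exhaust; cases "k - 1") auto
  qed
  have "(\<lambda>k. \<Sum>i\<le>k. f i * f (k - i)) sums (s * s)"
    unfolding s_def by (rule Cauchy_product_sums[OF sum_norm sum_norm])
  moreover have "(\<lambda>k. \<Sum>i\<le>k. f i * f (k - i)) sums (\<Sum>k\<in>{0, 1 :: nat}. if k = 0 then 1 else if k = 1 then - y else 0)"
    unfolding conv by (rule sums_finite) auto
  ultimately have "s * s = 1 - y"
    using sums_unique2 by fastforce
  moreover have "star s = s"
  proof -
    have "star (y ^ n) = y ^ n" for n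
      by (induction n) (simp_all add: star_1 star_mult sa power_commutes)
    then have "star (f n) = f n" for n
      by (simp add: f_def scaleR_scaleC star_scaleC)
    then show ?thesis
      unfolding s_def using bounded_linear.suminf[OF bounded_linear_star sum] by simp
  qed
  moreover have "z * s = s * z" if "z * y = y * z" for z
  proof -
    have "z * f n = f n * z" for n
      using that by (simp add: f_def power_commuting_commutes)
    then show ?thesis
      unfolding s_def by (simp add: suminf_mult2[OF sum] flip: suminf_mult[OF sum])
  qed
  ultimately show thesis
    using that by blast
qed

lemma norm_unitary_element:
  fixes u :: "'a::unital_cstar_algebra"
  assumes "star u * u = 1"
  shows "norm u = 1"
  using cstar_identity[of u] assms by (simp add: power2_eq_1_iff) (smt (verit) norm_ge_zero)

text \<open>The unitary is \<open>x + \<i> (1 - x\<^sup>2)\<^sup>1\<^sup>/\<^sup>2\<close>.\<close>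

lemma self_adjoint_mean_of_unitaries:
  fixes x :: "'a::unital_cstar_algebra"
  assumes sa: "star x = x" and x: "norm x < 1"
  obtains u where "star u * u = 1" "x = (1/2) *\<^sub>C (u + star u)"
proof -
  have "norm (x * x) < 1"
    using norm_mult_ineq[of x x] x by (smt (verit) mult_le_one norm_ge_zero mult_left_le)
  moreover have "star (x * x) = x * x"
    by (simp add: star_mult sa)
  ultimately obtain s where s: "s * s = 1 - x * x" "star s = s"
    and comm: "\<And>z. z * (x * x) = (x * x) * z \<Longrightarrow> z * s = s * z"
    using sqrt_one_minus by metis
  have xs: "x * s = s * x"
    using comm[of x] by (simp add: mult.assoc)
  define u where "u = x + \<i> *\<^sub>C s"
  have star_u: "star u = x - \<i> *\<^sub>C s"
    by (simp add: u_def star_add star_scaleC sa s)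
  have "star u * u = x * x + s * s"
    unfolding star_u unfolding u_def
    by (simp add: algebra_simps mult_scaleC_left mult_scaleC_right scaleC_scaleC xs)
  then have "star u * u = 1"
    by (simp add: s)
  moreover have "x = (1/2) *\<^sub>C (u + star u)"
    by (simp add: star_u) (simp add: u_def scaleC_add_right scaleC_one flip: scaleC_add_left)
  ultimately show thesis
    using that by blast
qed

text \<open>A *-homomorphism maps unitaries to unitaries, which have norm one; so it is contractive on
  self-adjoint elements by the previous lemma, and on all elements by the C*-identity.\<close>

lemma unital_star_hom_norm_le:
  fixes f :: "'a::unital_cstar_algebra \<Rightarrow> 'b::unital_cstar_algebra"
  assumes f: "unital_star_hom f"
  shows "norm (f x) \<le> norm x"
proof -
  note F = unital_star_homD[OF f]
  have ball: "norm (f x) \<le> 1" if sa: "star x = x" and x: "norm x < 1" for x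
  proof -
    obtain u where u: "star u * u = 1" "x = (1/2) *\<^sub>C (u + star u)"
      using self_adjoint_mean_of_unitaries[OF sa x] .
    have "norm (f u) = 1"
      by (rule norm_unitary_element) (simp add: u F(4) flip: F(2,3))
    moreover have "f x = (1/2) *\<^sub>C (f u + star (f u))"
      by (simp only: u(2) F)
    ultimately show ?thesis
      using norm_triangle_ineq[of "f u" "star (f u)"] by (simp add: norm_scaleC norm_star)
  qed
  have sa: "norm (f x) \<le> norm x" if sa: "star x = x" for x
  proof (rule dense_ge)
    fix r assume r: "norm x < r"
    then have r0: "r > 0"
      using norm_ge_zero[of x] by linarith
    have "norm (f ((1 / of_real r) *\<^sub>C x)) \<le> 1"
      by (rule ball) (use r r0 in \<open>simp_all add: star_scaleC sa norm_scaleC norm_divide\<close>)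
    then show "norm (f x) \<le> r"
      using r0 by (simp add: F(7) norm_scaleC norm_divide)
  qed
  have "(norm (f x))\<^sup>2 = norm (f (star x * x))"
    by (simp add: F cstar_identity)
  also have "\<dots> \<le> norm (star x * x)"
    by (rule sa) (simp add: star_mult star_star)
  also have "\<dots> = (norm x)\<^sup>2"
    by (rule cstar_identity)
  finally show ?thesis
    by (rule power2_le_imp_le) simp
qed

lemma unital_star_hom_bounded_linear:
  fixes f :: "'a::unital_cstar_algebra \<Rightarrow> 'b::unital_cstar_algebra"
  assumes f: "unital_star_hom f"
  shows "bounded_linear f"
  by (rule bounded_linear_intro[of _ 1])
    (use unital_star_hom_norm_le[OF f] in \<open>simp_all add: unital_star_homD[OF f] scaleR_scaleC\<close>)

lemma unital_star_hom_comp: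
  "unital_star_hom f \<Longrightarrow> unital_star_hom g \<Longrightarrow> unital_star_hom (f \<circ> g)"
  unfolding unital_star_hom_def by (auto intro!: clinearI simp: clinear_add clinear_scaleC)

lemma unital_star_hom_id: "unital_star_hom id"
  unfolding unital_star_hom_def by (auto intro!: clinearI)

lemma unital_star_hom_sum: "unital_star_hom f \<Longrightarrow> f (\<Sum>i\<in>I. x i) = (\<Sum>i\<in>I. f (x i))"
  by (induction I rule: infinite_finite_induct)
    (simp_all add: unital_star_homD(5) unital_star_homD(6)[of f 0 0, simplified])

lemma unital_star_hom_prod_list: "unital_star_hom f \<Longrightarrow> f (prod_list xs) = prod_list (map f xs)"
  by (induction xs) (simp_all add: unital_star_homD)

lemma unital_star_hom_eval_free:
  assumes f: "unital_star_hom f"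
  shows "f (eval_free a x) = eval_free (f \<circ> a) x"
proof -
  have "f (eval_letter a l) = eval_letter (f \<circ> a) l" for l
    by (cases l) (simp_all add: unital_star_homD[OF f])
  then have "f (eval_word a w) = eval_word (f \<circ> a) w" for w
    by (simp add: eval_word_def unital_star_hom_prod_list[OF f] o_def)
  then show ?thesis
    by (simp add: eval_free_def unital_star_hom_sum[OF f] unital_star_homD[OF f])
qed

lemma unital_star_hom_eqI:
  assumes f: "unital_star_hom f" and g: "unital_star_hom g"
    and dense: "closure (range (eval_free a)) = UNIV" and eq: "\<And>h. f (a h) = g (a h)"
  shows "f = g"
proof -
  have "closed {x. f x = g x}"
    by (intro closed_Collect_eq linear_continuous_on unital_star_hom_bounded_linear f g)
  moreover have "f \<circ> a = g \<circ> a"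
    using eq by (simp add: fun_eq_iff)
  then have "range (eval_free a) \<subseteq> {x. f x = g x}"
    by (auto simp: unital_star_hom_eval_free[OF f] unital_star_hom_eval_free[OF g])
  ultimately have "closure (range (eval_free a)) \<subseteq> {x. f x = g x}"
    by (intro closure_minimal)
  then show ?thesis
    using dense by auto
qed

text \<open>The two maps are parametrised by a common index set so that the well-definedness of
  \<open>v x \<mapsto> w x\<close> is part of the inequality.\<close>

lemma nonexpansive_extension:
  fixes v :: "'s \<Rightarrow> 'm::metric_space" and w :: "'s \<Rightarrow> 'n::complete_space"
  assumes le: "\<And>x y. x \<in> S \<Longrightarrow> y \<in> S \<Longrightarrow> dist (w x) (w y) \<le> dist (v x) (v y)"
    and dense: "closure (v ` S) = UNIV"
  obtains T where "\<And>x. x \<in> S \<Longrightarrow> T (v x) = w x" and "\<And>p q. dist (T p) (T q) \<le> dist p q"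
proof -
  have "\<exists>s. (\<forall>n. s n \<in> S) \<and> (\<lambda>n. v (s n)) \<longlonglongrightarrow> p" for p
  proof -
    obtain u where u: "\<And>n. u n \<in> v ` S" "u \<longlonglongrightarrow> p"
      using dense closure_sequential[of p "v ` S"] by auto
    then obtain s where "\<And>n. s n \<in> S" "u = (\<lambda>n. v (s n))"
      unfolding image_iff fun_eq_iff by metis
    then show ?thesis
      using u(2) by blast
  qed
  then obtain s where s: "\<And>p n. s p n \<in> S" and v: "\<And>p. (\<lambda>n. v (s p n)) \<longlonglongrightarrow> p"
    by metis
  have "convergent (\<lambda>n. w (s p n))" for p
  proof -
    have "Cauchy (\<lambda>n. v (s p n))"
      using v by (rule LIMSEQ_imp_Cauchy)
    then have "Cauchy (\<lambda>n. w (s p n))"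
      unfolding Cauchy_def by (meson le s le_less_trans)
    then show ?thesis
      by (simp add: Cauchy_convergent_iff)
  qed
  then obtain T where T: "\<And>p. (\<lambda>n. w (s p n)) \<longlonglongrightarrow> T p"
    unfolding convergent_def by metis
  show thesis
  proof
    fix x assume x: "x \<in> S"
    have "(\<lambda>n. dist (v (s (v x) n)) (v x)) \<longlonglongrightarrow> 0"
      by (rule tendsto_dist_iff[THEN iffD1, OF v])
    then have "(\<lambda>n. dist (w (s (v x) n)) (w x)) \<longlonglongrightarrow> 0"
      by (rule Lim_null_comparison[rotated]) (use le s x in simp)
    then have "(\<lambda>n. w (s (v x) n)) \<longlonglongrightarrow> w x"
      by (rule tendsto_dist_iff[THEN iffD2])
    with T show "T (v x) = w x"
      by (rule LIMSEQ_unique)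
  next
    fix p q
    show "dist (T p) (T q) \<le> dist p q"
    proof (rule LIMSEQ_le)
      show "(\<lambda>n. dist (w (s p n)) (w (s q n))) \<longlonglongrightarrow> dist (T p) (T q)"
        by (intro tendsto_dist T)
      show "(\<lambda>n. dist (v (s p n)) (v (s q n))) \<longlonglongrightarrow> dist p q"
        by (intro tendsto_dist v)
    qed (use le s in blast)
  qed
qed

lemma nonexpansive_continuous_on:
  assumes "\<And>p q. dist (T p) (T q) \<le> dist p q"
  shows "continuous_on S T"
  unfolding continuous_on_iff by (meson assms le_less_trans)

text \<open>The norm inequality of the universal property makes \<open>eval_free a x \<mapsto> eval_free b x\<close>
  nonexpansive; algebraic identities pass to the extension by density.\<close>

lemma universal_cstar_algebra_hom:
  fixes a b :: "'g \<Rightarrow> 'a::unital_cstar_algebra"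
  assumes univ: "universal_cstar_algebra R a" and b: "\<forall>r\<in>R. eval_free b r = 0"
  obtains f where "unital_star_hom f" "\<And>g. f (a g) = b g"
proof -
  have dense: "closure (range (eval_free a)) = UNIV"
    using univ by (simp add: universal_cstar_algebra_def)
  obtain f where f: "\<And>x. f (eval_free a x) = eval_free b x" and le: "\<And>p q. dist (f p) (f q) \<le> dist p q"
  proof (rule nonexpansive_extension[of UNIV "eval_free b" "eval_free a"])
    show "dist (eval_free b x) (eval_free b y) \<le> dist (eval_free a x) (eval_free a y)" for x y
      unfolding dist_norm eval_free_diff[symmetric] by (rule universal_cstar_algebra_norm_le[OF univ b])
  qed (use dense in auto)
  note cont = nonexpansive_continuous_on[OF le, of UNIV]
  have cont': "continuous_on UNIV (\<lambda>x. f (g x))" if "continuous_on UNIV g"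
    for g :: "'x::topological_space \<Rightarrow> 'a"
    using continuous_on_compose2[OF cont that] by simp
  have pair: "closure (range (eval_free a) \<times> range (eval_free a)) = UNIV"
    by (simp add: closure_Times dense)
  have eval_const_mult: "eval_free e (free_const c * x) = c *\<^sub>C eval_free e x"
    for e :: "'g \<Rightarrow> 'a" and c x
    by (simp add: eval_free_mult eval_free_const mult_scaleC_left)
  have add: "f (x + y) = f x + f y" for x y
  proof -
    have "(x, y) \<in> {p. f (fst p + snd p) = f (fst p) + f (snd p)}"
      by (rule closed_superset_of_dense[OF _ pair])
        (auto intro!: closed_Collect_eq continuous_intros cont' simp: f simp flip: eval_free_add)
    then show ?thesis by simp
  qed
  have mult: "f (x * y) = f x * f y" for x y
  proof -
    have "(x, y) \<in> {p. f (fst p * snd p) = f (fst p) * f (snd p)}"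
      by (rule closed_superset_of_dense[OF _ pair])
        (auto intro!: closed_Collect_eq continuous_intros cont' simp: f simp flip: eval_free_mult)
    then show ?thesis by simp
  qed
  have scale: "f (c *\<^sub>C x) = c *\<^sub>C f x" for c x
  proof -
    have "x \<in> {x. f (c *\<^sub>C x) = c *\<^sub>C f x}"
      by (rule closed_superset_of_dense[OF _ dense])
        (auto intro!: closed_Collect_eq continuous_intros cont'
          bounded_bilinear.continuous_on[OF bounded_bilinear_scaleC_cstar]
          simp: f simp flip: eval_const_mult)
    then show ?thesis by simp
  qed
  have star: "f (star x) = star (f x)" for x
  proof -
    have "x \<in> {x. f (star x) = star (f x)}"
      by (rule closed_superset_of_dense[OF _ dense])
        (auto intro!: closed_Collect_eq cont cont'
          bounded_linear.continuous_on[OF bounded_linear_star] continuous_on_id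
          simp: f simp flip: eval_free_star)
    then show ?thesis by simp
  qed
  have one: "f 1 = 1"
    using f[of "free_const 1"] by (simp add: eval_free_const scaleC_one)
  have gen: "eval_free e (free_gen g) = e g" for e :: "'g \<Rightarrow> 'a" and g
    by (simp add: free_gen_def eval_free_single eval_word_def scaleC_one)
  have "f (a g) = b g" for g
    using f[of "free_gen g"] by (simp add: gen)
  moreover have "unital_star_hom f"
    unfolding unital_star_hom_def using add mult scale star one by (auto intro!: clinearI)
  ultimately show thesis
    using that by blast
qed

section \<open>The CAR algebra and its gauge-invariant part\<close>

lemma unitary_inverse:
  fixes U :: "'h::complex_hilbert_space \<Rightarrow> 'h"
  assumes U: "unitary_operator U"
  obtains V where "unitary_operator V" "\<And>x. U (V x) = x" "\<And>x. V (U x) = x"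
proof -
  note u = unitary_operatorD[OF U]
  have inj: "x = y" if "U x = U y" for x y
    using that unitary_norm[OF U, of "x - y"] by (simp add: clinear_diff[OF u(1)])
  define V where "V = inv_into UNIV U"
  have UV: "U (V x) = x" for x
    using u(2) by (simp add: V_def surj_f_inv_f)
  have VU: "V (U x) = x" for x
    using inj UV by blast
  have "clinear V"
    by (rule clinearI) (rule inj; simp add: clinear_add[OF u(1)] clinear_scaleC[OF u(1)] UV)+
  moreover have "surj V"
    using VU by (metis surjI)
  moreover have "cinner (V x) (V y) = cinner x y" for x y
    using u(3)[of "V x" "V y"] by (simp add: UV)
  ultimately have "unitary_operator V"
    by (simp add: unitary_operator_def)
  then show thesis
    using that UV VU by blast
qed

lemma unitary_operator_phase:
  assumes "cmod z = 1"
  shows "unitary_operator (\<lambda>h :: 'h::complex_hilbert_space. z *\<^sub>C h)"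
proof -
  have z: "z * cnj z = 1"
    using assms by (simp add: complex_norm_square[symmetric])
  then have "z *\<^sub>C cnj z *\<^sub>C h = h" for h :: 'h
    by (simp add: scaleC_scaleC scaleC_one)
  then have "surj (\<lambda>h :: 'h. z *\<^sub>C h)"
    by (metis surjI)
  moreover have "clinear (\<lambda>h :: 'h. z *\<^sub>C h)"
    by (rule clinearI) (simp_all add: scaleC_add_right scaleC_scaleC mult.commute)
  ultimately show ?thesis
    using z by (simp add: unitary_operator_def cinner_scaleC_left cinner_scaleC_right mult.commute flip: mult.assoc)
qed

lemma unitary_operator_comp:
  "unitary_operator U \<Longrightarrow> unitary_operator V \<Longrightarrow> unitary_operator (U \<circ> V)"
  for U V :: "'h::complex_hilbert_space \<Rightarrow> 'h"
  unfolding unitary_operator_def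
  by (intro conjI clinearI comp_surj) (simp_all add: clinear_add clinear_scaleC)

lemma creations_Nil [simp]: "creations a [] = 1"
  and creations_Cons: "creations a (h # hs) = star (a h) * creations a hs"
  and annihilations_Nil [simp]: "annihilations a [] = 1"
  and annihilations_Cons: "annihilations a (k # ks) = a k * annihilations a ks"
  by (simp_all add: creations_def annihilations_def)

text \<open>The normally ordered polynomials.\<close>

definition Wick :: "('h \<Rightarrow> 'a::unital_cstar_algebra) \<Rightarrow> 'a set" where
  "Wick a = cspan {creations a hs * annihilations a ks | hs ks. True}"

definition balanced_Wick :: "('h \<Rightarrow> 'a::unital_cstar_algebra) \<Rightarrow> 'a set" where
  "balanced_Wick a = cspan {creations a hs * annihilations a ks | hs ks. length hs = length ks}"

lemma monomial_in_Wick: "creations a hs * annihilations a ks \<in> Wick a"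
  unfolding Wick_def by (rule complex_vector.span_base) blast

lemma csubspace_Wick: "csubspace (Wick a)"
  unfolding Wick_def by (rule complex_vector.subspace_span)

lemma Wick_mult_left:
  fixes a :: "'h \<Rightarrow> 'a::unital_cstar_algebra"
  assumes mono: "\<And>hs ks. z * (creations a hs * annihilations a ks) \<in> Wick a" and x: "x \<in> Wick a"
  shows "z * x \<in> Wick a"
proof -
  have "x \<in> cspan {creations a hs * annihilations a ks | hs ks. True}"
    using x by (simp only: Wick_def)
  then show ?thesis
    by (induction rule: complex_vector.span_induct_alt)
      (auto simp: distrib_left mult_scaleC_right mono
        intro!: complex_vector.subspace_add[OF csubspace_Wick] complex_vector.subspace_scale[OF csubspace_Wick]
          complex_vector.subspace_0[OF csubspace_Wick])
qed

lemma Wick_mult_creation: "x \<in> Wick a \<Longrightarrow> star (a h) * x \<in> Wick a"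
  by (rule Wick_mult_left) (simp_all add: monomial_in_Wick flip: creations_Cons mult.assoc)

lemma in_GICAR_iff: "x \<in> GICAR a \<longleftrightarrow> (\<forall>z. cmod z = 1 \<longrightarrow> bogoliubov a (\<lambda>h. z *\<^sub>C h) x = x)"
  by (simp add: GICAR_def)

lemma csubspace_balanced_Wick: "csubspace (balanced_Wick a)"
  unfolding balanced_Wick_def by (rule complex_vector.subspace_span)

definition root_unity :: "nat \<Rightarrow> nat \<Rightarrow> complex" where
  "root_unity M j = exp (2 * of_real pi * \<i> * of_nat j / of_nat M)"

lemma norm_root_unity: "cmod (root_unity M j) = 1"
  by (simp add: root_unity_def norm_exp_eq_Re)

lemma root_unity_power: "root_unity M j ^ n = root_unity M (j * n)"
  by (simp add: root_unity_def mult_ac flip: exp_of_nat_mult)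

context
  fixes a :: "'h::complex_hilbert_space \<Rightarrow> 'a::unital_cstar_algebra"
  assumes CAR: "CAR_algebra a"
begin

lemma CAR_universal: "universal_cstar_algebra CAR_relations a"
  using CAR by (simp add: CAR_algebra_def)

lemma CAR_dense: "closure (range (eval_free a)) = UNIV"
  using CAR_universal by (simp add: universal_cstar_algebra_def)

lemma CAR_star_linear: "star (a (c *\<^sub>C h + d *\<^sub>C k)) = c *\<^sub>C star (a h) + d *\<^sub>C star (a k)"
  and CAR_anticommute: "a h * a k + a k * a h = 0"
  and CAR_mixed: "star (a h) * a k + a k * star (a h) = cinner h k *\<^sub>C 1"
  using CAR_universal eval_CAR_relations[of a] unfolding universal_cstar_algebra_def by blast+

lemma star_a_add: "star (a (h + k)) = star (a h) + star (a k)"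
  using CAR_star_linear[of 1 h 1 k] by (simp add: scaleC_one)

lemma star_a_scaleC: "star (a (c *\<^sub>C h)) = c *\<^sub>C star (a h)"
  using CAR_star_linear[of c h 0 h] by simp

lemma a_add: "a (h + k) = a h + a k"
  by (metis star_a_add star_add star_star)

lemma a_scaleC: "a (c *\<^sub>C h) = cnj c *\<^sub>C a h"
  by (metis star_a_scaleC star_scaleC star_star)

text \<open>Since \<open>a h a h = 0\<close>, the element \<open>p = star (a h) * a h\<close> satisfies \<open>p\<^sup>2 = \<parallel>h\<parallel>\<^sup>2 p\<close>, and the
  C*-identity for \<open>p\<close> gives \<open>\<parallel>p\<parallel> \<le> \<parallel>h\<parallel>\<^sup>2\<close>.\<close>

lemma norm_a_le: "norm (a h) \<le> norm h"
proof -
  define p where "p = star (a h) * a h"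
  have "2 *\<^sub>R (a h * a h) = 0"
    using CAR_anticommute[of h h] by (simp add: scaleR_2)
  then have sq: "a h * a h = 0" by simp
  have "a h * p = cinner h h *\<^sub>C a h"
  proof -
    have "a h * p = (a h * star (a h)) * a h"
      by (simp add: p_def mult.assoc)
    also have "a h * star (a h) = cinner h h *\<^sub>C 1 - star (a h) * a h"
      using CAR_mixed[of h h] by (simp add: algebra_simps)
    finally show ?thesis
      by (simp add: left_diff_distrib mult_scaleC_left mult.assoc sq)
  qed
  then have "p * p = cinner h h *\<^sub>C p"
    by (simp add: p_def mult.assoc mult_scaleC_right)
  moreover have "star p = p"
    by (simp add: p_def star_mult star_star)
  ultimately have "(norm p)\<^sup>2 = (norm h)\<^sup>2 * norm p"
    using cstar_identity[of p] by (simp add: norm_scaleC cinner_self norm_power)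
  then have "norm p \<le> (norm h)\<^sup>2"
    by (cases "norm p = 0") (simp_all add: power2_eq_square)
  then show ?thesis
    unfolding p_def cstar_identity by (rule power2_le_imp_le) simp
qed

lemma bounded_linear_a: "bounded_linear a"
  by (rule bounded_linear_intro[of _ 1]) (simp_all add: a_add scaleR_scaleC a_scaleC norm_a_le)

lemma bounded_linear_star_a: "bounded_linear (\<lambda>h. star (a h))"
  using bounded_linear_compose[OF bounded_linear_star bounded_linear_a] .

lemma bogoliubov_hom_exists:
  assumes U: "unitary_operator U"
  obtains \<gamma> where "unital_star_hom \<gamma>" "\<And>h. \<gamma> (a h) = a (U h)"
proof (rule universal_cstar_algebra_hom[OF CAR_universal])
  show "\<forall>r\<in>CAR_relations. eval_free (\<lambda>h. a (U h)) r = 0"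
    unfolding eval_CAR_relations
    using CAR_star_linear CAR_anticommute CAR_mixed unitary_operatorD[OF U]
    by (simp add: clinear_add clinear_scaleC)
qed (use that in blast)

text \<open>Bijectivity comes from the homomorphism for the inverse unitary. Uniqueness holds because
  *-homomorphisms are automatically continuous and the generators generate.\<close>

lemma bogoliubov:
  assumes U: "unitary_operator U"
  shows "unital_star_hom (bogoliubov a U)" and "bogoliubov a U (a h) = a (U h)"
proof -
  obtain V where V: "unitary_operator V" "\<And>x. U (V x) = x" "\<And>x. V (U x) = x"
    using unitary_inverse[OF U] by blast
  obtain \<gamma> where \<gamma>: "unital_star_hom \<gamma>" "\<And>h. \<gamma> (a h) = a (U h)"
    using bogoliubov_hom_exists[OF U] by blast
  obtain \<delta> where \<delta>: "unital_star_hom \<delta>" "\<And>h. \<delta> (a h) = a (V h)"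
    using bogoliubov_hom_exists[OF V(1)] by blast
  have "\<gamma> \<circ> \<delta> = id" "\<delta> \<circ> \<gamma> = id"
    by (rule unital_star_hom_eqI[OF unital_star_hom_comp unital_star_hom_id CAR_dense];
        simp add: \<gamma> \<delta> V)+
  then have "bij \<gamma>"
    using o_bij by blast
  then have "star_automorphism \<gamma>"
    using \<gamma> by (simp add: star_automorphism_def)
  moreover have "\<gamma>' = \<gamma>" if "star_automorphism \<gamma>'" "\<forall>h. \<gamma>' (a h) = a (U h)" for \<gamma>'
    by (rule unital_star_hom_eqI[OF _ \<gamma>(1) CAR_dense]) (use that \<gamma> in \<open>simp_all add: star_automorphism_def\<close>)
  ultimately have "bogoliubov a U = \<gamma>"
    unfolding bogoliubov_def using \<gamma> by (intro the_equality) blast+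
  then show "unital_star_hom (bogoliubov a U)" "bogoliubov a U (a h) = a (U h)"
    using \<gamma> by simp_all
qed

lemma bogoliubov_comp:
  assumes U: "unitary_operator U" and V: "unitary_operator V"
  shows "bogoliubov a (U \<circ> V) = bogoliubov a U \<circ> bogoliubov a V"
  by (rule unital_star_hom_eqI[OF bogoliubov(1) unital_star_hom_comp[OF bogoliubov(1) bogoliubov(1)] CAR_dense])
    (simp_all add: bogoliubov(2) U V unitary_operator_comp)

lemma bogoliubov_creations:
  "unitary_operator U \<Longrightarrow> bogoliubov a U (creations a hs) = creations a (map U hs)"
  by (induction hs) (simp_all add: creations_Cons bogoliubov unital_star_homD[OF bogoliubov(1)])

lemma bogoliubov_annihilations:
  "unitary_operator U \<Longrightarrow> bogoliubov a U (annihilations a ks) = annihilations a (map U ks)"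
  by (induction ks) (simp_all add: annihilations_Cons bogoliubov unital_star_homD[OF bogoliubov(1)])

lemma bogoliubov_monomial:
  "unitary_operator U \<Longrightarrow> bogoliubov a U (creations a hs * annihilations a ks)
    = creations a (map U hs) * annihilations a (map U ks)"
  by (simp add: unital_star_homD[OF bogoliubov(1)] bogoliubov_creations bogoliubov_annihilations)

lemma gauge_monomial:
  assumes z: "cmod z = 1"
  shows "bogoliubov a (\<lambda>h. z *\<^sub>C h) (creations a hs * annihilations a ks)
    = (z ^ length hs * cnj z ^ length ks) *\<^sub>C (creations a hs * annihilations a ks)"
proof -
  have c: "creations a (map (\<lambda>h. z *\<^sub>C h) hs) = z ^ length hs *\<^sub>C creations a hs" for hs
    by (induction hs)
      (simp_all add: creations_Cons star_a_scaleC mult_scaleC_left mult_scaleC_right scaleC_scaleC scaleC_one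
        mult.commute)
  have d: "annihilations a (map (\<lambda>h. z *\<^sub>C h) ks) = cnj z ^ length ks *\<^sub>C annihilations a ks" for ks
    by (induction ks)
      (simp_all add: annihilations_Cons a_scaleC mult_scaleC_left mult_scaleC_right scaleC_scaleC scaleC_one
        mult.commute)
  show ?thesis
    by (simp add: bogoliubov_monomial unitary_operator_phase z c d mult_scaleC_left mult_scaleC_right
        scaleC_scaleC mult.commute)
qed

text \<open>Wick ordering: the anticommutation relation moves the annihilator to the right past each
  creator, at the cost of a shorter monomial.\<close>

lemma Wick_mult_annihilation: "x \<in> Wick a \<Longrightarrow> a h * x \<in> Wick a"
proof (rule Wick_mult_left)
  fix hs ks
  show "a h * (creations a hs * annihilations a ks) \<in> Wick a"
  proof (induction hs)
    case Nil
    then show ?case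
      using monomial_in_Wick[of _ "[]" "h # ks"] by (simp add: annihilations_Cons)
  next
    case (Cons g hs)
    let ?X = "creations a hs * annihilations a ks"
    have "a h * (creations a (g # hs) * annihilations a ks) = (a h * star (a g)) * ?X"
      by (simp add: creations_Cons mult.assoc)
    also have "a h * star (a g) = cinner g h *\<^sub>C 1 - star (a g) * a h"
      using CAR_mixed[of g h] by (simp add: algebra_simps)
    also have "\<dots> * ?X = cinner g h *\<^sub>C ?X - star (a g) * (a h * ?X)"
      by (simp add: left_diff_distrib mult_scaleC_left mult.assoc)
    also have "\<dots> \<in> Wick a"
      by (intro complex_vector.subspace_diff[OF csubspace_Wick] complex_vector.subspace_scale[OF csubspace_Wick]
          monomial_in_Wick Wick_mult_creation Cons.IH)
    finally show ?case .
  qed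
qed

lemma eval_free_in_Wick: "eval_free a x \<in> Wick a"
proof -
  have "prod_list (map (eval_letter a) ls) \<in> Wick a" for ls
  proof (induction ls)
    case Nil
    then show ?case
      using monomial_in_Wick[of _ "[]" "[]"] by simp
  next
    case (Cons l ls)
    then show ?case
      by (cases l) (simp_all add: Wick_mult_creation Wick_mult_annihilation)
  qed
  then show ?thesis
    unfolding eval_free_def eval_word_def
    by (intro complex_vector.subspace_sum[OF csubspace_Wick] complex_vector.subspace_scale[OF csubspace_Wick])
qed

lemma Wick_dense: "closure (Wick a) = UNIV"
  using CAR_dense closure_mono[of "range (eval_free a)" "Wick a"] eval_free_in_Wick by auto

lemma GICAR_star_subalgebra:
  shows "csubspace (GICAR a)" and "1 \<in> GICAR a"
    and "x \<in> GICAR a \<Longrightarrow> y \<in> GICAR a \<Longrightarrow> x * y \<in> GICAR a"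
    and "x \<in> GICAR a \<Longrightarrow> star x \<in> GICAR a"
proof -
  note hom = unital_star_homD[OF bogoliubov(1)[OF unitary_operator_phase]]
  have zero: "bogoliubov a (\<lambda>h. z *\<^sub>C h) 0 = 0" if "cmod z = 1" for z
    using hom(6)[OF that, of 0 0] by simp
  show "csubspace (GICAR a)"
    by (simp add: complex_vector.subspace_def in_GICAR_iff hom zero)
qed (simp_all add: in_GICAR_iff unital_star_homD[OF bogoliubov(1)[OF unitary_operator_phase]])

lemma closed_GICAR: "closed (GICAR a)"
proof -
  have "GICAR a = (\<Inter>z\<in>{z. cmod z = 1}. {x. bogoliubov a (\<lambda>h. z *\<^sub>C h) x = x})"
    by (auto simp: in_GICAR_iff)
  moreover have "closed \<dots>"
    by (intro closed_INT ballI closed_Collect_eq continuous_on_id linear_continuous_on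
        unital_star_hom_bounded_linear bogoliubov(1) unitary_operator_phase) simp
  ultimately show ?thesis by simp
qed

text \<open>A linear map commutes with multiplication by phases, so the corresponding automorphisms commute.\<close>

lemma bogoliubov_GICAR:
  assumes U: "unitary_operator U" and x: "x \<in> GICAR a"
  shows "bogoliubov a U x \<in> GICAR a"
  unfolding in_GICAR_iff
proof (intro allI impI)
  fix z :: complex assume z: "cmod z = 1"
  let ?Z = "\<lambda>h :: 'h. z *\<^sub>C h"
  have "?Z \<circ> U = U \<circ> ?Z"
    by (simp add: fun_eq_iff clinear_scaleC[OF unitary_operatorD(1)[OF U]])
  then have "bogoliubov a ?Z \<circ> bogoliubov a U = bogoliubov a U \<circ> bogoliubov a ?Z"
    using bogoliubov_comp U unitary_operator_phase[OF z] by metis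
  then show "bogoliubov a ?Z (bogoliubov a U x) = bogoliubov a U x"
    using x z by (metis comp_apply in_GICAR_iff)
qed

lemma balanced_monomial_GICAR:
  assumes "length hs = length ks"
  shows "creations a hs * annihilations a ks \<in> GICAR a"
  unfolding in_GICAR_iff
proof (intro allI impI)
  fix z :: complex assume z: "cmod z = 1"
  then have "z * cnj z = 1"
    by (simp add: complex_norm_square[symmetric])
  then show "bogoliubov a (\<lambda>h. z *\<^sub>C h) (creations a hs * annihilations a ks)
      = creations a hs * annihilations a ks"
    by (simp add: gauge_monomial[OF z] assms scaleC_one flip: power_mult_distrib)
qed

text \<open>The mean over the finite subgroup of \<open>M\<close>-th roots of unity replaces the integral over the gauge
  group: on polynomials of degree less than \<open>M\<close> both averages agree.\<close>

definition gauge_mean :: "nat \<Rightarrow> 'a \<Rightarrow> 'a" where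
  "gauge_mean M x = (1 / of_nat M) *\<^sub>C (\<Sum>j<M. bogoliubov a (\<lambda>h. root_unity M j *\<^sub>C h) x)"

lemma gauge_mean_linear:
  "gauge_mean M (x + y) = gauge_mean M x + gauge_mean M y"
  "gauge_mean M (x - y) = gauge_mean M x - gauge_mean M y"
  "gauge_mean M (c *\<^sub>C x) = c *\<^sub>C gauge_mean M x"
proof -
  note hom = unital_star_homD[OF bogoliubov(1)[OF unitary_operator_phase[OF norm_root_unity]]]
  show "gauge_mean M (x + y) = gauge_mean M x + gauge_mean M y"
    by (simp add: gauge_mean_def hom sum.distrib scaleC_add_right)
  show "gauge_mean M (x - y) = gauge_mean M x - gauge_mean M y"
    by (simp add: gauge_mean_def hom sum_subtractf complex_vector.scale_right_diff_distrib)
  show "gauge_mean M (c *\<^sub>C x) = c *\<^sub>C gauge_mean M x"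
    by (simp add: gauge_mean_def hom scaleC_scaleC mult.commute flip: complex_vector.scale_sum_right)
qed

lemma norm_gauge_mean_le: "norm (gauge_mean M x) \<le> norm x"
proof (cases "M = 0")
  case False
  have "norm (\<Sum>j<M. bogoliubov a (\<lambda>h. root_unity M j *\<^sub>C h) x) \<le> (\<Sum>j<M. norm x)"
    by (rule sum_norm_le) (simp add: unital_star_hom_norm_le bogoliubov(1) unitary_operator_phase norm_root_unity)
  then show ?thesis
    using False by (simp add: gauge_mean_def norm_scaleC norm_divide field_simps)
qed (simp add: gauge_mean_def)

lemma gauge_mean_GICAR:
  assumes "x \<in> GICAR a" "M > 0"
  shows "gauge_mean M x = x"
proof -
  have "(\<Sum>j<M. bogoliubov a (\<lambda>h. root_unity M j *\<^sub>C h) x) = (\<Sum>j<M. x)"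
    using assms(1) by (intro sum.cong) (simp_all add: in_GICAR_iff norm_root_unity)
  also have "\<dots> = of_nat M *\<^sub>C x"
    unfolding sum_constant_scaleR by (simp add: scaleR_scaleC)
  finally show ?thesis
    using assms(2) by (simp add: gauge_mean_def scaleC_scaleC scaleC_one)
qed

text \<open>The monomial is an eigenvector with eigenvalue \<open>\<zeta>\<^sup>j\<close> for the \<open>j\<close>-th root. As the degrees are
  different and smaller than \<open>M\<close>, \<open>\<zeta>\<close> is a nontrivial \<open>M\<close>-th root of unity, whose powers sum to
  zero.\<close>

lemma gauge_mean_unbalanced:
  assumes neq: "length hs \<noteq> length ks" and M: "length hs < M" "length ks < M"
  shows "gauge_mean M (creations a hs * annihilations a ks) = 0"
proof -
  define \<zeta> where "\<zeta> = root_unity M (length hs) * cnj (root_unity M (length ks))"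
  have M1: "1 \<le> M" using M by linarith
  have unit: "root_unity M j * cnj (root_unity M j) = 1" for j
    by (simp add: complex_norm_square[symmetric] norm_root_unity)
  have pow: "\<zeta> ^ j = root_unity M j ^ length hs * cnj (root_unity M j) ^ length ks" for j
    by (simp add: \<zeta>_def power_mult_distrib root_unity_power mult.commute flip: complex_cnj_power)
  have "root_unity M (length hs) \<noteq> root_unity M (length ks)"
    unfolding root_unity_def complex_root_unity_eq[OF M1] using neq M by simp
  then have "\<zeta> \<noteq> 1"
    unfolding \<zeta>_def using unit[of "length ks"] by (metis mult.commute mult.left_commute mult.right_neutral)
  moreover have "\<zeta> ^ M = 1"
    using M1 by (simp add: \<zeta>_def power_mult_distrib root_unity_def complex_root_unity flip: complex_cnj_power)
  ultimately have "(\<Sum>j<M. \<zeta> ^ j) = 0"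
    by (simp add: geometric_sum)
  moreover have "(\<Sum>j<M. bogoliubov a (\<lambda>h. root_unity M j *\<^sub>C h) (creations a hs * annihilations a ks))
      = (\<Sum>j<M. \<zeta> ^ j) *\<^sub>C (creations a hs * annihilations a ks)"
    by (simp add: gauge_monomial norm_root_unity pow complex_vector.scale_sum_left)
  ultimately show ?thesis
    by (simp add: gauge_mean_def)
qed

lemma gauge_mean_Wick:
  assumes "x \<in> Wick a"
  shows "\<exists>M0. \<forall>M>M0. gauge_mean M x \<in> balanced_Wick a"
  using assms unfolding Wick_def
proof (induction rule: complex_vector.span_induct_alt)
  case base
  have "gauge_mean M 0 = 0" for M
    using gauge_mean_linear(2)[of M 0 0] by simp
  then show ?case
    by (simp add: complex_vector.subspace_0[OF csubspace_balanced_Wick])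
next
  case (step c x y)
  then obtain hs ks where x: "x = creations a hs * annihilations a ks" by blast
  obtain M0 where M0: "\<And>M. M > M0 \<Longrightarrow> gauge_mean M y \<in> balanced_Wick a"
    using step by blast
  have "gauge_mean M x \<in> balanced_Wick a" if M: "M > length hs" "M > length ks" for M
  proof (cases "length hs = length ks")
    case True
    have "x \<in> balanced_Wick a"
      unfolding balanced_Wick_def x using True by (intro complex_vector.span_base) blast
    moreover have "gauge_mean M x = x"
      unfolding x using True M by (intro gauge_mean_GICAR balanced_monomial_GICAR) simp_all
    ultimately show ?thesis by simp
  next
    case False
    show ?thesis
      unfolding x gauge_mean_unbalanced[OF False M] by (rule complex_vector.subspace_0[OF csubspace_balanced_Wick])
  qed
  then show ?case
    using M0
    by (intro exI[of _ "M0 + length hs + length ks"])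
      (auto simp: gauge_mean_linear intro!: complex_vector.subspace_add[OF csubspace_balanced_Wick]
        complex_vector.subspace_scale[OF csubspace_balanced_Wick])
qed

text \<open>Approximate a gauge-invariant element by a normally ordered polynomial and average: the mean fixes the
  element, is contractive, and leaves only the balanced part of the polynomial.\<close>

lemma GICAR_eq_closure: "GICAR a = closure (balanced_Wick a)"
proof
  have "balanced_Wick a \<subseteq> GICAR a"
    unfolding balanced_Wick_def
    by (rule complex_vector.span_minimal) (use balanced_monomial_GICAR GICAR_star_subalgebra(1) in auto)
  then show "closure (balanced_Wick a) \<subseteq> GICAR a"
    using closed_GICAR by (rule closure_minimal)
  show "GICAR a \<subseteq> closure (balanced_Wick a)"
  proof
    fix x assume x: "x \<in> GICAR a"
    show "x \<in> closure (balanced_Wick a)"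
      unfolding closure_approachable
    proof (intro allI impI)
      fix e :: real assume "e > 0"
      then obtain y where y: "y \<in> Wick a" "dist y x < e"
        using Wick_dense closure_approachable[of x "Wick a"] by auto
      obtain M0 where M0: "\<And>M. M > M0 \<Longrightarrow> gauge_mean M y \<in> balanced_Wick a"
        using gauge_mean_Wick[OF y(1)] by blast
      have "gauge_mean (Suc M0) y - x = gauge_mean (Suc M0) (y - x)"
        by (simp add: gauge_mean_linear gauge_mean_GICAR[OF x])
      then have "dist (gauge_mean (Suc M0) y) x < e"
        using norm_gauge_mean_le[of "Suc M0" "y - x"] y(2) by (simp add: dist_norm)
      then show "\<exists>y\<in>balanced_Wick a. dist y x < e"
        using M0[of "Suc M0"] by blast
    qed
  qed
qed

end

section \<open>Second quantization in the GNS representation\<close>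

lemma csubspace_Domain:
  fixes T :: "('h::complex_vector \<times> 'h) set"
  assumes "csubspace T"
  shows "csubspace (Domain T)"
  unfolding complex_vector.subspace_def
proof (intro conjI allI ballI)
  show "0 \<in> Domain T"
    using complex_vector.subspace_0[OF assms] by (auto simp: zero_prod_def)
qed (use csubspace_graphD(1,3)[OF assms] in \<open>blast elim!: DomainE\<close>)+

text \<open>The orbit map of a limit of vectors is a uniform limit of orbit maps.\<close>

lemma continuous_orbits_dense:
  fixes G :: "real \<Rightarrow> 'k::complex_hilbert_space \<Rightarrow> 'k"
  assumes le: "\<And>t p q. dist (G t p) (G t q) \<le> dist p q" and dense: "closure D = UNIV"
    and cont: "\<And>\<xi>. \<xi> \<in> D \<Longrightarrow> continuous_on UNIV (\<lambda>t. G t \<xi>)"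
  shows "continuous_on UNIV (\<lambda>t. G t \<xi>)"
proof -
  obtain x where x: "\<And>n. x n \<in> D" "x \<longlonglongrightarrow> \<xi>"
    using dense closure_sequential[of \<xi> D] by auto
  have "uniform_limit UNIV (\<lambda>n t. G t (x n)) (\<lambda>t. G t \<xi>) sequentially"
  proof (rule uniform_limitI)
    fix e :: real assume "e > 0"
    then have "\<forall>\<^sub>F n in sequentially. dist (x n) \<xi> < e"
      using x(2) by (simp add: tendsto_iff)
    then show "\<forall>\<^sub>F n in sequentially. \<forall>t\<in>UNIV. dist (G t (x n)) (G t \<xi>) < e"
      by (rule eventually_mono) (use le le_less_trans in blast)
  qed
  then show ?thesis
    by (rule uniform_limit_theorem[rotated]) (use cont x(1) in simp_all)
qed

lemma state_linear:
  assumes "state \<phi>"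
  shows "\<phi> (x + y) = \<phi> x + \<phi> y" "\<phi> (c *\<^sub>C x) = c * \<phi> x"
  using assms unfolding state_def Vector_Spaces.linear_iff by blast+

lemma state_bounded:
  assumes "state \<phi>"
  shows "bounded_linear \<phi>" "cmod (\<phi> x) \<le> norm x"
  using assms onorm[of \<phi> x] by (simp_all add: state_def)

text \<open>Both sides are continuous and linear in \<open>x\<close>, so normally ordered monomials suffice. There the
  matrix entries \<open>\<langle>K U h, U k\<rangle>\<close> and \<open>\<langle>K h, k\<rangle>\<close> are equal.\<close>

lemma state_invariant:
  assumes CAR: "CAR_algebra a" and qf: "quasi_free_state a K \<phi>"
    and U: "unitary_operator U" and UK: "U \<circ> K = K \<circ> U"
  shows "\<phi> (bogoliubov a U x) = \<phi> x"
proof -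
  have st: "state \<phi>"
    using qf by (simp add: quasi_free_state_def)
  note hom = unital_star_homD[OF bogoliubov(1)[OF CAR U]]
  have qf': "\<phi> (creations a hs * annihilations a ks) = (if length hs = length ks
      then Determinant.det (mat (length hs) (length hs) (\<lambda>(i, j). cinner (K (rev hs ! i)) (ks ! j))) else 0)" for hs ks
    using qf unfolding quasi_free_state_def by (metis length_rev rev_rev_ident)
  have mono: "\<phi> (bogoliubov a U (creations a hs * annihilations a ks)) = \<phi> (creations a hs * annihilations a ks)" for hs ks
  proof -
    have "mat (length hs) (length hs) (\<lambda>(i, j). cinner (K (rev (map U hs) ! i)) (map U ks ! j))
        = mat (length hs) (length hs) (\<lambda>(i, j). cinner (K (rev hs ! i)) (ks ! j))" if len: "length hs = length ks"
    proof (rule cong_mat, simp_all)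
      fix i j assume ij: "i < length hs" "j < length hs"
      have "K (U (rev hs ! i)) = U (K (rev hs ! i))"
        using UK by (metis comp_apply)
      then show "cinner (K (rev (map U hs) ! i)) (map U ks ! j) = cinner (K (rev hs ! i)) (ks ! j)"
        using ij len unitary_operatorD(3)[OF U] by (simp add: rev_map)
    qed
    then show ?thesis
      unfolding bogoliubov_monomial[OF CAR U] qf' by simp
  qed
  have "x \<in> {x. \<phi> (bogoliubov a U x) = \<phi> x}"
  proof (rule closed_superset_of_dense[OF _ Wick_dense[OF CAR]])
    have "bounded_linear (\<lambda>x. \<phi> (bogoliubov a U x))"
      by (rule bounded_linear_compose[OF state_bounded(1)[OF st] unital_star_hom_bounded_linear[OF bogoliubov(1)[OF CAR U]]])
    then show "closed {x. \<phi> (bogoliubov a U x) = \<phi> x}"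
      by (intro closed_Collect_eq linear_continuous_on state_bounded(1)[OF st])
    fix x assume "x \<in> Wick a"
    then show "x \<in> {x. \<phi> (bogoliubov a U x) = \<phi> x}"
      unfolding Wick_def
    proof (induction rule: complex_vector.span_induct_alt)
      case base
      then show ?case
        using hom(6)[of 0 0] by simp
    next
      case (step c x y)
      then show ?case
        using mono by (auto simp: hom state_linear[OF st])
    qed
  qed
  then show ?thesis by simp
qed

lemma GNS_dense: "GNS_triple S \<phi> \<rho> \<Omega> \<Longrightarrow> closure ((\<lambda>x. \<rho> x \<Omega>) ` S) = UNIV"
  by (simp add: GNS_triple_def)

lemma second_quantization_unique:
  assumes GNS: "GNS_triple (GICAR a) \<phi> \<rho> \<Omega>"
    and sq: "is_second_quantization a \<rho> \<Omega> U \<Gamma>" "is_second_quantization a \<rho> \<Omega> U \<Gamma>'"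
  shows "\<Gamma> = \<Gamma>'"
proof (intro ext)
  fix t \<xi>
  have "\<xi> \<in> {\<xi>. \<Gamma> t \<xi> = \<Gamma>' t \<xi>}"
  proof (rule closed_superset_of_dense[OF _ GNS_dense[OF GNS]])
    show "closed {\<xi>. \<Gamma> t \<xi> = \<Gamma>' t \<xi>}"
      using sq unfolding is_second_quantization_def
      by (intro closed_Collect_eq linear_continuous_on unitary_bounded_linear unitary_group_unitary) blast+
  qed (use sq in \<open>auto simp: is_second_quantization_def\<close>)
  then show "\<Gamma> t \<xi> = \<Gamma>' t \<xi>" by simp
qed

lemma monomial_in_V_tilde:
  "length hs = length ks \<Longrightarrow> set hs \<subseteq> V \<Longrightarrow> set ks \<subseteq> V \<Longrightarrow>
    \<rho> (creations a hs * annihilations a ks) \<Omega> \<in> V_tilde a \<rho> \<Omega> V"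
  unfolding V_tilde_def by (rule complex_vector.span_base) blast

lemma csubspace_V_tilde: "csubspace (V_tilde a \<rho> \<Omega> V)"
  unfolding V_tilde_def by (rule complex_vector.subspace_span)

lemma V_tilde_invariant:
  assumes CAR: "CAR_algebra a" and U: "unitary_group U" and V: "\<And>t. U t ` V \<subseteq> V"
    and \<Gamma>: "is_second_quantization a \<rho> \<Omega> U \<Gamma>" and \<xi>: "\<xi> \<in> V_tilde a \<rho> \<Omega> V"
  shows "\<Gamma> t \<xi> \<in> V_tilde a \<rho> \<Omega> V"
  using \<xi>[unfolded V_tilde_def]
proof (induction rule: complex_vector.span_induct_alt)
  have grp: "unitary_group \<Gamma>"
    using \<Gamma> by (simp add: is_second_quantization_def)
  note unit = unitary_group_unitary[OF grp]
  note lin = unitary_operatorD(1)[OF unit]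
  note sub = csubspace_V_tilde[of a \<rho> \<Omega> V]
  {
    case base
    then show ?case
      using clinear_diff[OF lin, of t 0 0] complex_vector.subspace_0[OF sub] by simp
  next
    case (step c x y)
    then obtain hs ks where x: "x = \<rho> (creations a hs * annihilations a ks) \<Omega>"
      and len: "length hs = length ks" and "set hs \<subseteq> V" "set ks \<subseteq> V"
      by blast
    then have "\<rho> (creations a (map (U t) hs) * annihilations a (map (U t) ks)) \<Omega> \<in> V_tilde a \<rho> \<Omega> V"
      using V[of t] by (intro monomial_in_V_tilde) auto
    moreover have "\<Gamma> t x = \<rho> (creations a (map (U t) hs) * annihilations a (map (U t) ks)) \<Omega>"
      using \<Gamma> balanced_monomial_GICAR[OF CAR len] bogoliubov_monomial[OF CAR unitary_group_unitary[OF U]]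
      by (simp add: x is_second_quantization_def)
    ultimately show ?case
      using step.IH
      by (simp add: clinear_add[OF lin] clinear_scaleC[OF lin] complex_vector.subspace_add[OF sub]
          complex_vector.subspace_scale[OF sub])
  }
qed

context
  fixes a :: "'h::complex_hilbert_space \<Rightarrow> 'a::unital_cstar_algebra"
    and \<phi> :: "'a \<Rightarrow> complex"
    and \<rho> :: "'a \<Rightarrow> 'k::complex_hilbert_space \<Rightarrow> 'k"
    and \<Omega> :: 'k
  assumes CAR: "CAR_algebra a" and st: "state \<phi>" and GNS: "GNS_triple (GICAR a) \<phi> \<rho> \<Omega>"
begin

lemma GNS_rep:
  assumes "x \<in> GICAR a" "y \<in> GICAR a"
  shows "\<rho> (x + y) \<Omega> = \<rho> x \<Omega> + \<rho> y \<Omega>" "\<rho> (c *\<^sub>C x) \<Omega> = c *\<^sub>C \<rho> x \<Omega>"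
    "\<rho> (x - y) \<Omega> = \<rho> x \<Omega> - \<rho> y \<Omega>"
    "cinner (\<rho> x \<Omega>) (\<rho> y \<Omega>) = \<phi> (star y * x)"
proof -
  have rep: "star_representation (GICAR a) \<rho>"
    using GNS by (simp add: GNS_triple_def)
  have add: "\<rho> (x + y) \<Omega> = \<rho> x \<Omega> + \<rho> y \<Omega>" if "x \<in> GICAR a" "y \<in> GICAR a" for x y
    using rep that by (simp add: star_representation_def)
  show "\<rho> (x + y) \<Omega> = \<rho> x \<Omega> + \<rho> y \<Omega>" "\<rho> (c *\<^sub>C x) \<Omega> = c *\<^sub>C \<rho> x \<Omega>"
    using rep assms by (simp_all add: star_representation_def)
  show "\<rho> (x - y) \<Omega> = \<rho> x \<Omega> - \<rho> y \<Omega>"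
    using add[of "x - y" y] assms complex_vector.subspace_diff[OF GICAR_star_subalgebra(1)[OF CAR]]
    by simp
  have "cinner (\<rho> x \<Omega>) (\<rho> y \<Omega>) = cinner (\<rho> (star y) (\<rho> x \<Omega>)) \<Omega>"
    using rep assms by (simp add: star_representation_def)
  also have "\<rho> (star y) (\<rho> x \<Omega>) = \<rho> (star y * x) \<Omega>"
    using rep assms GICAR_star_subalgebra(4)[OF CAR] by (simp add: star_representation_def)
  also have "cinner \<dots> \<Omega> = \<phi> (star y * x)"
    using GNS assms GICAR_star_subalgebra(3,4)[OF CAR] by (simp add: GNS_triple_def)
  finally show "cinner (\<rho> x \<Omega>) (\<rho> y \<Omega>) = \<phi> (star y * x)" .
qed

lemma norm_GNS_le:
  assumes "x \<in> GICAR a"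
  shows "norm (\<rho> x \<Omega>) \<le> norm x"
proof -
  have "(norm (\<rho> x \<Omega>))\<^sup>2 = cmod (\<phi> (star x * x))"
    by (simp add: norm_power flip: GNS_rep(4)[OF assms assms] cinner_self)
      (simp add: cinner_self norm_power)
  also have "\<dots> \<le> (norm x)\<^sup>2"
    using state_bounded(2)[OF st, of "star x * x"] by (simp add: cstar_identity)
  finally show ?thesis
    by (rule power2_le_imp_le) simp
qed

lemma dist_GNS_le:
  assumes "x \<in> GICAR a" "y \<in> GICAR a"
  shows "dist (\<rho> x \<Omega>) (\<rho> y \<Omega>) \<le> dist x y"
  unfolding dist_norm GNS_rep(3)[OF assms, symmetric]
  by (intro norm_GNS_le complex_vector.subspace_diff[OF GICAR_star_subalgebra(1)[OF CAR]] assms)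

lemma continuous_on_GNS: "continuous_on (GICAR a) (\<lambda>x. \<rho> x \<Omega>)"
  unfolding continuous_on_iff using dist_GNS_le le_less_trans by blast

text \<open>Monomials in arbitrary vectors are limits of monomials in vectors of \<open>V\<close>; they span a dense
  subspace of the GICAR algebra; and \<open>\<Omega>\<close> is cyclic.\<close>

lemma V_tilde_dense:
  assumes dense: "closure V = UNIV"
  shows "closure (V_tilde a \<rho> \<Omega> V) = UNIV"
proof -
  define T where "T = closure (V_tilde a \<rho> \<Omega> V)"
  have clT: "closed T" and subT: "csubspace T"
    by (simp_all add: T_def csubspace_closure_hilbert csubspace_V_tilde)
  have "\<forall>h. \<exists>s. (\<forall>n. s n \<in> V) \<and> s \<longlonglongrightarrow> h"
    using dense closure_sequential[of _ V] by blast
  then obtain s where s: "\<And>h n. s h n \<in> V" "\<And>h. s h \<longlonglongrightarrow> h"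
    by metis
  have mono: "\<rho> (creations a hs * annihilations a ks) \<Omega> \<in> T" if len: "length hs = length ks" for hs ks
  proof (rule closed_sequentially[OF clT])
    let ?m = "\<lambda>n. creations a (map (\<lambda>h. s h n) hs) * annihilations a (map (\<lambda>h. s h n) ks)"
    show "\<rho> (?m n) \<Omega> \<in> T" for n
      unfolding T_def
      by (rule subsetD[OF closure_subset], rule monomial_in_V_tilde) (use len s(1) in auto)
    have "(\<lambda>n. creations a (map (\<lambda>h. s h n) hs)) \<longlonglongrightarrow> creations a hs"
      by (induction hs)
        (auto simp: creations_Cons intro!: tendsto_mult s bounded_linear.tendsto[OF bounded_linear_star_a[OF CAR]])
    moreover have "(\<lambda>n. annihilations a (map (\<lambda>h. s h n) ks)) \<longlonglongrightarrow> annihilations a ks"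
      by (induction ks)
        (auto simp: annihilations_Cons intro!: tendsto_mult s bounded_linear.tendsto[OF bounded_linear_a[OF CAR]])
    ultimately have "?m \<longlonglongrightarrow> creations a hs * annihilations a ks"
      by (rule tendsto_mult)
    then show "(\<lambda>n. \<rho> (?m n) \<Omega>) \<longlonglongrightarrow> \<rho> (creations a hs * annihilations a ks) \<Omega>"
      by (rule continuous_on_tendsto_compose[OF continuous_on_GNS])
        (use len balanced_monomial_GICAR[OF CAR] in simp_all)
  qed
  have bal: "x \<in> GICAR a \<and> \<rho> x \<Omega> \<in> T" if "x \<in> balanced_Wick a" for x
    using that unfolding balanced_Wick_def
  proof (induction rule: complex_vector.span_induct_alt)
    case base
    then show ?case
      using complex_vector.subspace_0[OF GICAR_star_subalgebra(1)[OF CAR]] GNS_rep(3)[of 0 0]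
        complex_vector.subspace_0[OF subT] by simp
  next
    case (step c x y)
    then have x: "x \<in> GICAR a" "\<rho> x \<Omega> \<in> T"
      using mono balanced_monomial_GICAR[OF CAR] by auto
    have cx: "c *\<^sub>C x \<in> GICAR a"
      using complex_vector.subspace_scale[OF GICAR_star_subalgebra(1)[OF CAR] x(1)] .
    then show ?case
      using step.IH x GNS_rep(1)[OF cx, of y] GNS_rep(2)[OF x(1) x(1)]
      by (simp add: complex_vector.subspace_add[OF GICAR_star_subalgebra(1)[OF CAR]]
          complex_vector.subspace_add[OF subT] complex_vector.subspace_scale[OF subT])
  qed
  have "\<rho> x \<Omega> \<in> T" if x: "x \<in> GICAR a" for x
  proof -
    obtain u where u: "\<And>n. u n \<in> balanced_Wick a" "u \<longlonglongrightarrow> x"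
      using x unfolding GICAR_eq_closure[OF CAR] closure_sequential by blast
    have "(\<lambda>n. \<rho> (u n) \<Omega>) \<longlonglongrightarrow> \<rho> x \<Omega>"
      by (rule continuous_on_tendsto_compose[OF continuous_on_GNS u(2) x]) (use bal u in simp)
    then show ?thesis
      by (rule closed_sequentially[OF clT, rotated]) (use bal u in simp)
  qed
  then have "closure ((\<lambda>x. \<rho> x \<Omega>) ` GICAR a) \<subseteq> T"
    by (intro closure_minimal clT) auto
  then show ?thesis
    using GNS_dense[OF GNS] by (auto simp: T_def)
qed

text \<open>Invariance of the state makes \<open>\<rho> x \<Omega> \<mapsto> \<rho> (\<gamma> x) \<Omega>\<close> isometric; the rest is extension by
  continuity.\<close>

lemma second_quantization_isometry:
  assumes qf: "quasi_free_state a K \<phi>" and U: "unitary_operator U" and UK: "U \<circ> K = K \<circ> U"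
  obtains T where "clinear T" "\<And>\<xi>. norm (T \<xi>) = norm \<xi>"
    "\<And>x. x \<in> GICAR a \<Longrightarrow> T (\<rho> x \<Omega>) = \<rho> (bogoliubov a U x) \<Omega>"
proof -
  let ?v = "\<lambda>x. \<rho> x \<Omega>" and ?\<gamma> = "bogoliubov a U"
  note hom = unital_star_homD[OF bogoliubov(1)[OF CAR U]]
  note inv = bogoliubov_GICAR[OF CAR U]
  note sub = GICAR_star_subalgebra(1)[OF CAR]
  have iso: "norm (?v (?\<gamma> x)) = norm (?v x)" if x: "x \<in> GICAR a" for x
  proof -
    have "cinner (?v (?\<gamma> x)) (?v (?\<gamma> x)) = cinner (?v x) (?v x)"
      using state_invariant[OF CAR qf U UK, of "star x * x"] x
      by (simp add: GNS_rep(4) inv hom)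
    then show ?thesis
      by (simp add: norm_eq_sqrt_inner inner_eq_Re_cinner)
  qed
  obtain T where T: "\<And>x. x \<in> GICAR a \<Longrightarrow> T (?v x) = ?v (?\<gamma> x)" and le: "\<And>p q. dist (T p) (T q) \<le> dist p q"
  proof (rule nonexpansive_extension[OF _ GNS_dense[OF GNS]])
    fix x y assume xy: "x \<in> GICAR a" "y \<in> GICAR a"
    have "?v (?\<gamma> x) - ?v (?\<gamma> y) = ?v (?\<gamma> (x - y))"
      using xy by (simp add: GNS_rep(3) inv hom)
    then show "dist (?v (?\<gamma> x)) (?v (?\<gamma> y)) \<le> dist (?v x) (?v y)"
      using iso[of "x - y"] xy complex_vector.subspace_diff[OF sub]
      by (simp add: dist_norm GNS_rep(3))
  qed blast
  note cont = nonexpansive_continuous_on[OF le, of UNIV]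
  have cont': "continuous_on UNIV (\<lambda>x. T (g x))" if "continuous_on UNIV g" for g :: "'x::topological_space \<Rightarrow> 'k"
    using continuous_on_compose2[OF cont that] by simp
  have "T (p + q) = T p + T q" for p q
  proof -
    have "(p, q) \<in> {r. T (fst r + snd r) = T (fst r) + T (snd r)}"
    proof (rule closed_superset_of_dense)
      show "closed {r. T (fst r + snd r) = T (fst r) + T (snd r)}"
        by (intro closed_Collect_eq continuous_intros cont')
      show "closure (?v ` GICAR a \<times> ?v ` GICAR a) = UNIV"
        by (simp add: closure_Times GNS_dense[OF GNS])
      fix r assume "r \<in> ?v ` GICAR a \<times> ?v ` GICAR a"
      then obtain x y where xy: "x \<in> GICAR a" "y \<in> GICAR a" "r = (?v x, ?v y)" by blast
      have "T (?v x + ?v y) = ?v (?\<gamma> (x + y))"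
        using T[of "x + y"] xy complex_vector.subspace_add[OF sub] by (simp add: GNS_rep(1))
      then show "r \<in> {r. T (fst r + snd r) = T (fst r) + T (snd r)}"
        using xy by (simp add: T hom GNS_rep(1) inv)
    qed
    then show ?thesis by simp
  qed
  moreover have "T (c *\<^sub>C p) = c *\<^sub>C T p" for c p
  proof -
    have "p \<in> {p. T (c *\<^sub>C p) = c *\<^sub>C T p}"
    proof (rule closed_superset_of_dense[OF _ GNS_dense[OF GNS]])
      show "closed {p. T (c *\<^sub>C p) = c *\<^sub>C T p}"
        by (intro closed_Collect_eq continuous_intros cont cont'
            bounded_bilinear.continuous_on[OF bounded_bilinear_scaleC_hilbert])
      fix p assume "p \<in> ?v ` GICAR a"
      then obtain x where x: "x \<in> GICAR a" "p = ?v x" by blast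
      have "T (c *\<^sub>C ?v x) = ?v (?\<gamma> (c *\<^sub>C x))"
        using T[of "c *\<^sub>C x"] x complex_vector.subspace_scale[OF sub] by (simp add: GNS_rep(2)[OF x(1) x(1)])
      then show "p \<in> {p. T (c *\<^sub>C p) = c *\<^sub>C T p}"
        using x by (simp add: T hom GNS_rep(2)[OF inv inv])
    qed
    then show ?thesis by simp
  qed
  moreover have "norm (T \<xi>) = norm \<xi>" for \<xi>
  proof -
    have "\<xi> \<in> {\<xi>. norm (T \<xi>) = norm \<xi>}"
      by (rule closed_superset_of_dense[OF _ GNS_dense[OF GNS]])
        (use T iso in \<open>auto intro!: closed_Collect_eq continuous_intros cont\<close>)
    then show ?thesis by simp
  qed
  ultimately show thesis
    using that T by (blast intro: clinearI)
qed

lemma second_quantization_exists: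
  assumes qf: "quasi_free_state a K \<phi>" and U: "unitary_group U" and UK: "\<And>t. U t \<circ> K = K \<circ> U t"
  obtains \<Gamma> where "is_second_quantization a \<rho> \<Omega> U \<Gamma>"
proof -
  note unit = unitary_group_unitary[OF U]
  have "\<exists>T. clinear T \<and> (\<forall>\<xi>. norm (T \<xi>) = norm \<xi>) \<and>
      (\<forall>x\<in>GICAR a. T (\<rho> x \<Omega>) = \<rho> (bogoliubov a (U t) x) \<Omega>)" for t
    by (rule second_quantization_isometry[OF qf unit[of t] UK[of t]]) blast
  then obtain \<Gamma> where lin: "\<And>t. clinear (\<Gamma> t)" and norm: "\<And>t \<xi>. norm (\<Gamma> t \<xi>) = norm \<xi>"
    and \<Gamma>: "\<And>t x. x \<in> GICAR a \<Longrightarrow> \<Gamma> t (\<rho> x \<Omega>) = \<rho> (bogoliubov a (U t) x) \<Omega>"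
    by metis
  have le: "dist (\<Gamma> t p) (\<Gamma> t q) \<le> dist p q" for t p q
    by (simp add: dist_norm norm flip: clinear_diff[OF lin])
  have cont: "continuous_on S (\<Gamma> t)" for S t
    by (rule nonexpansive_continuous_on) (rule le)
  have add: "\<Gamma> (s + t) \<xi> = \<Gamma> s (\<Gamma> t \<xi>)" for s t \<xi>
  proof -
    have "U (s + t) = U s \<circ> U t"
      using U by (simp add: unitary_group_def)
    then have bog: "bogoliubov a (U (s + t)) = bogoliubov a (U s) \<circ> bogoliubov a (U t)"
      by (simp add: bogoliubov_comp[OF CAR unit unit])
    have "\<xi> \<in> {\<xi>. \<Gamma> (s + t) \<xi> = \<Gamma> s (\<Gamma> t \<xi>)}"
    proof (rule closed_superset_of_dense[OF _ GNS_dense[OF GNS]])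
      show "closed {\<xi>. \<Gamma> (s + t) \<xi> = \<Gamma> s (\<Gamma> t \<xi>)}"
        by (intro closed_Collect_eq cont continuous_on_compose2[OF cont cont]) auto
    qed (auto simp: \<Gamma> bog bogoliubov_GICAR[OF CAR unit])
    then show ?thesis by simp
  qed
  have zero: "\<Gamma> 0 \<xi> = \<xi>" for \<xi>
  proof -
    have "norm (\<Gamma> 0 (\<Gamma> 0 \<xi> - \<xi>)) = 0"
      using add[of 0 0 \<xi>] by (simp add: clinear_diff[OF lin])
    then show ?thesis
      unfolding norm by simp
  qed
  have "unitary_operator (\<Gamma> t)" for t
  proof (rule clinear_isometry_unitary[OF lin norm])
    have "\<Gamma> t (\<Gamma> (- t) \<xi>) = \<xi>" for \<xi>
      using add[of t "- t" \<xi>] by (simp add: zero)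
    then show "surj (\<Gamma> t)"
      by (metis surjI)
  qed
  moreover have "continuous_on UNIV (\<lambda>t. \<Gamma> t \<xi>)" for \<xi>
  proof (rule continuous_orbits_dense[OF le V_tilde_dense[OF closure_UNIV]])
    fix \<xi> assume "\<xi> \<in> V_tilde a \<rho> \<Omega> UNIV"
    then show "continuous_on UNIV (\<lambda>t. \<Gamma> t \<xi>)"
      unfolding V_tilde_def
    proof (induction rule: complex_vector.span_induct_alt)
      case base
      have "\<Gamma> t 0 = 0" for t
        using norm[of t 0] by simp
      then show ?case by simp
    next
      case (step c x y)
      then obtain hs ks where x: "x = \<rho> (creations a hs * annihilations a ks) \<Omega>"
        and len: "length hs = length ks"
        by blast
      have contU: "continuous_on UNIV (\<lambda>t. U t h)" for h
        using U by (simp add: unitary_group_def)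
      let ?m = "\<lambda>t. creations a (map (U t) hs) * annihilations a (map (U t) ks)"
      have "continuous_on UNIV (\<lambda>t. creations a (map (U t) hs))"
        by (induction hs)
          (auto simp: creations_Cons intro!: continuous_intros bounded_linear.continuous_on[OF bounded_linear_star_a[OF CAR]] contU)
      moreover have "continuous_on UNIV (\<lambda>t. annihilations a (map (U t) ks))"
        by (induction ks)
          (auto simp: annihilations_Cons intro!: continuous_intros bounded_linear.continuous_on[OF bounded_linear_a[OF CAR]] contU)
      ultimately have "continuous_on UNIV ?m"
        by (rule continuous_on_mult)
      then have "continuous_on UNIV (\<lambda>t. \<rho> (?m t) \<Omega>)"
        by (rule continuous_on_compose2[OF continuous_on_GNS]) (use len balanced_monomial_GICAR[OF CAR] in auto)
      then have "continuous_on UNIV (\<lambda>t. \<Gamma> t x)"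
        by (simp add: x \<Gamma> balanced_monomial_GICAR[OF CAR] len bogoliubov_monomial[OF CAR unit])
      then show ?case
        unfolding clinear_add[OF lin] clinear_scaleC[OF lin]
        by (intro continuous_intros bounded_bilinear.continuous_on[OF bounded_bilinear_scaleC_hilbert] step.IH)
    qed
  qed
  ultimately have "unitary_group \<Gamma>"
    by (simp add: unitary_group_def add fun_eq_iff)
  then have "is_second_quantization a \<rho> \<Omega> U \<Gamma>"
    using \<Gamma> by (simp add: is_second_quantization_def)
  then show thesis
    by (rule that)
qed

text \<open>Since \<open>a\<close> is real-linear and bounded, \<open>t \<mapsto> a (U t h)\<close> is differentiable for \<open>h \<in> V\<close>, and so are the
  monomials by the product rule. The difference quotients and their limit lie in the closed GICAR algebra,
  on which \<open>x \<mapsto> \<rho> x \<Omega>\<close> is continuous.\<close>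

lemma V_tilde_in_Domain:
  assumes U: "unitary_group U" and V: "V \<subseteq> Domain (generator U)"
    and \<Gamma>: "is_second_quantization a \<rho> \<Omega> U \<Gamma>"
  shows "V_tilde a \<rho> \<Omega> V \<subseteq> Domain (generator \<Gamma>)"
proof -
  note unit = unitary_group_unitary[OF U]
  have grp: "unitary_group \<Gamma>"
    and \<Gamma>: "\<And>t x. x \<in> GICAR a \<Longrightarrow> \<Gamma> t (\<rho> x \<Omega>) = \<rho> (bogoliubov a (U t) x) \<Omega>"
    using \<Gamma> by (auto simp: is_second_quantization_def)
  note sub = GICAR_star_subalgebra(1)[OF CAR]
  have "\<rho> (creations a hs * annihilations a ks) \<Omega> \<in> Domain (generator \<Gamma>)"
    if len: "length hs = length ks" and hs: "set hs \<subseteq> V" and ks: "set ks \<subseteq> V" for hs ks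
  proof -
    have der: "\<exists>d. ((\<lambda>t. U t h) has_vector_derivative d) (at 0)" if "h \<in> V" for h
      using V that in_generator_iff[OF U] by blast
    have "\<exists>d. ((\<lambda>t. creations a (map (U t) hs)) has_vector_derivative d) (at 0)"
      using hs
    proof (induction hs)
      case (Cons h hs)
      obtain d e where "((\<lambda>t. U t h) has_vector_derivative d) (at 0)"
        "((\<lambda>t. creations a (map (U t) hs)) has_vector_derivative e) (at 0)"
        using Cons der[of h] by auto
      from has_vector_derivative_mult[OF
          bounded_linear.has_vector_derivative[OF bounded_linear_star_a[OF CAR] this(1)] this(2)]
      show ?case
        by (auto simp: creations_Cons)
    qed (auto intro: has_vector_derivative_const)
    moreover have "\<exists>d. ((\<lambda>t. annihilations a (map (U t) ks)) has_vector_derivative d) (at 0)"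
      using ks
    proof (induction ks)
      case (Cons h ks)
      obtain d e where "((\<lambda>t. U t h) has_vector_derivative d) (at 0)"
        "((\<lambda>t. annihilations a (map (U t) ks)) has_vector_derivative e) (at 0)"
        using Cons der[of h] by auto
      from has_vector_derivative_mult[OF
          bounded_linear.has_vector_derivative[OF bounded_linear_a[OF CAR] this(1)] this(2)]
      show ?case
        by (auto simp: annihilations_Cons)
    qed (auto intro: has_vector_derivative_const)
    moreover define m where "m = (\<lambda>t. creations a (map (U t) hs) * annihilations a (map (U t) ks))"
    ultimately obtain d where "(m has_vector_derivative d) (at 0)"
      using has_vector_derivative_mult by blast
    then have lim: "((\<lambda>t. (m t - m 0) /\<^sub>R t) \<longlongrightarrow> d) (at 0)"
      by (simp add: has_vector_derivative_at_0_iff)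
    have m: "m t \<in> GICAR a" for t
      by (simp add: m_def balanced_monomial_GICAR[OF CAR] len)
    have m0: "m 0 = creations a hs * annihilations a ks"
      by (simp add: m_def unitary_group_0[OF U] map_idI)
    have diff: "m t - m 0 \<in> GICAR a" for t
      by (rule complex_vector.subspace_diff[OF sub m m])
    have quot: "(m t - m 0) /\<^sub>R t \<in> GICAR a" for t
      unfolding scaleR_scaleC by (rule complex_vector.subspace_scale[OF sub diff])
    have d: "d \<in> GICAR a"
      by (rule Lim_in_closed_set[OF closed_GICAR[OF CAR] _ _ lim]) (simp_all add: quot)
    have "((\<lambda>t. \<rho> ((m t - m 0) /\<^sub>R t) \<Omega>) \<longlongrightarrow> \<rho> d \<Omega>) (at 0)"
      by (rule continuous_on_tendsto_compose[OF continuous_on_GNS lim d]) (simp add: quot)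
    moreover have "\<rho> ((m t - m 0) /\<^sub>R t) \<Omega> = (\<Gamma> t (\<rho> (m 0) \<Omega>) - \<Gamma> 0 (\<rho> (m 0) \<Omega>)) /\<^sub>R t" for t
    proof -
      have "bogoliubov a (U t) (m 0) = m t"
        unfolding m0 by (simp add: m_def bogoliubov_monomial[OF CAR unit])
      then have "\<Gamma> t (\<rho> (m 0) \<Omega>) = \<rho> (m t) \<Omega>"
        by (simp add: \<Gamma> m)
      then show ?thesis
        by (simp add: unitary_group_0[OF grp] scaleR_scaleC GNS_rep(2)[OF diff m] GNS_rep(3)[OF m m])
    qed
    ultimately have "((\<lambda>t. \<Gamma> t (\<rho> (m 0) \<Omega>)) has_vector_derivative \<i> *\<^sub>C ((- \<i>) *\<^sub>C \<rho> d \<Omega>)) (at 0)"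
      by (simp add: has_vector_derivative_at_0_iff scaleC_scaleC scaleC_one)
    then have "(\<rho> (m 0) \<Omega>, (- \<i>) *\<^sub>C \<rho> d \<Omega>) \<in> generator \<Gamma>"
      unfolding in_generator_iff[OF grp] .
    then show ?thesis
      by (auto simp: m0)
  qed
  then show ?thesis
    unfolding V_tilde_def
    by (intro complex_vector.span_minimal csubspace_Domain csubspace_generator grp) auto
qed

end

theorem proposition4p1:
  fixes a :: "'h::complex_hilbert_space \<Rightarrow> 'a::unital_cstar_algebra"
    and K :: "'h \<Rightarrow> 'h"
    and \<phi> :: "'a \<Rightarrow> complex"
    and \<rho> :: "'a \<Rightarrow> 'k::complex_hilbert_space \<Rightarrow> 'k"
    and \<Omega> :: 'k
    and A :: "'h unbounded_operator"
    and U :: "real \<Rightarrow> 'h \<Rightarrow> 'h"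
  assumes separable: "separable_space (euclidean :: 'h topology)"
    and CAR: "CAR_algebra a"
    and K_nonneg: "positive_operator K"
    and K_le_1: "positive_operator (\<lambda>h. h - K h)"
    and quasi_free: "quasi_free_state a K \<phi>"
    and GNS: "GNS_triple (GICAR a) \<phi> \<rho> \<Omega>"
    and A: "self_adjoint A"
    and U: "U = exp_i A"
    and commutes: "\<And>t. U t \<circ> K = K \<circ> U t"
  shows "(\<exists>!\<Gamma>. is_second_quantization a \<rho> \<Omega> U \<Gamma>) \<and>
    (\<forall>V. csubspace V \<and> closure V = UNIV \<and> V \<subseteq> Domain A \<and> (\<forall>t. U t ` V \<subseteq> V) \<longrightarrow>
       is_core (V_tilde a \<rho> \<Omega> V) (generator (second_quantization a \<rho> \<Omega> U)))"
proof -
  have U_group: "unitary_group U" and U_gen: "generator U = A"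
    using stone[OF A] by (simp_all add: U)
  have st: "state \<phi>"
    using quasi_free by (simp add: quasi_free_state_def)
  obtain \<Gamma> where \<Gamma>: "is_second_quantization a \<rho> \<Omega> U \<Gamma>"
    using second_quantization_exists[OF CAR st GNS quasi_free U_group commutes] .
  have ex1: "\<exists>!\<Gamma>. is_second_quantization a \<rho> \<Omega> U \<Gamma>"
    using \<Gamma> second_quantization_unique[OF GNS] by blast
  have eq: "second_quantization a \<rho> \<Omega> U = \<Gamma>"
    unfolding second_quantization_def 
    by (rule the1_equality[where P = "is_second_quantization a \<rho> \<Omega> U", OF ex1 \<Gamma>])
  have "is_core (V_tilde a \<rho> \<Omega> V) (generator \<Gamma>)"
    if V: "closure V = UNIV" "V \<subseteq> Domain A" "\<And>t. U t ` V \<subseteq> V" for V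
  proof (rule core_of_invariant_dense)
    show "unitary_group \<Gamma>"
      using \<Gamma> by (simp add: is_second_quantization_def)
    show "csubspace (V_tilde a \<rho> \<Omega> V)"
      by (rule csubspace_V_tilde)
    show "closure (V_tilde a \<rho> \<Omega> V) = UNIV"
      by (rule V_tilde_dense[OF CAR st GNS V(1)])
    show "V_tilde a \<rho> \<Omega> V \<subseteq> Domain (generator \<Gamma>)"
      using V(2) by (intro V_tilde_in_Domain[OF CAR st GNS U_group _ \<Gamma>]) (simp add: U_gen)
    show "\<Gamma> t \<xi> \<in> V_tilde a \<rho> \<Omega> V" if "\<xi> \<in> V_tilde a \<rho> \<Omega> V" for t \<xi>
      using V_tilde_invariant[OF CAR U_group V(3) \<Gamma> that] .
  qed
  then show ?thesis
    using ex1 by (auto simp: eq)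
qed

end
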